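(* Let $N=N(n)$ be a sequence of integers with $N/n\to c\in(0,\infty)$ as $n\to\infty$, and assume the following. (A-1) The random variables $(X_{ij}^n;\,1\le i\le N,\,1\le j\le n,\,n\ge1)$ are real, independent and identically distributed, centered, with $\mathbb{E}(X_{ij}^n)^2=1$, and there exists $\varepsilon>0$ such that $\mathbb{E}|X_{ij}^n|^{4+\varepsilon}<\infty$. (A-2) The real numbers $\sigma_{ij}(n)$ satisfy $\sup_{n\ge1}\max_{1\le i\le N,1\le j\le n}|\sigma_{ij}(n)|\le\sigma_{\max}<\infty$. (A-3) $A_n$ is a real deterministic $N\times n$ matrix whose columns $\mathbf a_k^n$ and rows $\tilde{\mathbf a}_\ell^n$ satisfy $\sup_{n\ge1}\max(\|\mathbf a_k^n\|,\|\tilde{\mathbf a}_\ell^n\|;\,1\le k\le n,\,1\le\ell\le N)<\infty$ (Euclidean norms). Let $Y_n$ be the $N\times n$ matrix with entries $Y_{ij}^n=\frac{\sigma_{ij}(n)}{\sqrt n}X_{ij}^n$, let $\Sigma_n=Y_n+A_n$, and let $Q_n(z)=(\Sigma_n\Sigma_n^T-zI_N)^{-1}$, $\tilde Q_n(z)=(\Sigma_n^T\Sigma_n-zI_n)^{-1}$. Let $T_n(z),\tilde T_n(z)$ be the deterministic matrix-valued functions defined in the context. Then, almost surely, $$\lim_{n\to\infty,\,N/n\to c}\left(\frac1N\mathrm{Tr}\,Q_n(z)-\frac1N\mathrm{Tr}\,T_n(z)\right)=0\qquad\forall z\in\mathbb{C}-\mathbb{R}^+,$$ $$\lim_{n\to\infty,\,N/n\to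 c}\left(\frac1n\mathrm{Tr}\,\tilde Q_n(z)-\frac1n\mathrm{Tr}\,\tilde T_n(z)\right)=0\qquad\forall z\in\mathbb{C}-\mathbb{R}^+.$$
   Context: $\mathbb{R}^+=[0,\infty)$; $\mathcal{S}(\mathbb{R}^+)$ is the set of Stieltjes transforms $f(z)=\int_{\mathbb{R}^+}\frac{\nu(d\lambda)}{\lambda-z}$ of probability measures $\nu$ on $\mathbb{R}^+$, viewed as analytic functions on $\mathbb{C}-\mathbb{R}^+$. Definition of $T=T_n$, $\tilde T=\tilde T_n$ (with $A=A_n$, $\sigma_{ij}=\sigma_{ij}(n)$): let $D_j=\mathrm{diag}(\sigma_{ij}^2;1\le i\le N)$, $\tilde D_i=\mathrm{diag}(\sigma_{ij}^2;1\le j\le n)$. The system $$\psi_i(z)=\frac{-1}{z(1+\frac1n\mathrm{Tr}\,\tilde D_i\tilde T(z))}\ (1\le i\le N),\qquad \tilde\psi_j(z)=\frac{-1}{z(1+\frac1n\mathrm{Tr}\,D_jT(z))}\ (1\le j\le n),$$ with $\Psi=\mathrm{diag}(\psi_i)$, $\tilde\Psi=\mathrm{diag}(\tilde\psi_j)$, $T(z)=(\Psi^{-1}(z)-zA\tilde\Psi(z)A^T)^{-1}$, $\tilde T(z)=(\tilde\Psi^{-1}(z)-zA^T\Psi(z)A)^{-1}$, has a unique solution $(\psi_1,\dots,\psi_N,\tilde\psi_1,\dots,\tilde\psi_n)\in\mathcal{S}(\mathbb{R}^+)^{N+n}$; $T_n$ and $\tilde T_n$ are the matrices associated with this solution. 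*)

theory Defs
  imports
    "HOL-Probability.Probability"
    "Jordan_Normal_Form.Gauss_Jordan_Elimination"
begin

text \<open>
  Matrices have dimensions that vary with \<open>n\<close>, so they are the dynamically sized
  matrices of \<open>Jordan_Normal_Form\<close>; rows and columns are numbered from \<open>0\<close>.
  The set \<open>\<complex> - \<real>\<^sup>+\<close> is the complement of \<open>\<real>\<^sub>\<ge>\<^sub>0\<close>.
\<close>

definition mat_trace :: "'a::comm_monoid_add mat \<Rightarrow> 'a" where
  "mat_trace B = (\<Sum>i<dim_row B. B $$ (i, i))"

text \<open>
  Only meaningful for invertible matrices. All the inverses below are of invertible matrices:
  \<open>\<Sigma>\<Sigma>\<^sup>T - zI\<close> because \<open>z\<close> is not a nonnegative real, \<open>\<Psi>\<close> because Stieltjes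
  transforms of probability measures on \<open>[0,\<infinity>)\<close> do not vanish outside \<open>[0,\<infinity>)\<close>,
  and \<open>\<Psi>\<^sup>-\<^sup>1 - zA\<Psi>'A\<^sup>T\<close> because its imaginary part is negative (positive) definite
  for \<open>Im z > 0\<close> (\<open>Im z < 0\<close>), while it is positive definite for \<open>z < 0\<close>.
\<close>
definition mat_inv :: "'a::field mat \<Rightarrow> 'a mat" where
  "mat_inv B = the (mat_inverse B)"

definition euclidean_norm :: "real Matrix.vec \<Rightarrow> real" where
  "euclidean_norm v = sqrt (scalar_prod v v)"

text \<open>The class \<open>\<S>(\<real>\<^sup>+)\<close>; values on \<open>[0,\<infinity>)\<close> itself are irrelevant.\<close>
definition stieltjes_class :: "(complex \<Rightarrow> complex) set" where
  "stieltjes_class = {f. \<exists>\<nu> :: real measure.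
     prob_space \<nu> \<and> sets \<nu> = sets borel \<and> measure \<nu> {0..} = 1 \<and>
     (\<forall>z. z \<notin> \<real>\<^sub>\<ge>\<^sub>0 \<longrightarrow> f z = (\<integral>l. 1 / (complex_of_real l - z) \<partial>\<nu>))}"

abbreviation cmat :: "real mat \<Rightarrow> complex mat" where
  "cmat \<equiv> map_mat complex_of_real"

definition Sigma_mat ::
    "nat \<Rightarrow> nat \<Rightarrow> (nat \<Rightarrow> nat \<Rightarrow> real) \<Rightarrow> real mat \<Rightarrow> (nat \<Rightarrow> nat \<Rightarrow> real) \<Rightarrow> real mat" where
  "Sigma_mat N n \<sigma> A x = Matrix.mat N n (\<lambda>(i, j). \<sigma> i j / sqrt (real n) * x i j) + A"

definition resolvent :: "real mat \<Rightarrow> complex \<Rightarrow> complex mat" where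
  "resolvent S z = mat_inv (cmat (S * transpose_mat S) - z \<cdot>\<^sub>m 1\<^sub>m (dim_row S))"

definition co_resolvent :: "real mat \<Rightarrow> complex \<Rightarrow> complex mat" where
  "co_resolvent S z = mat_inv (cmat (transpose_mat S * S) - z \<cdot>\<^sub>m 1\<^sub>m (dim_col S))"

definition T_mat ::
    "nat \<Rightarrow> nat \<Rightarrow> real mat \<Rightarrow> (nat \<Rightarrow> complex \<Rightarrow> complex) \<Rightarrow> (nat \<Rightarrow> complex \<Rightarrow> complex) \<Rightarrow>
     complex \<Rightarrow> complex mat" where
  "T_mat N n A \<psi> \<psi>' z =
     mat_inv (mat_inv (mat_diag N (\<lambda>i. \<psi> i z))
       - z \<cdot>\<^sub>m (cmat A * mat_diag n (\<lambda>j. \<psi>' j z) * transpose_mat (cmat A)))"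

definition T'_mat ::
    "nat \<Rightarrow> nat \<Rightarrow> real mat \<Rightarrow> (nat \<Rightarrow> complex \<Rightarrow> complex) \<Rightarrow> (nat \<Rightarrow> complex \<Rightarrow> complex) \<Rightarrow>
     complex \<Rightarrow> complex mat" where
  "T'_mat N n A \<psi> \<psi>' z =
     mat_inv (mat_inv (mat_diag n (\<lambda>j. \<psi>' j z))
       - z \<cdot>\<^sub>m (transpose_mat (cmat A) * mat_diag N (\<lambda>i. \<psi> i z) * cmat A))"

text \<open>
  \<open>(\<psi>, \<psi>')\<close> is the solution in \<open>\<S>(\<real>\<^sup>+)\<^sup>N\<^sup>+\<^sup>n\<close> of the fundamental system;
  a prime stands for the tilde.
\<close>
definition is_fundamental_solution ::
    "nat \<Rightarrow> nat \<Rightarrow> (nat \<Rightarrow> nat \<Rightarrow> real) \<Rightarrow> real mat \<Rightarrow>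
     (nat \<Rightarrow> complex \<Rightarrow> complex) \<Rightarrow> (nat \<Rightarrow> complex \<Rightarrow> complex) \<Rightarrow> bool" where
  "is_fundamental_solution N n \<sigma> A \<psi> \<psi>' \<longleftrightarrow>
     (\<forall>i<N. \<psi> i \<in> stieltjes_class) \<and>
     (\<forall>j<n. \<psi>' j \<in> stieltjes_class) \<and>
     (\<forall>z. z \<notin> \<real>\<^sub>\<ge>\<^sub>0 \<longrightarrow>
       (\<forall>i<N. \<psi> i z = -1 / (z * (1 + 1 / of_nat n *
          mat_trace (mat_diag n (\<lambda>j. complex_of_real ((\<sigma> i j)\<^sup>2)) * T'_mat N n A \<psi> \<psi>' z)))) \<and>
       (\<forall>j<n. \<psi>' j z = -1 / (z * (1 + 1 / of_nat n *
          mat_trace (mat_diag N (\<lambda>i. complex_of_real ((\<sigma> i j)\<^sup>2)) * T_mat N n A \<psi> \<psi>' z)))))"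

end

theory Submission
  imports Defs "Jordan_Normal_Form.Determinant" "HOL-Complex_Analysis.Complex_Analysis"
begin

text \<open>
  At a negative point \<open>z = -t\<close> all matrices are real and positive definite. With \<open>Q\<close> the resolvent,
  \<open>p j\<close> and \<open>p' i\<close> the means of \<open>1/n Tr D\<^sub>j Q\<close> and \<open>1/n Tr D'\<^sub>i Q'\<close>, and \<open>R\<close> the matrix
  obtained from these weights in place of the solution of the fundamental system, removing one column
  of \<open>\<Sigma>\<close> at a time shows that \<open>Tr D R\<close> and the mean of \<open>Tr D Q\<close> differ by \<open>O(\<surd>n)\<close> for
  every bounded diagonal \<open>D\<close>. So the mean weights solve the fundamental system up to \<open>O(1/\<surd>n)\<close>; for
  large \<open>t\<close> the system is a contraction, even though the operator norm of \<open>A\<close> is not bounded, because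
  \<open>t A diag(b') A\<^sup>T \<le> R\<^sup>-\<^sup>1\<close>. Hence \<open>R\<close> is close to \<open>T\<close>. Removing a column changes the trace
  of \<open>Q\<close> by \<open>O(1)\<close>, so a bounded difference argument gives concentration and, with fourth moments,
  almost sure convergence at countably many points \<open>-t\<close>. All normalized traces are holomorphic and
  locally bounded off the half line, and Vitali's theorem extends the convergence.
\<close>

section \<open>Inverses of finite matrices\<close>

text \<open>The weights are built from expectations so that they, and with them \<open>R\<close>,
  are deterministic: a column of the noise is then independent of \<open>R\<close> and of the
  resolvent from which that column is erased. The obstacle is the deterministic part of a column: a
  form a^T Q0 a in a column a of A is of order one and nothing is proved about its concentration, so
  the factor 1 / (1 + xi^T Q0 xi) produced by removing a column xi of the sum cannot be compared
  directly with 1 / (1 + p). Its contribution cancels algebraically against the A-part of the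
  equation for \<open>R\<close> (\<open>bracket_identity\<close>), which leaves only errors from
  forms in the noise, of mean O(1/sqrt n) per column. A second cancellation, exact in expectation,
  removes the terms that couple the two families of weights
  (\<open>mean_resolvent_estimate\<close>). Positivity at negative points makes the constants
  uniform in the dimension: the denominators are at least 1 and every inverse has norm at most
  1/t.\<close>

lemma mat_inv_works:
  fixes B :: "'a::field mat"
  assumes B: "B \<in> carrier_mat n n" and d: "Determinant.det B \<noteq> 0"
  shows "mat_inv B \<in> carrier_mat n n" "B * mat_inv B = 1\<^sub>m n" "mat_inv B * B = 1\<^sub>m n"
proof -
  have "B \<in> Units (ring_mat TYPE('a) n ())"
    using det_non_zero_imp_unit[OF B d] .
  then obtain C where C: "mat_inverse B = Some C"
    using mat_inverse(1)[OF B, of "()"] by (cases "mat_inverse B") auto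
  from mat_inverse(2)[OF B C] C
  show "mat_inv B \<in> carrier_mat n n" "B * mat_inv B = 1\<^sub>m n" "mat_inv B * B = 1\<^sub>m n"
    by (simp_all add: mat_inv_def)
qed

lemma mat_inv_eqI:
  fixes B :: "'a::field mat"
  assumes B: "B \<in> carrier_mat n n" and C: "C \<in> carrier_mat n n" and BC: "B * C = 1\<^sub>m n"
  shows "mat_inv B = C"
proof -
  have "Determinant.det B * Determinant.det C = 1"
    using det_mult[OF B C] BC by simp
  hence d: "Determinant.det B \<noteq> 0" by auto
  note w = mat_inv_works[OF B d]
  have "mat_inv B = mat_inv B * (B * C)" using w by (simp add: BC)
  also have "\<dots> = (mat_inv B * B) * C" by (rule assoc_mult_mat[symmetric]) (use w B C in auto)
  also have "\<dots> = C" using w C by simp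
  finally show ?thesis .
qed

text \<open>Cramer's rule makes the entries of an inverse rational in the entries of the matrix.
  Both regularity statements about inverses rest on it: holomorphy in z and measurability in the
  random entries.\<close>

lemma mat_inv_cofactor:
  fixes B :: "'a::field mat"
  assumes B: "B \<in> carrier_mat n n" and d: "Determinant.det B \<noteq> 0" and "i < n" "k < n"
  shows "mat_inv B $$ (i, k) = cofactor B k i / Determinant.det B"
proof -
  have *: "B * (inverse (Determinant.det B) \<cdot>\<^sub>m adj_mat B) = 1\<^sub>m n"
    using adj_mat[OF B] d B
    by (subst mult_smult_distrib[of _ n n _ n]) (auto intro!: eq_matI)
  have "mat_inv B = inverse (Determinant.det B) \<cdot>\<^sub>m adj_mat B"
    using adj_mat(1)[OF B] by (intro mat_inv_eqI[OF B _ *]) auto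
  thus ?thesis using assms adj_mat(1)[OF B] by (simp add: adj_mat_def divide_inverse mult.commute)
qed

abbreviation sqmat :: "nat \<Rightarrow> (nat \<Rightarrow> nat \<Rightarrow> 'a) \<Rightarrow> 'a mat" where
  "sqmat N B \<equiv> Matrix.mat N N (\<lambda>(i, k). B i k)"

text \<open>Matrices are handled as functions of two indices, relevant only below the dimension, so
  that the algebra reduces to finite sums; the matrix type is visited only to invert.\<close>

definition minv :: "nat \<Rightarrow> (nat \<Rightarrow> nat \<Rightarrow> 'a::field) \<Rightarrow> nat \<Rightarrow> nat \<Rightarrow> 'a" where
  "minv N B i k = mat_inv (sqmat N B) $$ (i, k)"

lemma det_sqmat_nonzero:
  fixes B :: "nat \<Rightarrow> nat \<Rightarrow> 'a::field"
  assumes "\<And>v. (\<And>i. i < N \<Longrightarrow> (\<Sum>k<N. B i k * v k) = 0) \<Longrightarrow> \<forall>i<N. v i = 0"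
  shows "Determinant.det (sqmat N B) \<noteq> 0"
proof
  assume "Determinant.det (sqmat N B) = 0"
  then obtain v where v: "v \<in> carrier_vec N" "v \<noteq> 0\<^sub>v N" "sqmat N B *\<^sub>v v = 0\<^sub>v N"
    using det_0_iff_vec_prod_zero_field[of "sqmat N B" N] by auto
  have "(\<Sum>k<N. B i k * v $ k) = 0" if "i < N" for i
  proof -
    have "(sqmat N B *\<^sub>v v) $ i = 0" using v that by simp
    thus ?thesis using that v(1) by (simp add: scalar_prod_def atLeast0LessThan)
  qed
  from assms[of "\<lambda>k. v $ k", OF this] v show False
    by (auto simp: Matrix.vec_eq_iff)
qed

lemma minv_right:
  assumes "Determinant.det (sqmat N B) \<noteq> 0" "i < N" "l < N"
  shows "(\<Sum>k<N. B i k * minv N B k l) = (if i = l then 1 else 0)"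
proof -
  note w = mat_inv_works[of "sqmat N B" N, OF _ assms(1)]
  have "(sqmat N B * mat_inv (sqmat N B)) $$ (i, l) = (if i = l then 1 else 0)"
    using w assms by simp
  thus ?thesis using assms w(1) by (simp add: minv_def scalar_prod_def atLeast0LessThan)
qed

lemma minv_left:
  assumes "Determinant.det (sqmat N B) \<noteq> 0" "i < N" "l < N"
  shows "(\<Sum>k<N. minv N B i k * B k l) = (if i = l then 1 else 0)"
proof -
  note w = mat_inv_works[of "sqmat N B" N, OF _ assms(1)]
  have "(mat_inv (sqmat N B) * sqmat N B) $$ (i, l) = (if i = l then 1 else 0)"
    using w assms by simp
  thus ?thesis using assms w(1) by (simp add: minv_def scalar_prod_def atLeast0LessThan)
qed

text \<open>A right inverse of a square matrix is the inverse, so candidate entries are enough. This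
  later identifies the complex inverse at a negative point with the embedded real one.\<close>

lemma minv_entries:
  assumes "\<And>i l. i < N \<Longrightarrow> l < N \<Longrightarrow> (\<Sum>k<N. B i k * C k l) = (if i = l then 1 else 0)"
    and "i < N" "l < N"
  shows "minv N B i l = C i l"
proof -
  have "mat_inv (sqmat N B) = sqmat N C"
    by (rule mat_inv_eqI[of _ N])
       (auto simp: scalar_prod_def atLeast0LessThan assms(1) intro!: eq_matI)
  thus ?thesis using assms by (simp add: minv_def)
qed

lemma minv_cofactor:
  assumes "Determinant.det (sqmat N B) \<noteq> 0" "i < N" "k < N"
  shows "minv N B i k = cofactor (sqmat N B) k i / Determinant.det (sqmat N B)"
  unfolding minv_def by (rule mat_inv_cofactor) (use assms in auto)

lemma minv_cong:
  "(\<And>i k. i < N \<Longrightarrow> k < N \<Longrightarrow> B i k = B' i k) \<Longrightarrow> minv N B = minv N B'"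
  unfolding minv_def by (metis (no_types, lifting) cong_mat case_prod_conv)

lemma det_sqmat: "Determinant.det (sqmat N B) =
    (\<Sum>p | p permutes {0..<N}. signof p * (\<Prod>i = 0..<N. B i (p i)))"
  unfolding Determinant.det_def
  by (auto intro!: sum.cong prod.cong simp: permutes_in_image)

text \<open>The minor is again a \<open>sqmat\<close>, of a reindexed function, so a single
  expansion of determinants treats numerator and denominator of Cramer's rule alike.\<close>

lemma cofactor_sqmat:
  assumes "k < N" "i < N"
  shows "cofactor (sqmat N B) k i = (-1) ^ (k + i) * Determinant.det
     (sqmat (N - 1) (\<lambda>a b. B (if a < k then a else Suc a) (if b < i then b else Suc b)))"
proof -
  have "mat_delete (sqmat N B) k i =
      sqmat (N - 1) (\<lambda>a b. B (if a < k then a else Suc a) (if b < i then b else Suc b))"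
    using assms by (auto simp: mat_delete_def intro!: eq_matI)
  thus ?thesis by (simp add: Determinant.cofactor_def)
qed

lemma minv_holomorphic:
  fixes B :: "complex \<Rightarrow> nat \<Rightarrow> nat \<Rightarrow> complex"
  assumes d: "\<And>z. z \<in> U \<Longrightarrow> Determinant.det (sqmat N (B z)) \<noteq> 0"
    and h: "\<And>i k. i < N \<Longrightarrow> k < N \<Longrightarrow> (\<lambda>z. B z i k) holomorphic_on U"
    and "i < N" "k < N"
  shows "(\<lambda>z. minv N (B z) i k) holomorphic_on U"
proof -
  have det: "(\<lambda>z. Determinant.det (sqmat n (C z))) holomorphic_on U"
    if "\<And>i k. i < n \<Longrightarrow> k < n \<Longrightarrow> (\<lambda>z. C z i k) holomorphic_on U"
    for n and C :: "complex \<Rightarrow> nat \<Rightarrow> nat \<Rightarrow> complex"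
    unfolding det_sqmat
    by (intro holomorphic_on_sum holomorphic_on_mult holomorphic_on_const holomorphic_on_prod that)
       (auto simp: permutes_in_image)
  have "(\<lambda>z. cofactor (sqmat N (B z)) k i / Determinant.det (sqmat N (B z))) holomorphic_on U"
    by (simp only: cofactor_sqmat[OF \<open>k < N\<close> \<open>i < N\<close>])
       (intro holomorphic_on_divide holomorphic_on_mult holomorphic_on_const det h d; auto)
  thus ?thesis
    by (rule holomorphic_transform) (simp add: minv_cofactor d assms)
qed

lemma minv_measurable:
  fixes B :: "'b \<Rightarrow> nat \<Rightarrow> nat \<Rightarrow> real"
  assumes d: "\<And>x. x \<in> space M \<Longrightarrow> Determinant.det (sqmat N (B x)) \<noteq> 0"
    and h: "\<And>i k. i < N \<Longrightarrow> k < N \<Longrightarrow> (\<lambda>x. B x i k) \<in> borel_measurable M"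
    and "i < N" "k < N"
  shows "(\<lambda>x. minv N (B x) i k) \<in> borel_measurable M"
proof -
  have det: "(\<lambda>x. Determinant.det (sqmat n (C x))) \<in> borel_measurable M"
    if "\<And>i k. i < n \<Longrightarrow> k < n \<Longrightarrow> (\<lambda>x. C x i k) \<in> borel_measurable M"
    for n and C :: "'b \<Rightarrow> nat \<Rightarrow> nat \<Rightarrow> real"
    unfolding det_sqmat
    by (intro borel_measurable_sum borel_measurable_times borel_measurable_const borel_measurable_prod that)
       (auto simp: permutes_in_image)
  have "(\<lambda>x. cofactor (sqmat N (B x)) k i / Determinant.det (sqmat N (B x))) \<in> borel_measurable M"
    by (simp only: cofactor_sqmat[OF \<open>k < N\<close> \<open>i < N\<close>])
       (intro borel_measurable_divide borel_measurable_times borel_measurable_const det h; auto)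
  moreover have "(\<lambda>x. minv N (B x) i k) \<in> borel_measurable M \<longleftrightarrow>
      (\<lambda>x. cofactor (sqmat N (B x)) k i / Determinant.det (sqmat N (B x))) \<in> borel_measurable M"
    by (rule measurable_cong) (simp add: minv_cofactor d assms)
  ultimately show ?thesis by simp
qed

section \<open>Real vectors and positive definite matrices\<close>

definition dot :: "nat \<Rightarrow> (nat \<Rightarrow> real) \<Rightarrow> (nat \<Rightarrow> real) \<Rightarrow> real" where
  "dot N v w = (\<Sum>i<N. v i * w i)"

definition app :: "nat \<Rightarrow> (nat \<Rightarrow> nat \<Rightarrow> real) \<Rightarrow> (nat \<Rightarrow> real) \<Rightarrow> nat \<Rightarrow> real" where
  "app N B v i = (\<Sum>k<N. B i k * v k)"

abbreviation unitv :: "nat \<Rightarrow> nat \<Rightarrow> real" where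
  "unitv i \<equiv> (\<lambda>k. if k = i then 1 else 0)"

lemma dot_cong: "(\<And>i. i < N \<Longrightarrow> v i = v' i) \<Longrightarrow> (\<And>i. i < N \<Longrightarrow> w i = w' i) \<Longrightarrow> dot N v w = dot N v' w'"
  unfolding dot_def by (intro sum.cong) auto

lemma app_cong: "(\<And>k. k < N \<Longrightarrow> v k = v' k) \<Longrightarrow> app N B v = app N B v'"
  unfolding app_def by (auto intro!: sum.cong ext)

lemma dot_commute: "dot N v w = dot N w v"
  unfolding dot_def by (simp add: mult.commute)

lemma dot_add_left: "dot N (\<lambda>i. v i + w i) u = dot N v u + dot N w u"
  and dot_add_right: "dot N u (\<lambda>i. v i + w i) = dot N u v + dot N u w"
  and dot_diff_left: "dot N (\<lambda>i. v i - w i) u = dot N v u - dot N w u"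
  and dot_diff_right: "dot N u (\<lambda>i. v i - w i) = dot N u v - dot N u w"
  and dot_scale_left: "dot N (\<lambda>i. c * v i) u = c * dot N v u"
  and dot_scale_right: "dot N u (\<lambda>i. c * v i) = c * dot N u v"
  unfolding dot_def
  by (simp_all add: algebra_simps sum.distrib sum_subtractf sum_distrib_left)

lemma app_add: "app N B (\<lambda>i. v i + w i) = (\<lambda>i. app N B v i + app N B w i)"
  and app_diff: "app N B (\<lambda>i. v i - w i) = (\<lambda>i. app N B v i - app N B w i)"
  and app_scale: "app N B (\<lambda>i. c * v i) = (\<lambda>i. c * app N B v i)"
  unfolding app_def
  by (auto simp: algebra_simps sum.distrib sum_subtractf sum_distrib_left)

lemmas dot_linear = dot_add_left dot_add_right dot_diff_left dot_diff_right
  dot_scale_left dot_scale_right app_add app_diff app_scale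

lemma dot_self_nonneg [simp]: "0 \<le> dot N v v"
  unfolding dot_def by (intro sum_nonneg) auto

lemma dot_unitv [simp]: "i < N \<Longrightarrow> dot N v (unitv i) = v i" "i < N \<Longrightarrow> dot N (unitv i) v = v i"
  unfolding dot_def by (simp_all add: if_distrib if_distribR cong: if_cong)

lemma app_unitv: "i < N \<Longrightarrow> app N B (unitv i) k = B k i"
  unfolding app_def by (simp add: if_distrib cong: if_cong)

lemma dot_Cauchy_Schwarz: "(dot N v w)\<^sup>2 \<le> dot N v v * dot N w w"
  using Cauchy_Schwarz_ineq_sum[of v w "{..<N}"] by (simp add: dot_def power2_eq_square)

lemma dot_le_of_sq:
  assumes "dot N v v \<le> a\<^sup>2" "dot N w w \<le> b\<^sup>2" "0 \<le> a" "0 \<le> b"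
  shows "\<bar>dot N v w\<bar> \<le> a * b"
proof -
  have "(dot N v w)\<^sup>2 \<le> a\<^sup>2 * b\<^sup>2"
    by (rule order_trans[OF dot_Cauchy_Schwarz]) (intro mult_mono assms; simp)
  hence "\<bar>dot N v w\<bar>\<^sup>2 \<le> (a * b)\<^sup>2" by (simp add: power_mult_distrib)
  thus ?thesis by (rule power2_le_imp_le) (use assms in auto)
qed

lemma component_sq_le_dot: "i < N \<Longrightarrow> (v i)\<^sup>2 \<le> dot N v v"
  unfolding dot_def power2_eq_square[symmetric]
  by (rule member_le_sum) auto

text \<open>The parameter \<open>t\<close> is a lower bound for the spectrum, so the estimates on
  the inverse are quantitative and free of the dimension.\<close>

definition posdef :: "real \<Rightarrow> nat \<Rightarrow> (nat \<Rightarrow> nat \<Rightarrow> real) \<Rightarrow> bool" where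
  "posdef t N B \<longleftrightarrow> t > 0 \<and> (\<forall>i<N. \<forall>k<N. B i k = B k i) \<and> (\<forall>v. t * dot N v v \<le> dot N v (app N B v))"

lemma posdef_det:
  assumes "posdef t N B"
  shows "Determinant.det (sqmat N B) \<noteq> 0"
proof (rule det_sqmat_nonzero)
  fix v assume "\<And>i. i < N \<Longrightarrow> (\<Sum>k<N. B i k * v k) = 0"
  hence "dot N v (app N B v) = 0" by (auto simp: dot_def app_def intro!: sum.neutral)
  with assms have "t * dot N v v \<le> 0" "t > 0" by (auto simp: posdef_def dest: spec[of _ v])
  hence "dot N v v \<le> 0" by (simp add: mult_le_0_iff)
  hence "\<forall>i\<in>{..<N}. v i * v i = 0"
    unfolding dot_def by (subst sum_nonneg_eq_0_iff[symmetric]) (auto intro!: antisym sum_nonneg)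
  thus "\<forall>i<N. v i = 0" by auto
qed

lemma posdef_app_minv:
  assumes "posdef t N B" "i < N"
  shows "app N B (app N (minv N B) v) i = v i" "app N (minv N B) (app N B v) i = v i"
proof -
  note d = posdef_det[OF assms(1)]
  have "app N B (app N (minv N B) v) i = (\<Sum>l<N. (\<Sum>k<N. B i k * minv N B k l) * v l)"
    unfolding app_def by (simp add: sum_distrib_left sum_distrib_right mult.assoc) (rule sum.swap)
  also have "\<dots> = (\<Sum>l<N. if i = l then v l else 0)"
    by (intro sum.cong) (auto simp: minv_right[OF d assms(2)])
  finally show "app N B (app N (minv N B) v) i = v i" using assms by simp
  have "app N (minv N B) (app N B v) i = (\<Sum>l<N. (\<Sum>k<N. minv N B i k * B k l) * v l)"
    unfolding app_def by (simp add: sum_distrib_left sum_distrib_right mult.assoc) (rule sum.swap)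
  also have "\<dots> = (\<Sum>l<N. if i = l then v l else 0)"
    by (intro sum.cong) (auto simp: minv_left[OF d assms(2)])
  finally show "app N (minv N B) (app N B v) i = v i" using assms by simp
qed

lemma symmetric_dot_app:
  assumes "\<forall>i<N. \<forall>k<N. B i k = B k i"
  shows "dot N v (app N B w) = dot N (app N B v) w"
proof -
  have "dot N v (app N B w) = (\<Sum>i<N. \<Sum>k<N. v i * (B i k * w k))"
    unfolding dot_def app_def by (simp add: sum_distrib_left)
  also have "\<dots> = (\<Sum>k<N. \<Sum>i<N. v i * (B i k * w k))" by (rule sum.swap)
  also have "\<dots> = dot N (app N B v) w"
    unfolding dot_def app_def using assms
    by (auto simp: sum_distrib_left sum_distrib_right mult_ac intro!: sum.cong)
  finally show ?thesis .
qed

lemma posdef_minv_dot: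
  assumes "posdef t N B"
  shows "dot N v (app N (minv N B) w) = dot N (app N (minv N B) v) w"
proof -
  have sym: "\<forall>i<N. \<forall>k<N. B i k = B k i" using assms by (simp add: posdef_def)
  let ?Q = "app N (minv N B)"
  have "dot N v (?Q w) = dot N (app N B (?Q v)) (?Q w)"
    by (rule dot_cong) (simp_all add: posdef_app_minv[OF assms])
  also have "\<dots> = dot N (?Q v) (app N B (?Q w))"
    by (rule symmetric_dot_app[OF sym, symmetric])
  also have "\<dots> = dot N (?Q v) w"
    by (rule dot_cong) (simp_all add: posdef_app_minv[OF assms])
  finally show ?thesis .
qed

text \<open>Coercivity is tested at the vector w = B^{-1} v, where the form becomes the product of w
  and v. The squared norm of w is thus controlled by the form itself, a bound that stays useful when
  v is large.\<close>

lemma posdef_minv_lower: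
  assumes "posdef t N B"
  shows "t * dot N (app N (minv N B) v) (app N (minv N B) v) \<le> dot N v (app N (minv N B) v)"
proof -
  let ?w = "app N (minv N B) v"
  have "t * dot N ?w ?w \<le> dot N ?w (app N B ?w)" using assms by (simp add: posdef_def)
  also have "dot N ?w (app N B ?w) = dot N ?w v"
    by (rule dot_cong) (simp_all add: posdef_app_minv[OF assms])
  finally show ?thesis by (simp add: dot_commute)
qed

lemma posdef_minv_norm:
  assumes "posdef t N B"
  shows "dot N (app N (minv N B) v) (app N (minv N B) v) \<le> dot N v v / t\<^sup>2"
proof -
  let ?w = "app N (minv N B) v"
  have t: "t > 0" using assms by (simp add: posdef_def)
  have "(t * dot N ?w ?w)\<^sup>2 \<le> (dot N v ?w)\<^sup>2"
    by (rule power_mono[OF posdef_minv_lower[OF assms]]) (use t in auto)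
  also have "\<dots> \<le> dot N v v * dot N ?w ?w" by (rule dot_Cauchy_Schwarz)
  finally have *: "t\<^sup>2 * dot N ?w ?w * dot N ?w ?w \<le> dot N v v * dot N ?w ?w"
    by (simp add: power2_eq_square mult_ac)
  show ?thesis
  proof (cases "dot N ?w ?w = 0")
    case False
    hence "dot N ?w ?w > 0" using dot_self_nonneg[of N ?w] by linarith
    with * have "t\<^sup>2 * dot N ?w ?w \<le> dot N v v" by simp
    thus ?thesis using t by (simp add: field_simps)
  qed (use t in simp)
qed

lemma posdef_minv_upper:
  assumes "posdef t N B"
  shows "dot N v (app N (minv N B) v) \<le> dot N v v / t"
proof -
  have t: "t > 0" using assms by (simp add: posdef_def)
  have *: "dot N (app N (minv N B) v) (app N (minv N B) v) \<le> (sqrt (dot N v v) / t)\<^sup>2"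
    using posdef_minv_norm[OF assms, of v] by (simp add: power_divide)
  have "\<bar>dot N v (app N (minv N B) v)\<bar> \<le> sqrt (dot N v v) * (sqrt (dot N v v) / t)"
    by (rule dot_le_of_sq[OF _ *]) (use t in auto)
  thus ?thesis by simp
qed

lemma posdef_minv_nonneg:
  assumes "posdef t N B"
  shows "0 \<le> dot N v (app N (minv N B) v)"
  using posdef_minv_lower[OF assms, of v] assms
  by (meson dot_self_nonneg less_imp_le mult_nonneg_nonneg order_trans posdef_def)

lemma posdef_minv_diag:
  assumes "posdef t N B" "i < N"
  shows "0 \<le> minv N B i i" "minv N B i i \<le> 1 / t"
  using posdef_minv_nonneg[OF assms(1), of "unitv i"] posdef_minv_upper[OF assms(1), of "unitv i"] assms(2)
  by (simp_all add: app_unitv)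

text \<open>The Sherman-Morrison formula for adding \<xi> \<xi>^T. The last bound is uniform in
  \<xi>: by \<open>posdef_minv_lower\<close> the squared norm of Q0 \<xi> is at most
  \<open>\<kappa> / t\<close>, and the denominator \<open>1 + \<kappa>\<close> absorbs
  \<open>\<kappa>\<close>.\<close>

lemma
  assumes B0: "posdef t N B0" and B: "posdef t N B"
    and rank1: "\<And>v i. i < N \<Longrightarrow> app N B v i = app N B0 v i + dot N \<xi> v * \<xi> i"
  defines "Q \<equiv> app N (minv N B)" and "Q0 \<equiv> app N (minv N B0)"
  defines "\<kappa> \<equiv> dot N \<xi> (Q0 \<xi>)"
  shows rank1_nonneg: "0 \<le> \<kappa>"
    and rank1_minv: "i < N \<Longrightarrow> Q v i = Q0 v i - dot N \<xi> (Q0 v) / (1 + \<kappa>) * Q0 \<xi> i"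
    and rank1_trace: "dot N (Q0 \<xi>) (Q0 \<xi>) / (1 + \<kappa>) \<le> 1 / t"
proof -
  show k: "0 \<le> \<kappa>" unfolding \<kappa>_def Q0_def by (rule posdef_minv_nonneg[OF B0])
  have gen: "Q v i = Q0 v i - dot N \<xi> (Q0 v) / (1 + \<kappa>) * Q0 \<xi> i" if i: "i < N" for v i
  proof -
    define w where "w = (\<lambda>i. Q0 v i - dot N \<xi> (Q0 v) / (1 + \<kappa>) * Q0 \<xi> i)"
    have w: "app N B w l = v l" if l: "l < N" for l
    proof -
      have 1: "app N B (Q0 u) l = u l + dot N \<xi> (Q0 u) * \<xi> l" for u
        using rank1[OF l] posdef_app_minv(1)[OF B0 l] by (simp add: Q0_def)
      have "app N B w l = app N B (Q0 v) l - dot N \<xi> (Q0 v) / (1 + \<kappa>) * app N B (Q0 \<xi>) l"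
        by (simp only: w_def app_diff app_scale)
      also have "\<dots> = v l + dot N \<xi> (Q0 v) * \<xi> l - dot N \<xi> (Q0 v) / (1 + \<kappa>) * ((1 + \<kappa>) * \<xi> l)"
        by (simp add: 1 \<kappa>_def algebra_simps)
      also have "\<dots> = v l" using k by simp
      finally show ?thesis .
    qed
    have "Q v i = Q (app N B w) i" unfolding Q_def by (rule fun_cong[OF app_cong]) (simp add: w)
    also have "\<dots> = w i" unfolding Q_def by (rule posdef_app_minv[OF B i])
    finally show ?thesis by (simp add: w_def)
  qed
  show "i < N \<Longrightarrow> Q v i = Q0 v i - dot N \<xi> (Q0 v) / (1 + \<kappa>) * Q0 \<xi> i" by (rule gen)
  have t: "t > 0" using B0 by (simp add: posdef_def)
  have "t * dot N (Q0 \<xi>) (Q0 \<xi>) \<le> \<kappa>" unfolding Q0_def \<kappa>_def by (rule posdef_minv_lower[OF B0])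
  thus "dot N (Q0 \<xi>) (Q0 \<xi>) / (1 + \<kappa>) \<le> 1 / t" using k t by (simp add: field_simps)
qed

section \<open>Operator norm bounds and traces under rank-one perturbations\<close>

definition opbound :: "nat \<Rightarrow> (nat \<Rightarrow> nat \<Rightarrow> real) \<Rightarrow> real \<Rightarrow> bool" where
  "opbound N K k \<longleftrightarrow> 0 \<le> k \<and> (\<forall>v. dot N (app N K v) (app N K v) \<le> k\<^sup>2 * dot N v v)"

lemma opbound_dot:
  assumes "opbound N K k"
  shows "\<bar>dot N v (app N K v)\<bar> \<le> k * dot N v v"
proof -
  have "\<bar>dot N v (app N K v)\<bar> \<le> sqrt (dot N v v) * (k * sqrt (dot N v v))"
    using assms by (intro dot_le_of_sq) (auto simp: opbound_def power_mult_distrib)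
  thus ?thesis by (simp add: mult_ac)
qed

lemma opbound_entry:
  assumes "opbound N K k" "i < N" "l < N"
  shows "\<bar>K i l\<bar> \<le> k"
proof -
  have "(app N K (unitv l) i)\<^sup>2 \<le> dot N (app N K (unitv l)) (app N K (unitv l))"
    by (rule component_sq_le_dot) fact
  also have "\<dots> \<le> k\<^sup>2" using assms by (auto simp: opbound_def dest: spec[of _ "unitv l"])
  finally have "(K i l)\<^sup>2 \<le> k\<^sup>2" using assms by (simp add: app_unitv)
  thus ?thesis using assms by (simp add: opbound_def abs_le_square_iff[symmetric])
qed

lemma opbound_minv: "posdef t N B \<Longrightarrow> opbound N (minv N B) (1 / t)"
  using posdef_minv_norm[of t N B] by (auto simp: opbound_def posdef_def power_divide)

definition mulm :: "nat \<Rightarrow> (nat \<Rightarrow> nat \<Rightarrow> real) \<Rightarrow> (nat \<Rightarrow> nat \<Rightarrow> real) \<Rightarrow> nat \<Rightarrow> nat \<Rightarrow> real" where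
  "mulm N B C i k = (\<Sum>l<N. B i l * C l k)"

lemma app_mulm: "app N (mulm N B C) v = app N B (app N C v)"
  unfolding app_def mulm_def
  by (auto simp: sum_distrib_left sum_distrib_right mult.assoc intro: sum.swap)

lemma mulm_unitv: "k < N \<Longrightarrow> mulm N B C i k = app N B (app N C (unitv k)) i"
  by (simp add: app_mulm[symmetric] app_unitv)

lemma opbound_mulm:
  assumes "opbound N B b" "opbound N C c"
  shows "opbound N (mulm N B C) (b * c)"
  unfolding opbound_def
proof (intro conjI allI)
  fix v
  have "dot N (app N B (app N C v)) (app N B (app N C v)) \<le> b\<^sup>2 * dot N (app N C v) (app N C v)"
    using assms by (simp add: opbound_def)
  also have "\<dots> \<le> b\<^sup>2 * (c\<^sup>2 * dot N v v)"
    using assms by (intro mult_left_mono) (auto simp: opbound_def)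
  finally show "dot N (app N (mulm N B C) v) (app N (mulm N B C) v) \<le> (b * c)\<^sup>2 * dot N v v"
    by (simp add: app_mulm power_mult_distrib mult_ac)
qed (use assms in \<open>auto simp: opbound_def\<close>)

lemma opbound_diag:
  assumes "\<And>i. i < N \<Longrightarrow> \<bar>d i\<bar> \<le> c" "0 \<le> c" "opbound N B b"
  shows "opbound N (\<lambda>i k. d i * B i k) (c * b)"
  unfolding opbound_def
proof (intro conjI allI)
  fix v
  have e: "app N (\<lambda>i k. d i * B i k) v = (\<lambda>i. d i * app N B v i)"
    by (auto simp: app_def sum_distrib_left mult.assoc)
  have "dot N (\<lambda>i. d i * app N B v i) (\<lambda>i. d i * app N B v i) = (\<Sum>i<N. (d i)\<^sup>2 * (app N B v i)\<^sup>2)"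
    by (simp add: dot_def power2_eq_square mult_ac)
  also have "\<dots> \<le> (\<Sum>i<N. c\<^sup>2 * (app N B v i)\<^sup>2)"
    using assms by (intro sum_mono mult_right_mono) (auto simp: abs_le_square_iff[symmetric])
  also have "\<dots> = c\<^sup>2 * dot N (app N B v) (app N B v)"
    by (simp add: dot_def power2_eq_square sum_distrib_left)
  also have "\<dots> \<le> c\<^sup>2 * (b\<^sup>2 * dot N v v)"
    using assms by (intro mult_left_mono) (auto simp: opbound_def)
  finally show "dot N (app N (\<lambda>i k. d i * B i k) v) (app N (\<lambda>i k. d i * B i k) v) \<le> (c * b)\<^sup>2 * dot N v v"
    by (simp add: e power_mult_distrib mult_ac)
qed (use assms in \<open>auto simp: opbound_def\<close>)

text \<open>Each column is the image of a unit vector, so its squared norm is at most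
  \<open>c\<^sup>2\<close>. The variance of a quadratic form in the noise is governed by this
  Frobenius norm.\<close>

lemma opbound_frobenius:
  assumes "opbound N C c"
  shows "(\<Sum>i<N. \<Sum>k<N. (C i k)\<^sup>2) \<le> real N * c\<^sup>2"
proof -
  have "(\<Sum>i<N. (C i k)\<^sup>2) \<le> c\<^sup>2" if "k < N" for k
  proof -
    have "dot N (app N C (unitv k)) (app N C (unitv k)) \<le> c\<^sup>2 * dot N (unitv k) (unitv k)"
      using assms by (simp add: opbound_def)
    moreover have "dot N (app N C (unitv k)) (app N C (unitv k)) = (\<Sum>i<N. (C i k)\<^sup>2)"
      using that by (simp add: dot_def app_unitv power2_eq_square)
    ultimately show ?thesis using that by simp
  qed
  hence "(\<Sum>k<N. \<Sum>i<N. (C i k)\<^sup>2) \<le> (\<Sum>k<N. c\<^sup>2)" by (intro sum_mono) auto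
  thus ?thesis by (subst sum.swap) simp
qed

text \<open>The difference of the inverses has rank one, so the trace against \<open>K\<close> is a
  single quadratic form of \<open>K\<close> at Q0 \<xi>. With \<open>rank1_trace\<close> it is
  bounded independently of the dimension and of the size of \<xi>; this drives both the
  leave-one-out comparison and the bounded differences.\<close>

lemma rank1_trace_diff:
  assumes B0: "posdef t N B0" and B: "posdef t N B"
    and rank1: "\<And>v i. i < N \<Longrightarrow> app N B v i = app N B0 v i + dot N \<xi> v * \<xi> i"
    and K: "opbound N K k"
  shows "\<bar>(\<Sum>i<N. mulm N (minv N B0) K i i) - (\<Sum>i<N. mulm N (minv N B) K i i)\<bar> \<le> k / t"
proof -
  let ?w = "app N (minv N B0) \<xi>"
  let ?\<kappa> = "dot N \<xi> ?w"
  have r1: "0 \<le> ?\<kappa>" by (rule rank1_nonneg[OF B0 B rank1])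
  have r2: "app N (minv N B) v i = app N (minv N B0) v i - dot N \<xi> (app N (minv N B0) v) / (1 + ?\<kappa>) * ?w i"
    if "i < N" for v i by (rule rank1_minv[OF B0 B rank1 that])
  have r3: "dot N ?w ?w / (1 + ?\<kappa>) \<le> 1 / t" by (rule rank1_trace[OF B0 B rank1])
  have "mulm N (minv N B0) K i i - mulm N (minv N B) K i i =
      dot N ?w (app N K (unitv i)) * ?w i / (1 + ?\<kappa>)" if "i < N" for i
    using that r2[OF that, of "app N K (unitv i)"]
    by (simp add: mulm_unitv posdef_minv_dot[OF B0, of \<xi>])
  hence "(\<Sum>i<N. mulm N (minv N B0) K i i) - (\<Sum>i<N. mulm N (minv N B) K i i)
      = (\<Sum>i<N. dot N ?w (app N K (unitv i)) * ?w i / (1 + ?\<kappa>))"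
    by (simp add: sum_subtractf[symmetric])
  also have "\<dots> = dot N ?w (app N K ?w) / (1 + ?\<kappa>)"
  proof -
    have "(\<Sum>i<N. dot N ?w (app N K (unitv i)) * ?w i) = (\<Sum>i<N. \<Sum>l<N. ?w l * K l i * ?w i)"
      by (intro sum.cong refl) (simp add: dot_def app_unitv sum_distrib_right)
    also have "\<dots> = (\<Sum>l<N. \<Sum>i<N. ?w l * K l i * ?w i)" by (rule sum.swap)
    also have "\<dots> = dot N ?w (app N K ?w)" by (simp add: dot_def app_def[of N K] sum_distrib_left mult.assoc)
    finally show ?thesis by (simp add: sum_divide_distrib[symmetric])
  qed
  finally have eq: "(\<Sum>i<N. mulm N (minv N B0) K i i) - (\<Sum>i<N. mulm N (minv N B) K i i)
    = dot N ?w (app N K ?w) / (1 + ?\<kappa>)" .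
  have "\<bar>dot N ?w (app N K ?w) / (1 + ?\<kappa>)\<bar> \<le> k * dot N ?w ?w / (1 + ?\<kappa>)"
    using opbound_dot[OF K, of ?w] r1 by (simp add: divide_right_mono)
  also have "\<dots> = k * (dot N ?w ?w / (1 + ?\<kappa>))" by simp
  also have "\<dots> \<le> k * (1 / t)" using r3 K by (intro mult_left_mono) (auto simp: opbound_def)
  finally show ?thesis by (simp add: eq)
qed

section \<open>Moments in product spaces\<close>

context prob_space
begin

lemma prob_space_const_PiM: "prob_space (PiM I (\<lambda>_. M))"
  by (rule prob_space_PiM) (rule prob_space_axioms)

lemma product_sigma_finite_const: "product_sigma_finite (\<lambda>_. M)"
  by unfold_locales

end

text \<open>The common law of the entries. Besides mean and variance, the bound \<open>m4\<close> is
  all that the constants below see of it.\<close>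

locale entry_law = prob_space \<mu> for \<mu> :: "real measure" +
  fixes m4 :: real
  assumes sets_law [measurable_cong]: "sets \<mu> = sets borel"
    and law_fourth: "integrable \<mu> (\<lambda>x. x ^ 4)" "(\<integral>x. x ^ 4 \<partial>\<mu>) \<le> m4"
    and law_mean: "(\<integral>x. x \<partial>\<mu>) = 0"
    and law_var: "(\<integral>x. x\<^sup>2 \<partial>\<mu>) = 1"
begin

lemma law_integrable: "integrable \<mu> (\<lambda>x. x)" "integrable \<mu> (\<lambda>x. x\<^sup>2)"
proof -
  have i: "integrable \<mu> (\<lambda>x. 1 + x ^ 4)" using law_fourth by simp
  have le: "\<bar>y\<bar> \<le> 1 + y\<^sup>2" for y :: real
    using zero_le_power2[of "\<bar>y\<bar> - 1 / 2"] by (simp add: power2_diff power_divide)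
  have sq: "x\<^sup>2 \<le> 1 + x ^ 4" for x :: real using le[of "x\<^sup>2"] by simp
  show i2: "integrable \<mu> (\<lambda>x. x\<^sup>2)"
    by (rule Bochner_Integration.integrable_bound[OF i]) (auto intro: sq order_trans[OF sq])
  have i3: "integrable \<mu> (\<lambda>x. 1 + x\<^sup>2)" using i2 by simp
  show "integrable \<mu> (\<lambda>x. x)"
    by (rule Bochner_Integration.integrable_bound[OF i3]) (auto intro: le order_trans[OF le])
qed

lemma m4_nonneg: "0 \<le> m4"
  by (rule order_trans[OF _ law_fourth(2)]) (rule integral_nonneg_AE, auto)

lemma nn_integral_linear_sq:
  "(\<integral>\<^sup>+y. ennreal ((L + c * y)\<^sup>2) \<partial>\<mu>) = ennreal (L\<^sup>2 + c\<^sup>2)"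
proof -
  have eq: "(L + c * y)\<^sup>2 = L\<^sup>2 + (2 * L * c) * y + c\<^sup>2 * y\<^sup>2" for y
    by (simp add: power2_eq_square algebra_simps)
  have "integrable \<mu> (\<lambda>y. (L + c * y)\<^sup>2)"
    unfolding eq using law_integrable by auto
  moreover have "(\<integral>y. (L + c * y)\<^sup>2 \<partial>\<mu>) = L\<^sup>2 + c\<^sup>2"
    unfolding eq using law_integrable by (simp add: law_mean law_var prob_space)
  ultimately show ?thesis by (subst nn_integral_eq_integral) auto
qed

text \<open>Coordinates are integrated out one at a time by Fubini; the cross term vanishes because
  each coordinate is centered. Nonnegative integrals keep integrability out of the
  induction.\<close>

lemma nn_integral_linear_form:
  assumes "finite F"
  shows "(\<integral>\<^sup>+x. ennreal ((\<Sum>i\<in>F. c i * x i)\<^sup>2) \<partial>PiM F (\<lambda>_. \<mu>)) = ennreal (\<Sum>i\<in>F. (c i)\<^sup>2)"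
  using assms
proof induction
  case empty
  then show ?case by simp
next
  case (insert j F)
  interpret PP: product_sigma_finite "\<lambda>_. \<mu>" by (rule product_sigma_finite_const)
  interpret F: prob_space "PiM F (\<lambda>_. \<mu>)" by (rule prob_space_const_PiM)
  have "(\<integral>\<^sup>+x. ennreal ((\<Sum>i\<in>insert j F. c i * x i)\<^sup>2) \<partial>PiM (insert j F) (\<lambda>_. \<mu>))
      = (\<integral>\<^sup>+x. \<integral>\<^sup>+y. ennreal ((\<Sum>i\<in>insert j F. c i * (x(j := y)) i)\<^sup>2) \<partial>\<mu> \<partial>PiM F (\<lambda>_. \<mu>))"
    by (rule PP.product_nn_integral_insert) (use insert in \<open>auto\<close>)
  also have "\<dots> = (\<integral>\<^sup>+x. \<integral>\<^sup>+y. ennreal (((\<Sum>i\<in>F. c i * x i) + c j * y)\<^sup>2) \<partial>\<mu> \<partial>PiM F (\<lambda>_. \<mu>))"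
    using insert by (intro nn_integral_cong) (auto intro!: arg_cong[where f = ennreal] arg_cong[where f = "\<lambda>x. x\<^sup>2"] sum.cong simp: add.commute)
  also have "\<dots> = (\<integral>\<^sup>+x. ennreal ((\<Sum>i\<in>F. c i * x i)\<^sup>2) + ennreal ((c j)\<^sup>2) \<partial>PiM F (\<lambda>_. \<mu>))"
    by (simp add: nn_integral_linear_sq)
  also have "\<dots> = ennreal (\<Sum>i\<in>F. (c i)\<^sup>2) + ennreal ((c j)\<^sup>2)"
    using insert by (subst nn_integral_add) (auto simp: F.emeasure_space_1)
  also have "\<dots> = ennreal (\<Sum>i\<in>insert j F. (c i)\<^sup>2)"
    using insert by (simp add: sum_nonneg add.commute)
  finally show ?case .
qed

text \<open>One coordinate y of a quadratic form: \<open>S\<close> is the centered form in the other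
  coordinates, \<open>L\<close> the coefficient linear in y, \<open>c\<close> the diagonal
  coefficient. The product of the last two summands would produce a third moment; it is traded for
  their squares, whence the factors 2, while the terms linear in \<open>S\<close> integrate to
  zero.\<close>

lemma nn_integral_quadratic_step:
  "(\<integral>\<^sup>+y. ennreal ((S + y * L + c * (y\<^sup>2 - 1))\<^sup>2) \<partial>\<mu>) \<le> ennreal (S\<^sup>2 + 2 * L\<^sup>2 + 2 * m4 * c\<^sup>2)"
proof -
  have le: "(S + y * L + c * (y\<^sup>2 - 1))\<^sup>2 \<le>
      (S\<^sup>2 - 2 * S * c + 2 * c\<^sup>2) + (2 * S * L) * y + (2 * S * c + 2 * L\<^sup>2 - 4 * c\<^sup>2) * y\<^sup>2 + 2 * c\<^sup>2 * y ^ 4" for y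
  proof -
    have "0 \<le> (y * L - c * (y\<^sup>2 - 1))\<^sup>2" by simp
    thus ?thesis by (simp add: power2_eq_square power4_eq_xxxx algebra_simps)
  qed
  have "(\<integral>\<^sup>+y. ennreal ((S + y * L + c * (y\<^sup>2 - 1))\<^sup>2) \<partial>\<mu>) \<le>
     (\<integral>\<^sup>+y. ennreal ((S\<^sup>2 - 2 * S * c + 2 * c\<^sup>2) + (2 * S * L) * y + (2 * S * c + 2 * L\<^sup>2 - 4 * c\<^sup>2) * y\<^sup>2 + 2 * c\<^sup>2 * y ^ 4) \<partial>\<mu>)"
    by (intro nn_integral_mono ennreal_leI le)
  also have "\<dots> = ennreal (\<integral>y. (S\<^sup>2 - 2 * S * c + 2 * c\<^sup>2) + (2 * S * L) * y + (2 * S * c + 2 * L\<^sup>2 - 4 * c\<^sup>2) * y\<^sup>2 + 2 * c\<^sup>2 * y ^ 4 \<partial>\<mu>)"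
    using law_integrable law_fourth
    by (intro nn_integral_eq_integral) (auto intro!: AE_I2 order_trans[OF zero_le_power2 le])
  also have "(\<integral>y. (S\<^sup>2 - 2 * S * c + 2 * c\<^sup>2) + (2 * S * L) * y + (2 * S * c + 2 * L\<^sup>2 - 4 * c\<^sup>2) * y\<^sup>2 + 2 * c\<^sup>2 * y ^ 4 \<partial>\<mu>)
      = S\<^sup>2 + 2 * L\<^sup>2 - 2 * c\<^sup>2 + 2 * c\<^sup>2 * (\<integral>y. y ^ 4 \<partial>\<mu>)"
    using law_integrable law_fourth by (simp add: law_mean law_var prob_space)
  also have "\<dots> \<le> S\<^sup>2 + 2 * L\<^sup>2 + 2 * m4 * c\<^sup>2"
  proof -
    have "2 * c\<^sup>2 * (\<integral>y. y ^ 4 \<partial>\<mu>) \<le> 2 * c\<^sup>2 * m4"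
      by (rule mult_left_mono[OF law_fourth(2)]) simp
    moreover have "0 \<le> c\<^sup>2" "2 * c\<^sup>2 * m4 = 2 * m4 * c\<^sup>2" by simp_all
    ultimately show ?thesis by linarith
  qed
  finally show ?thesis by (simp add: ennreal_leI)
qed

text \<open>Induction on the coordinates with \<open>nn_integral_quadratic_step\<close>. Since
  \<open>C\<close> need not be symmetric, the linear coefficient of coordinate j is C i j + C j i,
  whose square is at most twice the sum of the squares; with the factor 2 of the step this gives the
  4, and the diagonal gives 2 \<open>m4\<close>.\<close>

lemma nn_integral_quadratic_form:
  assumes "finite F"
  shows "(\<integral>\<^sup>+x. ennreal (((\<Sum>i\<in>F. \<Sum>k\<in>F. C i k * x i * x k) - (\<Sum>i\<in>F. C i i))\<^sup>2) \<partial>PiM F (\<lambda>_. \<mu>))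
     \<le> ennreal ((4 + 2 * m4) * (\<Sum>i\<in>F. \<Sum>k\<in>F. (C i k)\<^sup>2))"
  using assms
proof induction
  case empty
  then show ?case by simp
next
  case (insert j F)
  interpret PP: product_sigma_finite "\<lambda>_. \<mu>" by (rule product_sigma_finite_const)
  interpret F: prob_space "PiM F (\<lambda>_. \<mu>)" by (rule prob_space_const_PiM)
  note fin = insert(1) and j = insert(2)
  let ?K = "4 + 2 * m4"
  let ?S = "\<lambda>x. (\<Sum>i\<in>F. \<Sum>k\<in>F. C i k * x i * x k) - (\<Sum>i\<in>F. C i i)"
  let ?L = "\<lambda>x. \<Sum>i\<in>F. (C i j + C j i) * x i"
  have "(\<integral>\<^sup>+x. ennreal (((\<Sum>i\<in>insert j F. \<Sum>k\<in>insert j F. C i k * x i * x k) - (\<Sum>i\<in>insert j F. C i i))\<^sup>2)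
       \<partial>PiM (insert j F) (\<lambda>_. \<mu>))
      = (\<integral>\<^sup>+x. \<integral>\<^sup>+y. ennreal (((\<Sum>i\<in>insert j F. \<Sum>k\<in>insert j F. C i k * (x(j := y)) i * (x(j := y)) k) -
          (\<Sum>i\<in>insert j F. C i i))\<^sup>2) \<partial>\<mu> \<partial>PiM F (\<lambda>_. \<mu>))"
    by (rule PP.product_nn_integral_insert) (use insert in \<open>auto\<close>)
  also have "\<dots> = (\<integral>\<^sup>+x. \<integral>\<^sup>+y. ennreal ((?S x + y * ?L x + C j j * (y\<^sup>2 - 1))\<^sup>2) \<partial>\<mu> \<partial>PiM F (\<lambda>_. \<mu>))"
  proof (intro nn_integral_cong arg_cong[where f = ennreal] arg_cong[where f = "\<lambda>x. x\<^sup>2"])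
    fix x :: "'a \<Rightarrow> real" and y :: real
    have ne: "i \<noteq> j" if "i \<in> F" for i using that j by auto
    have "(\<Sum>i\<in>insert j F. \<Sum>k\<in>insert j F. C i k * (x(j := y)) i * (x(j := y)) k)
       = C j j * y * y + (\<Sum>k\<in>F. C j k * y * x k) + ((\<Sum>i\<in>F. C i j * x i * y) + (\<Sum>i\<in>F. \<Sum>k\<in>F. C i k * x i * x k))"
      using fin j ne by (simp add: sum.distrib)
    moreover have "y * ?L x = (\<Sum>k\<in>F. C j k * y * x k) + (\<Sum>i\<in>F. C i j * x i * y)"
      by (simp add: sum_distrib_left sum.distrib[symmetric] algebra_simps)
    moreover have "(\<Sum>i\<in>insert j F. C i i) = C j j + (\<Sum>i\<in>F. C i i)" using fin j by simp
    ultimately show "(\<Sum>i\<in>insert j F. \<Sum>k\<in>insert j F. C i k * (x(j := y)) i * (x(j := y)) k) - (\<Sum>i\<in>insert j F. C i i)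
        = ?S x + y * ?L x + C j j * (y\<^sup>2 - 1)"
      by (simp add: algebra_simps power2_eq_square)
  qed
  also have "\<dots> \<le> (\<integral>\<^sup>+x. ennreal ((?S x)\<^sup>2 + 2 * (?L x)\<^sup>2 + 2 * m4 * (C j j)\<^sup>2) \<partial>PiM F (\<lambda>_. \<mu>))"
    by (intro nn_integral_mono nn_integral_quadratic_step)
  also have "\<dots> = (\<integral>\<^sup>+x. (ennreal ((?S x)\<^sup>2) + 2 * ennreal ((?L x)\<^sup>2)) + ennreal (2 * m4 * (C j j)\<^sup>2) \<partial>PiM F (\<lambda>_. \<mu>))"
    using m4_nonneg by (intro nn_integral_cong) (simp add: ennreal_mult)
  also have "\<dots> = ((\<integral>\<^sup>+x. ennreal ((?S x)\<^sup>2) \<partial>PiM F (\<lambda>_. \<mu>)) + 2 * (\<integral>\<^sup>+x. ennreal ((?L x)\<^sup>2) \<partial>PiM F (\<lambda>_. \<mu>)))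
      + ennreal (2 * m4 * (C j j)\<^sup>2)"
  proof -
    have [measurable]: "(\<lambda>x. ennreal ((?S x)\<^sup>2)) \<in> borel_measurable (PiM F (\<lambda>_. \<mu>))" by measurable
    have [measurable]: "(\<lambda>x. ennreal ((?L x)\<^sup>2)) \<in> borel_measurable (PiM F (\<lambda>_. \<mu>))" by measurable
    show ?thesis
      by (simp add: nn_integral_add nn_integral_cmult F.emeasure_space_1)
  qed
  also have "\<dots> \<le> (ennreal (?K * (\<Sum>i\<in>F. \<Sum>k\<in>F. (C i k)\<^sup>2)) + 2 * ennreal (\<Sum>i\<in>F. (C i j + C j i)\<^sup>2))
      + ennreal (2 * m4 * (C j j)\<^sup>2)"
    by (intro add_mono insert.IH mult_left_mono order.refl) (simp_all add: nn_integral_linear_form fin)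
  also have "\<dots> = ennreal (?K * (\<Sum>i\<in>F. \<Sum>k\<in>F. (C i k)\<^sup>2) + 2 * (\<Sum>i\<in>F. (C i j + C j i)\<^sup>2) + 2 * m4 * (C j j)\<^sup>2)"
    using m4_nonneg by (simp add: ennreal_mult' sum_nonneg)
  also have "\<dots> \<le> ennreal (?K * (\<Sum>i\<in>insert j F. \<Sum>k\<in>insert j F. (C i k)\<^sup>2))"
  proof (rule ennreal_leI)
    have e: "(\<Sum>i\<in>insert j F. \<Sum>k\<in>insert j F. (C i k)\<^sup>2) =
      (C j j)\<^sup>2 + (\<Sum>i\<in>F. (C j i)\<^sup>2 + (C i j)\<^sup>2) + (\<Sum>i\<in>F. \<Sum>k\<in>F. (C i k)\<^sup>2)"
      using fin j by (simp add: sum.distrib)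
    have sq: "(C i j + C j i)\<^sup>2 \<le> 2 * ((C j i)\<^sup>2 + (C i j)\<^sup>2)" for i
      using sum_squares_bound[of "C i j" "C j i"] by (simp add: power2_eq_square algebra_simps)
    define U where "U = (\<Sum>i\<in>F. (C j i)\<^sup>2 + (C i j)\<^sup>2)"
    have "(\<Sum>i\<in>F. (C i j + C j i)\<^sup>2) \<le> 2 * U"
      unfolding U_def sum_distrib_left by (intro sum_mono sq)
    moreover have "0 \<le> m4 * U"
      using m4_nonneg unfolding U_def by (intro mult_nonneg_nonneg sum_nonneg) auto
    moreover have "0 \<le> (C j j)\<^sup>2" by simp
    moreover have "?K * ((C j j)\<^sup>2 + U + (\<Sum>i\<in>F. \<Sum>k\<in>F. (C i k)\<^sup>2)) =
        4 * (C j j)\<^sup>2 + 2 * m4 * (C j j)\<^sup>2 + 4 * U + 2 * (m4 * U) + ?K * (\<Sum>i\<in>F. \<Sum>k\<in>F. (C i k)\<^sup>2)"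
      by (simp add: algebra_simps)
    ultimately show "?K * (\<Sum>i\<in>F. \<Sum>k\<in>F. (C i k)\<^sup>2) + 2 * (\<Sum>i\<in>F. (C i j + C j i)\<^sup>2) + 2 * m4 * (C j j)\<^sup>2
      \<le> ?K * (\<Sum>i\<in>insert j F. \<Sum>k\<in>insert j F. (C i k)\<^sup>2)"
      unfolding e U_def[symmetric] by linarith
  qed
  finally show ?case .
qed

end

section \<open>Concentration for functions of independent blocks\<close>

text \<open>Converts exponential moments of both signs into a fourth moment. The 64 is 8 squared,
  from squaring v^2 / 8 <= exp (v / 2).\<close>

lemma power4_le_exp: "(u::real) ^ 4 \<le> 64 * (exp u + exp (- u))"
proof -
  have *: "v ^ 4 \<le> 64 * exp v" if v: "v \<ge> 0" for v :: real
  proof -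
    have "v\<^sup>2 / 8 \<le> exp (v / 2)"
      using exp_lower_Taylor_quadratic[of "v / 2"] v by (simp add: power2_eq_square field_simps)
    hence "(v\<^sup>2 / 8)\<^sup>2 \<le> (exp (v / 2))\<^sup>2" by (intro power_mono) auto
    also have "\<dots> = exp v" by (simp add: power2_eq_square exp_add[symmetric])
    finally show ?thesis by (simp add: power_divide power_mult[symmetric])
  qed
  show ?thesis
  proof (cases "u \<ge> 0")
    case True
    have "0 \<le> exp (- u)" by simp
    with *[OF True] show ?thesis unfolding distrib_left by linarith
  next
    case False
    have "0 \<le> exp u" by simp
    moreover have "u ^ 4 \<le> 64 * exp (- u)" using *[of "-u"] False by simp
    ultimately show ?thesis unfolding distrib_left by linarith
  qed
qed

context prob_space
begin

text \<open>The blocks are the index sets \<open>A \<times> {j}\<close> with \<open>j \<in> C\<close>.\<close>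

lemma mgf_block_differences:
  fixes f :: "('i \<times> 'j \<Rightarrow> 'a) \<Rightarrow> real" and A :: "'i set"
  assumes "finite A" "finite C" and l: "l > 0"
    and meas: "f \<in> borel_measurable (PiM (A \<times> C) (\<lambda>_. M))"
    and bd: "\<And>x. x \<in> space (PiM (A \<times> C) (\<lambda>_. M)) \<Longrightarrow> \<bar>f x\<bar> \<le> B"
    and diff: "\<And>j x x'. j \<in> C \<Longrightarrow> x \<in> space (PiM (A \<times> C) (\<lambda>_. M)) \<Longrightarrow> x' \<in> space (PiM (A \<times> C) (\<lambda>_. M)) \<Longrightarrow>
      (\<And>i k. i \<in> A \<Longrightarrow> k \<in> C \<Longrightarrow> k \<noteq> j \<Longrightarrow> x (i, k) = x' (i, k)) \<Longrightarrow> \<bar>f x - f x'\<bar> \<le> c"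
  shows "(\<integral>\<^sup>+x. ennreal (exp (l * f x)) \<partial>PiM (A \<times> C) (\<lambda>_. M))
     \<le> ennreal (exp (l * (\<integral>x. f x \<partial>PiM (A \<times> C) (\<lambda>_. M)) + real (card C) * (l\<^sup>2 * c\<^sup>2 / 2)))"
  using \<open>finite C\<close> meas bd diff
proof (induction C arbitrary: f rule: finite_induct)
  case empty
  show ?case by (simp add: PiM_empty nn_integral_count_space_finite lebesgue_integral_count_space_finite)
next
  case (insert j C)
  let ?I = "A \<times> C" and ?J = "A \<times> {j}"
  let ?P = "\<lambda>I. PiM I (\<lambda>_. M)"
  interpret QQ: product_sigma_finite "\<lambda>_. M" by (rule product_sigma_finite_const)
  have IJ: "A \<times> insert j C = ?I \<union> ?J" "?I \<inter> ?J = {}" "finite ?I" "finite ?J"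
    using insert \<open>finite A\<close> by auto
  note meas = insert.prems(1)[unfolded IJ(1)] and bd = insert.prems(2)[unfolded IJ(1)]
    and diff = insert.prems(3)[unfolded IJ(1)]
  have mg: "(\<lambda>p. f (merge ?I ?J p)) \<in> borel_measurable (?P ?I \<Otimes>\<^sub>M ?P ?J)"
    using meas by measurable
  have mx [measurable]: "(\<lambda>y. f (merge ?I ?J (x, y))) \<in> borel_measurable (?P ?J)" if "x \<in> space (?P ?I)" for x
    by (rule measurable_compose[OF measurable_Pair1'[OF that] mg, unfolded o_def])
  have sp: "merge ?I ?J (x, y) \<in> space (?P (?I \<union> ?J))" if "x \<in> space (?P ?I)" "y \<in> space (?P ?J)" for x y
    using that by (intro measurable_space[OF measurable_merge]) (auto simp: space_pair_measure)
  \<comment> \<open>Averaging over block j preserves the bounded differences in the remaining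
    blocks, so the induction hypothesis applies to \<open>g\<close>. The fluctuation of
    \<open>f\<close> around \<open>g\<close> lives in block j alone and is left to Hoeffding's
    lemma.\<close>
  define g where "g = (\<lambda>x. \<integral>y. f (merge ?I ?J (x, y)) \<partial>?P ?J)"
  interpret J: prob_space "?P ?J" by (rule prob_space_const_PiM)
  interpret I: prob_space "?P ?I" by (rule prob_space_const_PiM)
  interpret U: prob_space "?P (?I \<union> ?J)" by (rule prob_space_const_PiM)
  have intJ: "integrable (?P ?J) (\<lambda>y. f (merge ?I ?J (x, y)))" if "x \<in> space (?P ?I)" for x
    by (rule J.integrable_const_bound[where B = B]) (use that mx bd sp in auto)
  have g_meas: "g \<in> borel_measurable (?P ?I)"
    unfolding g_def using mg by (intro J.borel_measurable_lebesgue_integral) (simp add: split_beta')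
  have g_bd: "\<bar>g x\<bar> \<le> B" if "x \<in> space (?P ?I)" for x
  proof -
    have "\<bar>g x\<bar> \<le> (\<integral>y. \<bar>f (merge ?I ?J (x, y))\<bar> \<partial>?P ?J)" unfolding g_def by (rule integral_abs_bound)
    also have "\<dots> \<le> B"
      using that intJ[OF that] bd sp by (intro J.integral_le_const) auto
    finally show ?thesis .
  qed
  have g_diff: "\<bar>g x - g x'\<bar> \<le> c" if "k \<in> C" "x \<in> space (?P ?I)" "x' \<in> space (?P ?I)"
     "\<And>i l. i \<in> A \<Longrightarrow> l \<in> C \<Longrightarrow> l \<noteq> k \<Longrightarrow> x (i, l) = x' (i, l)" for k x x'
  proof -
    have "g x - g x' = (\<integral>y. f (merge ?I ?J (x, y)) - f (merge ?I ?J (x', y)) \<partial>?P ?J)"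
      unfolding g_def by (rule Bochner_Integration.integral_diff[symmetric]) (use intJ that in auto)
    hence "\<bar>g x - g x'\<bar> \<le> (\<integral>y. \<bar>f (merge ?I ?J (x, y)) - f (merge ?I ?J (x', y))\<bar> \<partial>?P ?J)"
      by (simp add: integral_abs_bound)
    also have "\<dots> \<le> c"
    proof (rule J.integral_le_const)
      show "integrable (?P ?J) (\<lambda>y. \<bar>f (merge ?I ?J (x, y)) - f (merge ?I ?J (x', y))\<bar>)"
        using intJ that by auto
      show "AE y in ?P ?J. \<bar>f (merge ?I ?J (x, y)) - f (merge ?I ?J (x', y))\<bar> \<le> c"
        using that insert(2) by (intro AE_I2 diff[of k] sp) (auto simp: merge_def)
    qed
    finally show ?thesis .
  qed
  have "(\<integral>\<^sup>+x. ennreal (exp (l * f x)) \<partial>?P (?I \<union> ?J)) =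
     (\<integral>\<^sup>+x. \<integral>\<^sup>+y. ennreal (exp (l * f (merge ?I ?J (x, y)))) \<partial>?P ?J \<partial>?P ?I)"
    by (rule QQ.product_nn_integral_fold) (use IJ meas in auto)
  also have "\<dots> \<le> (\<integral>\<^sup>+x. ennreal (exp (l * g x)) * ennreal (exp (l\<^sup>2 * c\<^sup>2 / 2)) \<partial>?P ?I)"
  proof (rule nn_integral_mono)
    fix x assume x: "x \<in> space (?P ?I)"
    obtain y0 where y0: "y0 \<in> space (?P ?J)" using J.not_empty by blast
    let ?f = "\<lambda>y. f (merge ?I ?J (x, y))"
    \<comment> \<open>With the other blocks fixed, all values lie within \<open>c\<close> of the
      value at an arbitrary point \<open>y0\<close>. The interval has length 2c, and (2c)^2 / 8 is
      the c^2 / 2 contributed by each block.\<close>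
    interpret H: interval_bounded_random_variable "?P ?J" ?f "?f y0 - c" "?f y0 + c"
    proof
      show "?f \<in> borel_measurable (?P ?J)" using x by (rule mx)
      have "\<bar>?f y - ?f y0\<bar> \<le> c" if "y \<in> space (?P ?J)" for y
        using that x y0 insert(2) by (intro diff[of j] sp) (auto simp: merge_def)
      thus "AE y in ?P ?J. ?f y \<in> {?f y0 - c..?f y0 + c}"
        by (intro AE_I2) (auto simp: abs_le_iff algebra_simps)
    qed
    have "(\<integral>\<^sup>+y. ennreal (exp (l * ?f y)) \<partial>?P ?J)
      = (\<integral>\<^sup>+y. ennreal (exp (l * g x)) * ennreal (exp (l * (?f y - J.expectation ?f))) \<partial>?P ?J)"
      by (intro nn_integral_cong)
        (simp add: g_def ennreal_mult[symmetric] exp_add[symmetric] algebra_simps)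
    also have "\<dots> = ennreal (exp (l * g x)) * (\<integral>\<^sup>+y. ennreal (exp (l * (?f y - J.expectation ?f))) \<partial>?P ?J)"
      using mx[OF x] by (intro nn_integral_cmult) measurable
    also have "\<dots> \<le> ennreal (exp (l * g x)) * ennreal (exp (l\<^sup>2 * ((?f y0 + c) - (?f y0 - c))\<^sup>2 / 8))"
      by (intro mult_left_mono H.Hoeffdings_lemma_nn_integral l) auto
    also have "((?f y0 + c) - (?f y0 - c))\<^sup>2 = 4 * c\<^sup>2" by (simp add: power2_eq_square)
    finally show "(\<integral>\<^sup>+y. ennreal (exp (l * ?f y)) \<partial>?P ?J) \<le> ennreal (exp (l * g x)) * ennreal (exp (l\<^sup>2 * c\<^sup>2 / 2))"
      by (simp add: mult.commute)
  qed
  also have "\<dots> = (\<integral>\<^sup>+x. ennreal (exp (l * g x)) \<partial>?P ?I) * ennreal (exp (l\<^sup>2 * c\<^sup>2 / 2))"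
    using g_meas by (intro nn_integral_multc) measurable
  also have "\<dots> \<le> ennreal (exp (l * (\<integral>x. g x \<partial>?P ?I) + real (card C) * (l\<^sup>2 * c\<^sup>2 / 2))) * ennreal (exp (l\<^sup>2 * c\<^sup>2 / 2))"
    using g_meas g_bd g_diff by (intro mult_right_mono insert.IH) auto
  also have "(\<integral>x. g x \<partial>?P ?I) = (\<integral>x. f x \<partial>?P (?I \<union> ?J))"
    unfolding g_def
    by (rule QQ.product_integral_fold[symmetric])
       (use IJ meas bd in \<open>auto intro!: U.integrable_const_bound[where B = B]\<close>)
  finally show ?case
    using insert(1,2) unfolding IJ(1)
    by (simp add: ennreal_mult[symmetric] exp_add[symmetric] algebra_simps add_divide_distrib)
qed

text \<open>The exponential bound is applied to f and to -f at one parameter only. The fourth moment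
  then has order c^4 n^2 for n blocks, which divided by n^4 is summable.\<close>

lemma fourth_moment_block_differences:
  fixes f :: "('i \<times> 'j \<Rightarrow> 'a) \<Rightarrow> real" and A :: "'i set"
  assumes "finite A" "finite C" "C \<noteq> {}" and c: "c > 0"
    and meas: "f \<in> borel_measurable (PiM (A \<times> C) (\<lambda>_. M))"
    and bd: "\<And>x. x \<in> space (PiM (A \<times> C) (\<lambda>_. M)) \<Longrightarrow> \<bar>f x\<bar> \<le> B"
    and diff: "\<And>j x x'. j \<in> C \<Longrightarrow> x \<in> space (PiM (A \<times> C) (\<lambda>_. M)) \<Longrightarrow> x' \<in> space (PiM (A \<times> C) (\<lambda>_. M)) \<Longrightarrow>
      (\<And>i k. i \<in> A \<Longrightarrow> k \<in> C \<Longrightarrow> k \<noteq> j \<Longrightarrow> x (i, k) = x' (i, k)) \<Longrightarrow> \<bar>f x - f x'\<bar> \<le> c"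
  shows "(\<integral>\<^sup>+x. ennreal ((f x - (\<integral>x. f x \<partial>PiM (A \<times> C) (\<lambda>_. M))) ^ 4) \<partial>PiM (A \<times> C) (\<lambda>_. M))
     \<le> ennreal (100 * c ^ 4 * (real (card C))\<^sup>2)"
proof -
  let ?P = "PiM (A \<times> C) (\<lambda>_. M)"
  interpret P: prob_space ?P by (rule prob_space_const_PiM)
  define v where "v = real (card C) * (c\<^sup>2 / 2)"
  have n: "real (card C) > 0" using assms by (simp add: card_gt_0_iff)
  have v: "v > 0" unfolding v_def using n c by simp
  \<comment> \<open>The inverse of the sub-Gaussian scale sqrt v, so that both centered exponential
    moments are at most \<open>exp 1\<close>.\<close>
  define l where "l = 1 / sqrt v"
  have l: "l > 0" using v by (simp add: l_def)
  have lv: "l\<^sup>2 * v = 1" using v by (simp add: l_def power_divide)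
  define E where "E = (\<integral>x. f x \<partial>?P)"
  have mgf: "(\<integral>\<^sup>+x. ennreal (exp (l * (f x - E))) \<partial>?P) \<le> ennreal (exp 1)"
  proof -
    have "(\<integral>\<^sup>+x. ennreal (exp (l * (f x - E))) \<partial>?P) = (\<integral>\<^sup>+x. ennreal (exp (l * f x)) * ennreal (exp (- l * E)) \<partial>?P)"
      by (intro nn_integral_cong) (simp add: ennreal_mult[symmetric] exp_add[symmetric] algebra_simps)
    also have "\<dots> = (\<integral>\<^sup>+x. ennreal (exp (l * f x)) \<partial>?P) * ennreal (exp (- l * E))"
      using meas by (intro nn_integral_multc) measurable
    also have "\<dots> \<le> ennreal (exp (l * E + real (card C) * (l\<^sup>2 * c\<^sup>2 / 2))) * ennreal (exp (- l * E))"
      unfolding E_def by (intro mult_right_mono mgf_block_differences[where B = B] assms l) auto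
    also have "real (card C) * (l\<^sup>2 * c\<^sup>2 / 2) = 1" using lv by (simp add: v_def algebra_simps)
    finally show ?thesis by (simp add: ennreal_mult[symmetric] exp_add[symmetric])
  qed
  have mgf': "(\<integral>\<^sup>+x. ennreal (exp (- (l * (f x - E)))) \<partial>?P) \<le> ennreal (exp 1)"
  proof -
    have "(\<integral>\<^sup>+x. ennreal (exp (- (l * (f x - E)))) \<partial>?P) = (\<integral>\<^sup>+x. ennreal (exp (l * (- f x))) * ennreal (exp (l * E)) \<partial>?P)"
      by (intro nn_integral_cong) (simp add: ennreal_mult[symmetric] exp_add[symmetric] algebra_simps)
    also have "\<dots> = (\<integral>\<^sup>+x. ennreal (exp (l * (- f x))) \<partial>?P) * ennreal (exp (l * E))"
      using meas by (intro nn_integral_multc) measurable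
    also have "\<dots> \<le> ennreal (exp (l * (\<integral>x. - f x \<partial>?P) + real (card C) * (l\<^sup>2 * c\<^sup>2 / 2))) * ennreal (exp (l * E))"
    proof (intro mult_right_mono mgf_block_differences[where B = B] assms l)
      show "(\<lambda>x. - f x) \<in> borel_measurable ?P" using meas by measurable
    next
      fix x assume "x \<in> space ?P"
      thus "\<bar>- f x\<bar> \<le> B" using bd by simp
    next
      fix j x x' assume "j \<in> C" "x \<in> space ?P" "x' \<in> space ?P"
        "\<And>i k. i \<in> A \<Longrightarrow> k \<in> C \<Longrightarrow> k \<noteq> j \<Longrightarrow> x (i, k) = x' (i, k)"
      from diff[OF this] show "\<bar>- f x - - f x'\<bar> \<le> c" by simp
    qed auto
    also have "real (card C) * (l\<^sup>2 * c\<^sup>2 / 2) = 1" using lv by (simp add: v_def algebra_simps)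
    finally show ?thesis by (simp add: ennreal_mult[symmetric] exp_add[symmetric] E_def)
  qed
  have "(\<integral>\<^sup>+x. ennreal ((f x - E) ^ 4) \<partial>?P) \<le>
      (\<integral>\<^sup>+x. ennreal (64 / l ^ 4) * (ennreal (exp (l * (f x - E))) + ennreal (exp (- (l * (f x - E))))) \<partial>?P)"
  proof (rule nn_integral_mono)
    fix x
    have "(f x - E) ^ 4 \<le> 64 / l ^ 4 * (exp (l * (f x - E)) + exp (- (l * (f x - E))))"
    proof -
      have "l ^ 4 * (f x - E) ^ 4 \<le> 64 * (exp (l * (f x - E)) + exp (- (l * (f x - E))))"
        using power4_le_exp[of "l * (f x - E)"] by (simp only: power_mult_distrib)
      thus ?thesis using l by (simp add: pos_le_divide_eq mult.commute)
    qed
    thus "ennreal ((f x - E) ^ 4) \<le> ennreal (64 / l ^ 4) * (ennreal (exp (l * (f x - E))) + ennreal (exp (- (l * (f x - E)))))"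
      using l by (simp add: ennreal_plus[symmetric] ennreal_mult[symmetric] ennreal_leI del: ennreal_plus)
  qed
  also have "\<dots> = ennreal (64 / l ^ 4) * ((\<integral>\<^sup>+x. ennreal (exp (l * (f x - E))) \<partial>?P) + (\<integral>\<^sup>+x. ennreal (exp (- (l * (f x - E)))) \<partial>?P))"
  proof -
    have [measurable]: "f \<in> borel_measurable ?P" by (rule meas)
    show ?thesis by (subst nn_integral_cmult; (subst nn_integral_add)?; measurable)
  qed
  also have "\<dots> \<le> ennreal (64 / l ^ 4) * (ennreal (exp 1) + ennreal (exp 1))"
    by (intro mult_left_mono add_mono mgf mgf') auto
  also have "\<dots> = ennreal (128 * exp 1 / l ^ 4)"
    using l by (simp add: ennreal_plus[symmetric] ennreal_mult[symmetric] del: ennreal_plus)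
  also have "128 * exp 1 / l ^ 4 = 128 * exp 1 * v\<^sup>2"
  proof -
    have "l\<^sup>2 = 1 / v" using v by (simp add: l_def power_divide)
    moreover have "l ^ 4 = (l\<^sup>2)\<^sup>2" by simp
    ultimately have "l ^ 4 = 1 / v\<^sup>2" by (simp add: power_divide)
    thus ?thesis by simp
  qed
  finally have "(\<integral>\<^sup>+x. ennreal ((f x - E) ^ 4) \<partial>?P) \<le> ennreal (128 * exp 1 * v\<^sup>2)" .
  also have "128 * exp 1 * v\<^sup>2 \<le> 128 * 3 * v\<^sup>2" using exp_le by (intro mult_right_mono mult_left_mono) auto
  \<comment> \<open>Here 128 * 3 / 4 = 96 is rounded up to a square, whose root 10 reappears in
    \<open>trace_msq\<close>.\<close>
  also have "\<dots> \<le> 100 * c ^ 4 * (real (card C))\<^sup>2"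
    by (simp add: v_def power_mult_distrib power_divide)
  finally show ?thesis by (simp add: ennreal_leI E_def)
qed

end

section \<open>Resolvents and their deterministic equivalents at a negative point\<close>

text \<open>This is S S^T - z I at z = -t.\<close>

definition gram :: "nat \<Rightarrow> (nat \<Rightarrow> nat \<Rightarrow> real) \<Rightarrow> real \<Rightarrow> nat \<Rightarrow> nat \<Rightarrow> real" where
  "gram n S t i k = (\<Sum>j<n. S i j * S k j) + (if i = k then t else 0)"

abbreviation (input) colv :: "(nat \<Rightarrow> nat \<Rightarrow> real) \<Rightarrow> nat \<Rightarrow> nat \<Rightarrow> real" where
  "colv S j \<equiv> (\<lambda>i. S i j)"

abbreviation (input) transp :: "(nat \<Rightarrow> nat \<Rightarrow> 'a) \<Rightarrow> nat \<Rightarrow> nat \<Rightarrow> 'a" where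
  "transp S \<equiv> (\<lambda>j i. S i j)"

text \<open>The column is set to zero rather than deleted, so the dimensions and the numbering of
  the columns do not change.\<close>

definition erase :: "nat \<Rightarrow> (nat \<Rightarrow> nat \<Rightarrow> real) \<Rightarrow> nat \<Rightarrow> nat \<Rightarrow> real" where
  "erase j S i k = (if k = j then 0 else S i k)"

text \<open>The matrix \<Psi>^{-1} - z A \<Psi>' A^T at z = -t, with arbitrary diagonal weights in
  place of the solution.\<close>

definition wgram :: "nat \<Rightarrow> (nat \<Rightarrow> nat \<Rightarrow> real) \<Rightarrow> real \<Rightarrow> (nat \<Rightarrow> real) \<Rightarrow> (nat \<Rightarrow> real) \<Rightarrow> nat \<Rightarrow> nat \<Rightarrow> real" where
  "wgram n A t b b' i k = (if i = k then 1 / b i else 0) + t * (\<Sum>j<n. A i j * b' j * A k j)"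

lemma app_rank_sum:
  "(\<Sum>k<N. (\<Sum>j<n. A i j * c j * A k j) * v k) = (\<Sum>j<n. c j * A i j * dot N (colv A j) v)"
proof -
  have "(\<Sum>k<N. (\<Sum>j<n. A i j * c j * A k j) * v k) = (\<Sum>k<N. \<Sum>j<n. A i j * c j * A k j * v k)"
    by (intro sum.cong refl sum_distrib_right)
  also have "\<dots> = (\<Sum>j<n. \<Sum>k<N. A i j * c j * A k j * v k)" by (rule sum.swap)
  also have "\<dots> = (\<Sum>j<n. c j * A i j * dot N (colv A j) v)"
    by (simp add: dot_def sum_distrib_left mult_ac)
  finally show ?thesis .
qed

lemma app_gram:
  assumes "i < N"
  shows "app N (gram n S t) v i = (\<Sum>j<n. S i j * dot N (colv S j) v) + t * v i"
  using assms app_rank_sum[of S i "\<lambda>_. 1" n v N]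
  by (simp add: app_def gram_def distrib_right sum.distrib if_distrib[of "\<lambda>x. x * _"] cong: if_cong)

lemma app_wgram:
  assumes "i < N"
  shows "app N (wgram n A t b b') v i = v i / b i + t * (\<Sum>j<n. b' j * A i j * dot N (colv A j) v)"
  using assms app_rank_sum[of A i b' n v N]
  by (simp add: app_def wgram_def distrib_right sum.distrib mult.assoc sum_distrib_left[symmetric]
      if_distrib[of "\<lambda>x. x * _"] cong: if_cong)

lemma dot_rank_sum:
  "dot N w (\<lambda>i. \<Sum>j<n. c j * A i j * d j) = (\<Sum>j<n. c j * dot N (colv A j) w * d j)"
proof -
  have "dot N w (\<lambda>i. \<Sum>j<n. c j * A i j * d j) = (\<Sum>i<N. \<Sum>j<n. w i * (c j * A i j * d j))"
    by (simp add: dot_def sum_distrib_left)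
  also have "\<dots> = (\<Sum>j<n. \<Sum>i<N. w i * (c j * A i j * d j))" by (rule sum.swap)
  also have "\<dots> = (\<Sum>j<n. c j * dot N (colv A j) w * d j)"
    by (simp add: dot_def sum_distrib_left sum_distrib_right mult_ac)
  finally show ?thesis .
qed

lemma dot_app_gram: "dot N w (app N (gram n S t) v) = (\<Sum>j<n. dot N (colv S j) w * dot N (colv S j) v) + t * dot N w v"
proof -
  have "dot N w (app N (gram n S t) v) = dot N w (\<lambda>i. (\<Sum>j<n. 1 * S i j * dot N (colv S j) v) + t * v i)"
    by (rule dot_cong) (simp_all add: app_gram)
  also have "\<dots> = (\<Sum>j<n. dot N (colv S j) w * dot N (colv S j) v) + t * dot N w v"
    unfolding dot_add_right dot_rank_sum dot_scale_right by simp
  finally show ?thesis .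
qed

lemma dot_app_wgram: "dot N w (app N (wgram n A t b b') v) =
   dot N w (\<lambda>i. v i / b i) + t * (\<Sum>j<n. b' j * dot N (colv A j) w * dot N (colv A j) v)"
proof -
  have "dot N w (app N (wgram n A t b b') v) =
      dot N w (\<lambda>i. v i / b i + t * (\<Sum>j<n. b' j * A i j * dot N (colv A j) v))"
    by (rule dot_cong) (simp_all add: app_wgram)
  thus ?thesis unfolding dot_add_right dot_rank_sum dot_scale_right by simp
qed

lemma posdef_gram: "t > 0 \<Longrightarrow> posdef t N (gram n S t)"
  by (auto simp: posdef_def gram_def mult.commute dot_app_gram sum_nonneg)

text \<open>The lower bound comes from the diagonal alone, since 1 / b >= t; the part in A only adds
  a nonnegative form, whatever the size of A.\<close>

lemma posdef_wgram:
  assumes "t > 0" "\<And>i. i < N \<Longrightarrow> 0 < b i" "\<And>i. i < N \<Longrightarrow> b i \<le> 1 / t" "\<And>j. j < n \<Longrightarrow> 0 \<le> b' j"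
  shows "posdef t N (wgram n A t b b')"
  unfolding posdef_def
proof (intro conjI allI impI)
  fix v
  have "t * (v i * v i) \<le> v i * (v i / b i)" if "i < N" for i
  proof -
    have "t \<le> 1 / b i" using assms(1) assms(2,3)[OF that] by (simp add: field_simps)
    hence "t * (v i * v i) \<le> 1 / b i * (v i * v i)" by (rule mult_right_mono) simp
    thus ?thesis by simp
  qed
  hence "t * dot N v v \<le> dot N v (\<lambda>i. v i / b i)"
    unfolding dot_def sum_distrib_left by (intro sum_mono) auto
  moreover have "0 \<le> t * (\<Sum>j<n. b' j * dot N (colv A j) v * dot N (colv A j) v)"
  proof (intro mult_nonneg_nonneg[of t] sum_nonneg)
    fix j assume "j \<in> {..<n}"
    hence "0 \<le> b' j * (dot N (colv A j) v * dot N (colv A j) v)" using assms by (intro mult_nonneg_nonneg zero_le_square) auto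
    thus "0 \<le> b' j * dot N (colv A j) v * dot N (colv A j) v" by (simp add: mult.assoc)
  qed (use assms in simp)
  ultimately show "t * dot N v v \<le> dot N v (app N (wgram n A t b b') v)"
    by (simp add: dot_app_wgram)
qed (use assms in \<open>auto simp: wgram_def mult_ac\<close>)

lemma gram_rank1:
  assumes "j < n" "i < N"
  shows "app N (gram n S t) v i = app N (gram n (erase j S) t) v i + dot N (colv S j) v * colv S j i"
proof -
  have "(\<Sum>k<n. S i k * dot N (colv S k) v) =
     S i j * dot N (colv S j) v + (\<Sum>k\<in>{..<n} - {j}. S i k * dot N (colv S k) v)"
    using assms by (intro sum.remove) auto
  moreover have "(\<Sum>k<n. erase j S i k * dot N (colv (erase j S) k) v) =
     erase j S i j * dot N (colv (erase j S) j) v + (\<Sum>k\<in>{..<n} - {j}. erase j S i k * dot N (colv (erase j S) k) v)"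
    using assms by (intro sum.remove) auto
  moreover have "(\<Sum>k\<in>{..<n} - {j}. erase j S i k * dot N (colv (erase j S) k) v) =
     (\<Sum>k\<in>{..<n} - {j}. S i k * dot N (colv S k) v)"
    by (intro sum.cong) (auto simp: erase_def)
  ultimately show ?thesis using assms by (simp add: app_gram erase_def algebra_simps)
qed

text \<open>A diagonal entry of the identity t (S^T S + t)^{-1} = I - S^T (S S^T + t)^{-1} S. The
  vector \<open>w\<close> below is column j of the right-hand side, and S^T S + t is checked to map
  it to t times the unit vector.\<close>

lemma gram_transp_diag:
  assumes t: "t > 0" and j: "j < n"
  shows "t * minv n (gram N (transp S) t) j j = 1 - dot N (colv S j) (app N (minv N (gram n S t)) (colv S j))"
proof -
  let ?H = "gram n S t" and ?G = "gram N (transp S) t"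
  let ?Q = "app N (minv N ?H)"
  define w where "w = (\<lambda>k. unitv j k - dot N (colv S k) (?Q (colv S j)))"
  have "app n ?G w k = t * unitv j k" if k: "k < n" for k
  proof -
    have d: "dot n (\<lambda>k. S i k) w = S i j - (\<Sum>k<n. S i k * dot N (colv S k) (?Q (colv S j)))" for i
      unfolding w_def using j by (simp add: dot_diff_right) (simp add: dot_def)
    have "app N ?H (?Q (colv S j)) i = S i j" if "i < N" for i
      by (rule posdef_app_minv(1)[OF posdef_gram[OF t] that])
    hence h: "(\<Sum>k<n. S i k * dot N (colv S k) (?Q (colv S j))) + t * ?Q (colv S j) i = S i j" if "i < N" for i
      using that by (simp add: app_gram)
    have "dot n (\<lambda>k. S i k) w = t * ?Q (colv S j) i" if "i < N" for i
      using h[OF that] d by simp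
    hence "(\<Sum>i<N. S i k * dot n (\<lambda>k. S i k) w) = t * dot N (colv S k) (?Q (colv S j))"
      by (simp add: dot_def[of N] sum_distrib_left mult_ac)
    thus ?thesis using k by (simp add: app_gram w_def algebra_simps)
  qed
  hence "app n (minv n ?G) (app n ?G w) j = app n (minv n ?G) (\<lambda>k. t * unitv j k) j"
    by (intro fun_cong[OF app_cong]) auto
  hence "w j = t * minv n ?G j j"
    using posdef_app_minv(2)[OF posdef_gram[OF t, of n N "transp S"] j, of w] j
    by (simp only: app_scale app_unitv)
  thus ?thesis by (simp add: w_def)
qed

text \<open>Sherman-Morrison for one erased column. Its factor 1 / (1 + \<xi>^T Q0 \<xi>) equals t
  times a diagonal entry \<open>q\<close> of the co-resolvent, which is how the two families of
  weights become coupled.\<close>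

lemma
  fixes S :: "nat \<Rightarrow> nat \<Rightarrow> real" and N n :: nat
  assumes t: "t > 0" and j: "j < n"
  defines "Q \<equiv> app N (minv N (gram n S t))" and "Q0 \<equiv> app N (minv N (gram n (erase j S) t))"
  defines "q \<equiv> minv n (gram N (transp S) t) j j" and "\<xi> \<equiv> colv S j"
  shows leave_one_nonneg: "0 \<le> dot N \<xi> (Q0 \<xi>)"
    and leave_one_q: "q = 1 / (t * (1 + dot N \<xi> (Q0 \<xi>)))"
    and leave_one_self: "dot N \<xi> (Q v) = t * q * dot N \<xi> (Q0 v)"
    and leave_one_other: "dot N a (Q v) = dot N a (Q0 v) - t * q * dot N \<xi> (Q0 v) * dot N a (Q0 \<xi>)"
proof -
  have B0: "posdef t N (gram n (erase j S) t)" and B: "posdef t N (gram n S t)"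
    using t by (auto intro: posdef_gram)
  have r: "i < N \<Longrightarrow> app N (gram n S t) v i = app N (gram n (erase j S) t) v i + dot N \<xi> v * \<xi> i" for v i
    unfolding \<xi>_def by (rule gram_rank1[OF j])
  let ?\<kappa> = "dot N \<xi> (Q0 \<xi>)"
  show k: "0 \<le> ?\<kappa>" unfolding Q0_def by (rule rank1_nonneg[OF B0 B r])
  have s: "dot N a (Q v) = dot N a (Q0 v) - dot N \<xi> (Q0 v) / (1 + ?\<kappa>) * dot N a (Q0 \<xi>)" for a v
  proof -
    have "dot N a (Q v) = dot N a (\<lambda>i. Q0 v i - dot N \<xi> (Q0 v) / (1 + ?\<kappa>) * Q0 \<xi> i)"
      unfolding Q_def Q0_def by (rule dot_cong[OF refl]) (rule rank1_minv[OF B0 B r])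
    thus ?thesis by (simp only: dot_linear)
  qed
  have "t * q = 1 - dot N \<xi> (Q \<xi>)"
    unfolding q_def \<xi>_def Q_def by (rule gram_transp_diag[OF t j])
  also have "dot N \<xi> (Q \<xi>) = ?\<kappa> / (1 + ?\<kappa>)" using k by (subst s) (simp add: field_simps)
  finally have tq: "t * q = 1 / (1 + ?\<kappa>)" using k by (simp add: field_simps)
  have "q = t * q / t" using t by simp
  thus "q = 1 / (t * (1 + ?\<kappa>))" unfolding tq by (simp add: mult.commute)
  show "dot N \<xi> (Q v) = t * q * dot N \<xi> (Q0 v)"
  proof -
    have "x - x / (1 + ?\<kappa>) * ?\<kappa> = 1 / (1 + ?\<kappa>) * x" for x using k by (simp add: field_simps)
    thus ?thesis by (simp only: s tq)
  qed
  show "dot N a (Q v) = dot N a (Q0 v) - t * q * dot N \<xi> (Q0 v) * dot N a (Q0 \<xi>)"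
    by (subst s) (simp add: tq)
qed

text \<open>Both sides are \<open>Tr D R (H - W) Q\<close> with \<open>H\<close>, \<open>W\<close> the inverses of \<open>Q\<close> and \<open>R\<close>.\<close>

lemma trace_resolvent_difference:
  fixes A S :: "nat \<Rightarrow> nat \<Rightarrow> real" and D :: "nat \<Rightarrow> real" and N n :: nat
  assumes t: "t > 0" and W: "posdef t N (wgram n A t b b')"
  defines "Q \<equiv> minv N (gram n S t)" and "R \<equiv> minv N (wgram n A t b b')"
  defines "K \<equiv> \<lambda>i k. D i * R i k"
  shows "(\<Sum>i<N. D i * (R i i - Q i i)) =
     (\<Sum>j<n. dot N (colv S j) (app N Q (app N K (colv S j))))
     - (\<Sum>l<N. (1 / b l - t) * mulm N Q K l l)
     - t * (\<Sum>j<n. b' j * dot N (colv A j) (app N Q (app N K (colv A j))))"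
proof -
  note H = posdef_gram[OF t, of N n S]
  \<comment> \<open>The three vectors split (H - W) Q applied to a unit vector. The shift t of
    \<open>gram\<close> is merged with the diagonal of \<open>wgram\<close>, hence the coefficient 1
    / b - t, which for \<open>weight\<close> is t times the parameter.\<close>
  define u where "u = (\<lambda>i l. (\<Sum>j<n. 1 * S l j * dot N (colv S j) (app N Q (unitv i))))"
  define u' where "u' = (\<lambda>i l. (1 / b l - t) * app N Q (unitv i) l)"
  define u'' where "u'' = (\<lambda>i l. \<Sum>j<n. b' j * A l j * dot N (colv A j) (app N Q (unitv i)))"
  have Kapp: "app N K v i = D i * app N R v i" for v i
    by (simp add: K_def app_def sum_distrib_left mult.assoc)
  have main: "D i * (R i i - Q i i) = app N K (u i) i - app N K (u' i) i - t * app N K (u'' i) i" if i: "i < N" for i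
  proof -
    have "app N R (app N (gram n S t) (app N Q (unitv i))) i = app N R (unitv i) i"
      by (rule fun_cong[OF app_cong]) (use H in \<open>simp add: Q_def posdef_app_minv\<close>)
    hence 1: "app N R (app N (gram n S t) (app N Q (unitv i))) i = R i i" using i by (simp add: app_unitv)
    have "app N R (app N (wgram n A t b b') (app N Q (unitv i))) i = app N Q (unitv i) i"
      unfolding R_def by (rule posdef_app_minv(2)[OF W i])
    hence 2: "app N R (app N (wgram n A t b b') (app N Q (unitv i))) i = Q i i" using i by (simp add: app_unitv)
    have "R i i - Q i i = app N R (\<lambda>l. app N (gram n S t) (app N Q (unitv i)) l - app N (wgram n A t b b') (app N Q (unitv i)) l) i"
      by (simp add: app_diff 1 2)
    also have "\<dots> = app N R (\<lambda>l. u i l - u' i l - t * u'' i l) i"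
      by (rule fun_cong[OF app_cong])
         (simp add: app_gram app_wgram u_def u'_def u''_def algebra_simps)
    also have "\<dots> = app N R (u i) i - app N R (u' i) i - t * app N R (u'' i) i"
      by (simp only: app_diff app_scale)
    finally have e: "R i i - Q i i = app N R (u i) i - app N R (u' i) i - t * app N R (u'' i) i" .
    show ?thesis unfolding e Kapp by (simp add: algebra_simps)
  qed
  have QH: "dot N v (app N Q w) = dot N (app N Q v) w" for v w
    unfolding Q_def by (rule posdef_minv_dot[OF H])
  have rank: "(\<Sum>i<N. app N K (\<lambda>l. \<Sum>j<n. c j * B l j * dot N (colv B j) (app N Q (unitv i))) i) =
     (\<Sum>j<n. c j * dot N (colv B j) (app N Q (app N K (colv B j))))" for c B
  proof -
    have "app N K (\<lambda>l. \<Sum>j<n. c j * B l j * d j) i = (\<Sum>j<n. c j * app N K (colv B j) i * d j)" for d i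
      using dot_rank_sum[of N "K i" c B d n] by (simp add: app_def dot_def mult.commute)
    moreover have "dot N (colv B j) (app N Q (unitv i)) = app N Q (colv B j) i" if "i < N" for i j
      using that by (simp add: QH)
    ultimately have "(\<Sum>i<N. app N K (\<lambda>l. \<Sum>j<n. c j * B l j * dot N (colv B j) (app N Q (unitv i))) i)
        = (\<Sum>i<N. \<Sum>j<n. c j * app N K (colv B j) i * app N Q (colv B j) i)"
      by (intro sum.cong) auto
    also have "\<dots> = (\<Sum>j<n. \<Sum>i<N. c j * app N K (colv B j) i * app N Q (colv B j) i)" by (rule sum.swap)
    also have "\<dots> = (\<Sum>j<n. c j * dot N (app N Q (colv B j)) (app N K (colv B j)))"
      by (simp add: dot_def sum_distrib_left mult_ac)
    finally show ?thesis by (simp add: QH)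
  qed
  have diag: "(\<Sum>i<N. app N K (u' i) i) = (\<Sum>l<N. (1 / b l - t) * mulm N Q K l l)"
  proof -
    have "(\<Sum>i<N. app N K (u' i) i) = (\<Sum>i<N. \<Sum>l<N. (1 / b l - t) * (Q l i * K i l))"
      by (intro sum.cong refl) (simp add: app_def[of N K] u'_def app_unitv mult_ac)
    also have "\<dots> = (\<Sum>l<N. \<Sum>i<N. (1 / b l - t) * (Q l i * K i l))" by (rule sum.swap)
    finally show ?thesis by (simp add: mulm_def sum_distrib_left)
  qed
  have "(\<Sum>i<N. D i * (R i i - Q i i)) = (\<Sum>i<N. app N K (u i) i) - (\<Sum>i<N. app N K (u' i) i) - t * (\<Sum>i<N. app N K (u'' i) i)"
    by (simp add: main sum_subtractf sum_distrib_left)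
  also have "(\<Sum>i<N. app N K (u i) i) = (\<Sum>j<n. dot N (colv S j) (app N Q (app N K (colv S j))))"
    using rank[of "\<lambda>_. 1" S] by (simp add: u_def)
  also have "(\<Sum>i<N. app N K (u'' i) i) = (\<Sum>j<n. b' j * dot N (colv A j) (app N Q (app N K (colv A j))))"
    unfolding u''_def by (rule rank)
  finally show ?thesis by (simp add: diag)
qed

text \<open>
  At \<open>z = -t\<close> the fundamental system reads \<open>\<psi>\<^sub>i = weight t \<tau>' i\<close> with \<open>\<tau>' i = 1/n Tr D'\<^sub>i T'\<close>,
  where \<open>T\<close> is the inverse of \<open>wgram n A t \<psi> \<psi>'\<close>.
\<close>

definition weight :: "real \<Rightarrow> (nat \<Rightarrow> real) \<Rightarrow> nat \<Rightarrow> real" where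
  "weight t p i = 1 / (t * (1 + p i))"

lemma weight_bounds:
  assumes "t > 0" "0 \<le> p i"
  shows "0 < weight t p i" "weight t p i \<le> 1 / t"
proof -
  show "0 < weight t p i" using assms by (simp add: weight_def)
  have "t * 1 \<le> t * (1 + p i)" using assms by (intro mult_left_mono) auto
  thus "weight t p i \<le> 1 / t" using assms by (simp only: weight_def) (intro divide_left_mono; simp)
qed

section \<open>Stability of the deterministic equivalent under changes of the weights\<close>

lemma posdef_weights:
  assumes "t > 0" "\<And>i. i < N \<Longrightarrow> 0 \<le> p' i" "\<And>j. j < n \<Longrightarrow> 0 \<le> p j"
  shows "posdef t N (wgram n A t (weight t p') (weight t p))"
  using assms by (intro posdef_wgram) (auto intro: weight_bounds less_imp_le[OF weight_bounds(1)])

text \<open>For v = R e_i the form of R^{-1} at v equals the diagonal entry R i i, at most 1/t, and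
  it dominates t times the weighted sum of the squared products with the columns of A. Since t
  \<open>weight t p j\<close> >= 1 / (1 + c), the weights can be removed. This replaces a bound on
  the operator norm of A.\<close>

lemma wgram_columns_bound:
  fixes A :: "nat \<Rightarrow> nat \<Rightarrow> real" and N n :: nat
  assumes t: "t > 0" and p': "\<And>i. i < N \<Longrightarrow> 0 \<le> p' i" and p: "\<And>j. j < n \<Longrightarrow> 0 \<le> p j"
    and c: "\<And>j. j < n \<Longrightarrow> p j \<le> c" and c0: "0 \<le> c" and i: "i < N"
  defines "R \<equiv> minv N (wgram n A t (weight t p') (weight t p))"
  shows "(\<Sum>j<n. (dot N (colv A j) (app N R (unitv i)))\<^sup>2) \<le> (1 + c) / t"
proof -
  let ?W = "wgram n A t (weight t p') (weight t p)"
  note W = posdef_weights[where A = A, OF t p' p]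
  let ?v = "app N R (unitv i)"
  have "t * (\<Sum>j<n. weight t p j * (dot N (colv A j) ?v)\<^sup>2) \<le> dot N ?v (app N ?W ?v)"
  proof -
    have "0 \<le> dot N ?v (\<lambda>l. ?v l / weight t p' l)"
      unfolding dot_def using weight_bounds(1)[OF t p']
      by (intro sum_nonneg) (auto simp: less_imp_le)
    thus ?thesis by (simp add: dot_app_wgram power2_eq_square mult.assoc)
  qed
  also have "dot N ?v (app N ?W ?v) = dot N ?v (unitv i)"
    by (rule dot_cong) (simp_all add: R_def posdef_app_minv[OF W])
  also have "\<dots> \<le> 1 / t"
    using i posdef_minv_diag(2)[OF W i] by (simp add: R_def app_unitv)
  finally have *: "t * (\<Sum>j<n. weight t p j * (dot N (colv A j) ?v)\<^sup>2) \<le> 1 / t" .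
  have "(\<Sum>j<n. (dot N (colv A j) ?v)\<^sup>2) \<le> (\<Sum>j<n. (1 + c) * (t * (weight t p j * (dot N (colv A j) ?v)\<^sup>2)))"
  proof (rule sum_mono)
    fix j assume j: "j \<in> {..<n}"
    hence pj: "0 \<le> p j" "p j \<le> c" using p c by auto
    have "t * weight t p j = 1 / (1 + p j)" using t by (simp add: weight_def)
    hence "1 \<le> (1 + c) * (t * weight t p j)" using pj by simp
    from mult_right_mono[OF this, of "(dot N (colv A j) ?v)\<^sup>2"]
    show "(dot N (colv A j) ?v)\<^sup>2 \<le> (1 + c) * (t * (weight t p j * (dot N (colv A j) ?v)\<^sup>2))"
      by (simp add: mult.assoc)
  qed
  also have "\<dots> = (1 + c) * (t * (\<Sum>j<n. weight t p j * (dot N (colv A j) ?v)\<^sup>2))"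
    by (simp add: sum_distrib_left)
  also have "\<dots> \<le> (1 + c) * (1 / t)" using c0 by (intro mult_left_mono *) auto
  finally show ?thesis by simp
qed

text \<open>R - T = R (V - W) T, with W and V the inverses of R and T. The diagonal of V - W is at
  most t \<delta> and meets two vectors of norm 1/t, giving \<delta> / t. The A-part gives (1 + c)
  \<delta> / t, and the sum is the stated bound.\<close>

lemma wgram_stability:
  fixes A :: "nat \<Rightarrow> nat \<Rightarrow> real" and N n :: nat
  assumes t: "t > 0" and c0: "0 \<le> c" and \<delta>: "0 \<le> \<delta>"
    and p': "\<And>i. i < N \<Longrightarrow> 0 \<le> p' i" and p: "\<And>j. j < n \<Longrightarrow> 0 \<le> p j \<and> p j \<le> c"
    and \<tau>': "\<And>i. i < N \<Longrightarrow> 0 \<le> \<tau>' i" and \<tau>: "\<And>j. j < n \<Longrightarrow> 0 \<le> \<tau> j \<and> \<tau> j \<le> c"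
    and d': "\<And>i. i < N \<Longrightarrow> \<bar>p' i - \<tau>' i\<bar> \<le> \<delta>" and d: "\<And>j. j < n \<Longrightarrow> \<bar>p j - \<tau> j\<bar> \<le> \<delta>"
    and i: "i < N"
  defines "R \<equiv> minv N (wgram n A t (weight t p') (weight t p))"
    and "T \<equiv> minv N (wgram n A t (weight t \<tau>') (weight t \<tau>))"
  shows "\<bar>R i i - T i i\<bar> \<le> (2 + c) * \<delta> / t"
proof -
  let ?W = "wgram n A t (weight t p') (weight t p)" and ?V = "wgram n A t (weight t \<tau>') (weight t \<tau>)"
  have W: "posdef t N ?W" and V: "posdef t N ?V"
    using t p p' \<tau> \<tau>' by (auto intro!: posdef_weights)
  let ?r = "app N R (unitv i)" and ?s = "app N T (unitv i)"
  have "dot N ?r (app N ?V ?s) = dot N ?r (unitv i)"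
    by (rule dot_cong) (simp_all add: T_def posdef_app_minv[OF V])
  moreover have "dot N ?r (app N ?W ?s) = dot N (app N ?W ?r) ?s"
    by (rule symmetric_dot_app) (use W in \<open>simp add: posdef_def\<close>)
  moreover have "dot N (app N ?W ?r) ?s = dot N (unitv i) ?s"
    by (rule dot_cong) (simp_all add: R_def posdef_app_minv[OF W])
  ultimately have "R i i - T i i = dot N ?r (app N ?V ?s) - dot N ?r (app N ?W ?s)"
    using i by (simp add: app_unitv)
  also have "\<dots> = dot N ?r (\<lambda>l. ?s l / weight t \<tau>' l - ?s l / weight t p' l)
     + t * (\<Sum>j<n. (weight t \<tau> j - weight t p j) * dot N (colv A j) ?r * dot N (colv A j) ?s)"
    by (simp add: dot_app_wgram dot_diff_right sum_subtractf algebra_simps)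
  finally have eq: "R i i - T i i = dot N ?r (\<lambda>l. ?s l / weight t \<tau>' l - ?s l / weight t p' l)
     + t * (\<Sum>j<n. (weight t \<tau> j - weight t p j) * dot N (colv A j) ?r * dot N (colv A j) ?s)" .
  have u1: "dot N (unitv i) (unitv i) = 1" using i by simp
  have nr: "dot N ?r ?r \<le> (1 / t)\<^sup>2" "dot N ?s ?s \<le> (1 / t)\<^sup>2"
    using posdef_minv_norm[OF W, of "unitv i"] posdef_minv_norm[OF V, of "unitv i"]
    unfolding R_def T_def u1 by (simp_all add: power_divide)
  have A1: "\<bar>dot N ?r (\<lambda>l. ?s l / weight t \<tau>' l - ?s l / weight t p' l)\<bar> \<le> \<delta> / t"
  proof -
    let ?w = "\<lambda>l. ?s l / weight t \<tau>' l - ?s l / weight t p' l"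
    have w: "?w l = t * (\<tau>' l - p' l) * ?s l" if "l < N" for l
      using t p'[OF that] \<tau>'[OF that] by (simp add: weight_def algebra_simps)
    have "dot N ?w ?w \<le> (t * \<delta>)\<^sup>2 * dot N ?s ?s"
      unfolding dot_def sum_distrib_left
    proof (rule sum_mono)
      fix l assume "l \<in> {..<N}"
      hence l: "l < N" by simp
      have "(\<tau>' l - p' l)\<^sup>2 \<le> \<delta>\<^sup>2" using d'[OF l] \<delta> by (simp add: abs_le_square_iff[symmetric])
      hence "t\<^sup>2 * (\<tau>' l - p' l)\<^sup>2 * (?s l)\<^sup>2 \<le> t\<^sup>2 * \<delta>\<^sup>2 * (?s l)\<^sup>2"
        by (intro mult_right_mono mult_left_mono) auto
      thus "?w l * ?w l \<le> (t * \<delta>)\<^sup>2 * (?s l * ?s l)"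
        unfolding w[OF l] by (simp add: power2_eq_square mult_ac)
    qed
    also have "\<dots> \<le> (t * \<delta>)\<^sup>2 * (1 / t)\<^sup>2" by (intro mult_left_mono nr) auto
    also have "\<dots> = \<delta>\<^sup>2" using t by (simp add: power_mult_distrib power_divide)
    finally have "\<bar>dot N ?r ?w\<bar> \<le> 1 / t * \<delta>" using nr t \<delta> by (intro dot_le_of_sq) auto
    thus ?thesis by simp
  qed
  \<comment> \<open>Cauchy-Schwarz over the columns of A: the weight differences are at most
    \<delta> / t, and \<open>wgram_columns_bound\<close> controls the remaining column sums for R
    and for T.\<close>
  have A2: "\<bar>\<Sum>j<n. (weight t \<tau> j - weight t p j) * dot N (colv A j) ?r * dot N (colv A j) ?s\<bar> \<le> \<delta> / t * ((1 + c) / t)"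
  proof -
    let ?f = "\<lambda>j. (weight t \<tau> j - weight t p j) * dot N (colv A j) ?r" and ?g = "\<lambda>j. dot N (colv A j) ?s"
    have bR: "(\<Sum>j<n. (dot N (colv A j) ?r)\<^sup>2) \<le> (1 + c) / t"
      unfolding R_def using t p p' i c0 by (intro wgram_columns_bound) auto
    have bT: "(\<Sum>j<n. (dot N (colv A j) ?s)\<^sup>2) \<le> (1 + c) / t"
      unfolding T_def using t \<tau> \<tau>' i c0 by (intro wgram_columns_bound) auto
    have "dot n ?f ?f \<le> (\<delta> / t)\<^sup>2 * (\<Sum>j<n. (dot N (colv A j) ?r)\<^sup>2)"
      unfolding dot_def[of n] sum_distrib_left
    proof (rule sum_mono)
      fix j assume "j \<in> {..<n}"
      hence j: "j < n" by simp
      have pj: "0 \<le> p j" "0 \<le> \<tau> j" using p[OF j] \<tau>[OF j] by auto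
      have "weight t \<tau> j - weight t p j = (p j - \<tau> j) / (t * ((1 + \<tau> j) * (1 + p j)))"
      proof -
        have "1 / (t * x) - 1 / (t * y) = (y - x) / (t * (x * y))" if "x \<noteq> 0" "y \<noteq> 0" for x y
          using that t by (simp add: field_simps)
        from this[of "1 + \<tau> j" "1 + p j"] show ?thesis using pj by (simp add: weight_def)
      qed
      hence "\<bar>weight t \<tau> j - weight t p j\<bar> = \<bar>p j - \<tau> j\<bar> / (t * ((1 + \<tau> j) * (1 + p j)))"
        using t pj by simp
      also have "\<dots> \<le> \<bar>p j - \<tau> j\<bar> / (t * 1)"
      proof -
        have "1 * 1 \<le> (1 + \<tau> j) * (1 + p j)" using pj by (intro mult_mono) auto
        thus ?thesis using t by (intro divide_left_mono mult_left_mono) (auto intro!: mult_pos_pos)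
      qed
      also have "\<dots> \<le> \<delta> / t" using d[OF j] t by (simp add: divide_right_mono)
      finally have "(weight t \<tau> j - weight t p j)\<^sup>2 \<le> (\<delta> / t)\<^sup>2"
        using t \<delta> by (simp add: abs_le_square_iff[symmetric])
      from mult_right_mono[OF this, of "(dot N (colv A j) ?r)\<^sup>2"]
      show "?f j * ?f j \<le> (\<delta> / t)\<^sup>2 * (dot N (colv A j) ?r)\<^sup>2"
        by (simp add: power2_eq_square mult_ac)
    qed
    also have "\<dots> \<le> (\<delta> / t)\<^sup>2 * ((1 + c) / t)" by (intro mult_left_mono bR) auto
    also have "\<dots> = (\<delta> / t * sqrt ((1 + c) / t))\<^sup>2"
    proof -
      have "(sqrt ((1 + c) / t))\<^sup>2 = (1 + c) / t" using c0 t by simp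
      thus ?thesis by (simp only: power_mult_distrib)
    qed
    finally have f: "dot n ?f ?f \<le> (\<delta> / t * sqrt ((1 + c) / t))\<^sup>2" .
    have g: "dot n ?g ?g \<le> (sqrt ((1 + c) / t))\<^sup>2"
      using bT c0 t by (simp add: dot_def[of n] power2_eq_square[symmetric])
    have "\<bar>dot n ?f ?g\<bar> \<le> \<delta> / t * sqrt ((1 + c) / t) * sqrt ((1 + c) / t)"
      using t c0 \<delta> by (intro dot_le_of_sq f g) auto
    also have "\<dots> = \<delta> / t * ((1 + c) / t)" using t c0 by (simp add: mult.assoc real_sqrt_mult_self)
    finally show ?thesis by (simp add: dot_def[of n])
  qed
  have "\<bar>R i i - T i i\<bar> \<le> \<delta> / t + t * (\<delta> / t * ((1 + c) / t))"
    unfolding eq using A1 mult_left_mono[OF A2, of t] t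
    by (intro order_trans[OF abs_triangle_ineq] add_mono) (auto simp: abs_mult)
  also have "\<dots> = (2 + c) * \<delta> / t" using t by (simp add: field_simps)
  finally show ?thesis .
qed

section \<open>The approximate fixed point equation for the mean resolvent\<close>

text \<open>The heart of the cancellation. Since q - b = t b q (p - \<kappa>), the term (q - b)
  \<beta> combines with t b q \<alpha> \<beta> into -t b q \<beta> (\<kappa> - p - \<alpha>). So
  \<alpha> and \<beta>, which are of order one, survive only next to a small factor; the e's are
  forms in the noise.\<close>

lemma bracket_identity:
  fixes t :: real
  assumes t: "t > 0" and k: "0 \<le> \<kappa>" and p: "0 \<le> p"
  defines "q \<equiv> 1 / (t * (1 + \<kappa>))" and "b \<equiv> 1 / (t * (1 + p))"
  shows "q * (e3 + \<beta> + e4) - b * (\<beta> - t * q * (\<beta> + e2) * (\<alpha> + e1))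
    = q * (e3 + e4) + t * b * q * (\<alpha> * e2 + e1 * \<beta> + e1 * e2 - \<beta> * (\<kappa> - p - \<alpha>))"
proof -
  have "q - b = t * b * q * (p - \<kappa>)"
    using t k p by (simp add: q_def b_def frac_eq_eq diff_frac_eq) (simp add: algebra_simps)
  hence "q * \<beta> - b * \<beta> = t * b * q * (p - \<kappa>) * \<beta>" by (simp add: left_diff_distrib[symmetric])
  thus ?thesis by (simp add: algebra_simps)
qed

lemma bracket_bound:
  fixes t :: real
  assumes t: "t > 0" and k: "0 \<le> \<kappa>" and p: "0 \<le> p"
    and ab: "\<bar>\<alpha>\<bar> \<le> ca" "\<bar>\<beta>\<bar> \<le> cb"
  shows "\<bar>1 / (t * (1 + \<kappa>)) * (e3 + \<beta> + e4) - 1 / (t * (1 + p)) * (\<beta> - t * (1 / (t * (1 + \<kappa>))) * (\<beta> + e2) * (\<alpha> + e1))\<bar>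
    \<le> 1 / t * (\<bar>e3\<bar> + \<bar>e4\<bar> + ca * \<bar>e2\<bar> + cb * \<bar>e1\<bar> + (e1\<^sup>2 + e2\<^sup>2) + cb * \<bar>\<kappa> - p - \<alpha>\<bar>)"
proof -
  let ?q = "1 / (t * (1 + \<kappa>))" and ?b = "1 / (t * (1 + p))"
  have q: "0 \<le> ?q" "?q \<le> 1 / t"
    using weight_bounds[OF t, of "\<lambda>_. \<kappa>" 0, unfolded weight_def] k by linarith+
  have b: "0 \<le> ?b" "?b \<le> 1 / t"
    using weight_bounds[OF t, of "\<lambda>_. p" 0, unfolded weight_def] p by linarith+
  have "t * ?b \<le> 1" using mult_left_mono[OF b(2) less_imp_le[OF t]] t by simp
  hence "t * ?b * ?q \<le> 1 * (1 / t)" by (rule mult_mono[OF _ q(2) _ q(1)]) simp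
  hence tbq: "0 \<le> t * ?b * ?q" "t * ?b * ?q \<le> 1 / t" using q(1) b(1) less_imp_le[OF t] by (simp_all only: mult_nonneg_nonneg mult_1)
  \<comment> \<open>Second moments of \<open>e1\<close> and \<open>e2\<close> are what will be
    controlled, so the product is traded for squares.\<close>
  have e12: "\<bar>e1 * e2\<bar> \<le> e1\<^sup>2 + e2\<^sup>2"
  proof -
    have "2 * (\<bar>e1\<bar> * \<bar>e2\<bar>) \<le> \<bar>e1\<bar>\<^sup>2 + \<bar>e2\<bar>\<^sup>2" using sum_squares_bound[of "\<bar>e1\<bar>" "\<bar>e2\<bar>"] by simp
    moreover have "0 \<le> \<bar>e1\<bar> * \<bar>e2\<bar>" by simp
    ultimately show ?thesis unfolding abs_mult power2_abs by linarith
  qed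
  have "\<bar>\<alpha> * e2 + e1 * \<beta> + e1 * e2 - \<beta> * (\<kappa> - p - \<alpha>)\<bar> \<le> \<bar>\<alpha> * e2\<bar> + \<bar>e1 * \<beta>\<bar> + \<bar>e1 * e2\<bar> + \<bar>\<beta> * (\<kappa> - p - \<alpha>)\<bar>"
    by linarith
  also have "\<dots> \<le> ca * \<bar>e2\<bar> + cb * \<bar>e1\<bar> + (e1\<^sup>2 + e2\<^sup>2) + cb * \<bar>\<kappa> - p - \<alpha>\<bar>"
    using ab e12 by (intro add_mono) (auto simp: abs_mult mult_right_mono mult.commute[of "\<bar>e1\<bar>"])
  finally have 2: "\<bar>\<alpha> * e2 + e1 * \<beta> + e1 * e2 - \<beta> * (\<kappa> - p - \<alpha>)\<bar>
     \<le> ca * \<bar>e2\<bar> + cb * \<bar>e1\<bar> + (e1\<^sup>2 + e2\<^sup>2) + cb * \<bar>\<kappa> - p - \<alpha>\<bar>" .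
  have "\<bar>?q * (e3 + e4)\<bar> \<le> 1 / t * (\<bar>e3\<bar> + \<bar>e4\<bar>)"
    unfolding abs_mult abs_of_nonneg[OF q(1)]
    by (rule mult_mono[OF q(2) abs_triangle_ineq _ abs_ge_zero]) (use t in simp)
  moreover have "\<bar>t * ?b * ?q * (\<alpha> * e2 + e1 * \<beta> + e1 * e2 - \<beta> * (\<kappa> - p - \<alpha>))\<bar>
      \<le> 1 / t * (ca * \<bar>e2\<bar> + cb * \<bar>e1\<bar> + (e1\<^sup>2 + e2\<^sup>2) + cb * \<bar>\<kappa> - p - \<alpha>\<bar>)"
    unfolding abs_mult[of "t * ?b * ?q"] abs_of_nonneg[OF tbq(1)]
    by (rule mult_mono[OF tbq(2) 2 _ abs_ge_zero]) (use t in simp)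
  ultimately show ?thesis
    unfolding bracket_identity[OF t k p]
    by (intro order_trans[OF abs_triangle_ineq]) (simp add: distrib_left)
qed

lemma opbound_diag_right:
  assumes "\<And>i. i < N \<Longrightarrow> \<bar>d i\<bar> \<le> c" "0 \<le> c" "opbound N B b"
  shows "opbound N (\<lambda>i k. B i k * d k) (b * c)"
  unfolding opbound_def
proof (intro conjI allI)
  fix v
  have e: "app N (\<lambda>i k. B i k * d k) v = app N B (\<lambda>k. d k * v k)"
    by (auto simp: app_def mult.assoc)
  have "dot N (app N B (\<lambda>k. d k * v k)) (app N B (\<lambda>k. d k * v k)) \<le> b\<^sup>2 * dot N (\<lambda>k. d k * v k) (\<lambda>k. d k * v k)"
    using assms by (simp add: opbound_def)
  also have "\<dots> \<le> b\<^sup>2 * (c\<^sup>2 * dot N v v)"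
  proof (rule mult_left_mono)
    show "dot N (\<lambda>k. d k * v k) (\<lambda>k. d k * v k) \<le> c\<^sup>2 * dot N v v"
    unfolding dot_def sum_distrib_left
  proof (rule sum_mono)
    fix i assume "i \<in> {..<N}"
    hence "(d i)\<^sup>2 \<le> c\<^sup>2" using assms by (auto simp: abs_le_square_iff[symmetric])
    from mult_right_mono[OF this, of "(v i)\<^sup>2"]
    show "d i * v i * (d i * v i) \<le> c\<^sup>2 * (v i * v i)" by (simp add: power2_eq_square mult_ac)
    qed
  qed simp
  finally show "dot N (app N (\<lambda>i k. B i k * d k) v) (app N (\<lambda>i k. B i k * d k) v) \<le> (b * c)\<^sup>2 * dot N v v"
    unfolding e by (simp add: power_mult_distrib mult_ac)
qed (use assms in \<open>auto simp: opbound_def\<close>)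

lemma opbound_app:
  assumes "opbound N B b" "dot N v v \<le> c"
  shows "dot N (app N B v) (app N B v) \<le> b\<^sup>2 * c"
  using assms by (meson mult_left_mono opbound_def order_trans zero_le_power2)

text \<open>The identity, which makes the plain trace of \<open>Q\<close> and the weights
  \<open>p\<close> the special case K = I of the estimates for Tr Q K.\<close>

definition one_matrix :: "nat \<Rightarrow> nat \<Rightarrow> real" where
  "one_matrix i k = (if i = k then 1 else 0)"

lemma app_one_matrix: "i < N \<Longrightarrow> app N one_matrix v i = v i"
  by (simp add: app_def one_matrix_def if_distrib[of "\<lambda>x. x * _"] cong: if_cong)

lemma opbound_one_matrix: "opbound N one_matrix 1"
  unfolding opbound_def by (auto intro!: eq_refl dot_cong simp: app_one_matrix)

lemma mulm_one_matrix: "k < N \<Longrightarrow> mulm N B one_matrix i k = B i k"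
  by (simp add: mulm_def one_matrix_def if_distrib[of "\<lambda>x. _ * x"] cong: if_cong)

text \<open>
  The entries are \<open>r i j = \<sigma>\<^sub>i\<^sub>j / \<surd>n\<close>. The scale \<open>m\<close> will be \<open>n\<close>; it is a separate parameter so
  that the assumptions are invariant under transposition.
\<close>

locale noise_model = entry_law \<mu> m4 for \<mu> :: "real measure" and m4 :: real +
  fixes N n :: nat and r A :: "nat \<Rightarrow> nat \<Rightarrow> real" and t m s \<kappa> a :: real
  assumes t: "t > 0" and m: "m \<ge> 1" and s: "s > 0" and a: "a \<ge> 0" and \<kappa>: "\<kappa> \<ge> 0"
    and N_le: "real N \<le> \<kappa> * m" and n_le: "real n \<le> \<kappa> * m" and n_pos: "n > 0"
    and r_le: "\<And>i j. i < N \<Longrightarrow> j < n \<Longrightarrow> (r i j)\<^sup>2 \<le> s / m"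
    and A_le: "\<And>j. j < n \<Longrightarrow> dot N (colv A j) (colv A j) \<le> a"
begin

abbreviation "J \<equiv> {..<N} \<times> {..<n}"
abbreviation "P \<equiv> PiM J (\<lambda>_. \<mu>)"

definition "Y j x = (\<lambda>i. r i j * x (i, j))"
definition "S x = (\<lambda>i j. r i j * x (i, j) + A i j)"
definition "Q x = minv N (gram n (S x) t)"
definition "Q0 j x = minv N (gram n (erase j (S x)) t)"
definition "q x j = minv n (gram N (transp (S x)) t) j j"

sublocale P: prob_space P by (rule prob_space_const_PiM)

lemma colv_S: "colv (S x) j = (\<lambda>i. Y j x i + A i j)"
  by (simp add: S_def Y_def)

lemma S_measurable: "i < N \<Longrightarrow> j < n \<Longrightarrow> (\<lambda>x. S x i j) \<in> borel_measurable P"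
  unfolding S_def by measurable

lemma Y_measurable: "i < N \<Longrightarrow> j < n \<Longrightarrow> (\<lambda>x. Y j x i) \<in> borel_measurable P"
  unfolding Y_def by measurable

lemma dot_measurable:
  "(\<And>i. i < N' \<Longrightarrow> (\<lambda>x. v x i) \<in> borel_measurable M) \<Longrightarrow> (\<And>i. i < N' \<Longrightarrow> (\<lambda>x. w x i) \<in> borel_measurable M) \<Longrightarrow>
    (\<lambda>x. dot N' (v x) (w x)) \<in> borel_measurable M"
  unfolding dot_def by (intro borel_measurable_sum borel_measurable_times) auto

lemma app_measurable:
  "(\<And>k. k < N' \<Longrightarrow> (\<lambda>x. B x i k) \<in> borel_measurable M) \<Longrightarrow> (\<And>k. k < N' \<Longrightarrow> (\<lambda>x. v x k) \<in> borel_measurable M) \<Longrightarrow>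
    (\<lambda>x. app N' (B x) (v x) i) \<in> borel_measurable M"
  unfolding app_def by (intro borel_measurable_sum borel_measurable_times) auto

lemma mulm_measurable:
  "(\<And>k. k < N' \<Longrightarrow> (\<lambda>x. B x i k) \<in> borel_measurable M) \<Longrightarrow>
    (\<lambda>x. mulm N' (B x) K i l) \<in> borel_measurable M"
  unfolding mulm_def by (intro borel_measurable_sum borel_measurable_times) auto

lemma minv_gram_measurable:
  assumes "\<And>i j. i < N' \<Longrightarrow> j < n' \<Longrightarrow> (\<lambda>x. B x i j) \<in> borel_measurable M" "i < N'" "k < N'"
  shows "(\<lambda>x. minv N' (gram n' (B x) t) i k) \<in> borel_measurable M"
proof (rule minv_measurable)
  show "Determinant.det (sqmat N' (gram n' (B x) t)) \<noteq> 0" for x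
    by (rule posdef_det[OF posdef_gram[OF t]])
  show "(\<lambda>x. gram n' (B x) t i' k') \<in> borel_measurable M" if "i' < N'" "k' < N'" for i' k'
    unfolding gram_def using that
    by (intro borel_measurable_add borel_measurable_sum borel_measurable_times borel_measurable_const assms(1)) auto
qed fact+

lemma Q_measurable: "i < N \<Longrightarrow> k < N \<Longrightarrow> (\<lambda>x. Q x i k) \<in> borel_measurable P"
  unfolding Q_def by (rule minv_gram_measurable) (auto intro: S_measurable)

lemma Q0_measurable: "i < N \<Longrightarrow> k < N \<Longrightarrow> (\<lambda>x. Q0 j x i k) \<in> borel_measurable P"
proof -
  have "(\<lambda>x. erase j (S x) i' l) \<in> borel_measurable P" if "i' < N" "l < n" for i' l
    using S_measurable[OF that] by (cases "l = j") (auto simp: erase_def)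
  thus "i < N \<Longrightarrow> k < N \<Longrightarrow> (\<lambda>x. Q0 j x i k) \<in> borel_measurable P"
    unfolding Q0_def by (rule minv_gram_measurable)
qed

lemma q_measurable: "j < n \<Longrightarrow> (\<lambda>x. q x j) \<in> borel_measurable P"
  unfolding q_def by (rule minv_gram_measurable) (auto intro: S_measurable)

lemma opbound_Q: "opbound N (Q x) (1 / t)" and opbound_Q0: "opbound N (Q0 j x) (1 / t)"
  unfolding Q_def Q0_def by (auto intro!: opbound_minv posdef_gram t)

lemma Q_diag: "i < N \<Longrightarrow> 0 \<le> Q x i i" "i < N \<Longrightarrow> Q x i i \<le> 1 / t"
  unfolding Q_def using posdef_minv_diag[OF posdef_gram[OF t]] by auto

lemma q_bounds: "j < n \<Longrightarrow> 0 \<le> q x j" "j < n \<Longrightarrow> q x j \<le> 1 / t"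
  unfolding q_def using posdef_minv_diag[OF posdef_gram[OF t]] by auto

lemma integrable_bounded:
  "f \<in> borel_measurable P \<Longrightarrow> (\<And>x. \<bar>f x\<bar> \<le> B) \<Longrightarrow> integrable P (f :: _ \<Rightarrow> real)"
  by (rule P.integrable_const_bound[where B = B]) auto

lemma Q_integrable: "i < N \<Longrightarrow> integrable P (\<lambda>x. Q x i i)"
  by (rule integrable_bounded[where B = "1 / t"]) (auto simp: Q_measurable Q_diag)

lemma q_integrable: "j < n \<Longrightarrow> integrable P (\<lambda>x. q x j)"
  by (rule integrable_bounded[where B = "1 / t"]) (auto simp: q_measurable q_bounds)

text \<open>The expectation makes the weights constants, so that \<open>R\<close> and every
  \<open>K\<close> built from it carry no randomness when a column is integrated out.\<close>

definition "p j = (\<integral>x. (\<Sum>i<N. (r i j)\<^sup>2 * Q x i i) \<partial>P)"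
definition "p' i = (\<integral>x. (\<Sum>j<n. (r i j)\<^sup>2 * q x j) \<partial>P)"

lemma p_bounds: "j < n \<Longrightarrow> 0 \<le> p j" "j < n \<Longrightarrow> p j \<le> \<kappa> * s / t"
proof -
  assume j: "j < n"
  show "0 \<le> p j" unfolding p_def by (intro Bochner_Integration.integral_nonneg sum_nonneg mult_nonneg_nonneg) (auto intro: Q_diag)
  have "p j \<le> (\<Sum>i<N. s / m * (1 / t))"
    unfolding p_def
  proof (rule P.integral_le_const)
    show "AE x in P. (\<Sum>i<N. (r i j)\<^sup>2 * Q x i i) \<le> (\<Sum>i<N. s / m * (1 / t))"
      using j s m by (intro AE_I2 sum_mono mult_mono r_le Q_diag) auto
  qed (auto intro!: Bochner_Integration.integrable_sum integrable_mult_right Q_integrable)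
  also have "\<dots> = real N * (s / (m * t))" by simp
  also have "\<dots> \<le> \<kappa> * m * (s / (m * t))" using N_le s m t by (intro mult_right_mono) auto
  also have "\<dots> = \<kappa> * s / t" using m by simp
  finally show "p j \<le> \<kappa> * s / t" .
qed

lemma p'_nonneg: "0 \<le> p' i"
  unfolding p'_def by (intro Bochner_Integration.integral_nonneg sum_nonneg mult_nonneg_nonneg) (auto intro: q_bounds)

lemma p'_le: "i < N \<Longrightarrow> p' i \<le> \<kappa> * s / t"
proof -
  assume i: "i < N"
  have "p' i \<le> (\<Sum>j<n. s / m * (1 / t))"
    unfolding p'_def
  proof (rule P.integral_le_const)
    show "AE x in P. (\<Sum>j<n. (r i j)\<^sup>2 * q x j) \<le> (\<Sum>j<n. s / m * (1 / t))"
      using i s m by (intro AE_I2 sum_mono mult_mono r_le q_bounds) auto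
  qed (auto intro!: Bochner_Integration.integrable_sum integrable_mult_right q_integrable)
  also have "\<dots> = real n * (s / (m * t))" by simp
  also have "\<dots> \<le> \<kappa> * m * (s / (m * t))" using n_le s m t by (intro mult_right_mono) auto
  also have "\<dots> = \<kappa> * s / t" using m by simp
  finally show "p' i \<le> \<kappa> * s / t" .
qed

subsection \<open>Concentration of traces\<close>

text \<open>Two samples that differ only in column j share \<open>Q0 j\<close>. Each trace is within
  k/t of the trace with \<open>Q0 j\<close>, so changing one column moves the trace by at most 2k/t,
  and the block inequality applies with columns as blocks.\<close>

lemma trace_fourth_moment:
  assumes K: "opbound N K k" and k: "k > 0"
  shows "(\<integral>\<^sup>+x. ennreal (((\<Sum>i<N. mulm N (Q x) K i i) - (\<integral>x. (\<Sum>i<N. mulm N (Q x) K i i) \<partial>P)) ^ 4) \<partial>P)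
    \<le> ennreal (100 * (2 * k / t) ^ 4 * (real n)\<^sup>2)"
proof -
  let ?f = "\<lambda>x. \<Sum>i<N. mulm N (Q x) K i i"
  have near: "\<bar>(\<Sum>i<N. mulm N (Q0 j x) K i i) - ?f x\<bar> \<le> k / t" if "j < n" for j and x :: "nat \<times> nat \<Rightarrow> real"
    unfolding Q_def Q0_def
    by (rule rank1_trace_diff[OF posdef_gram[OF t] posdef_gram[OF t] gram_rank1[OF that] K])
  have "(\<integral>\<^sup>+x. ennreal ((?f x - (\<integral>x. ?f x \<partial>P)) ^ 4) \<partial>P) \<le> ennreal (100 * (2 * k / t) ^ 4 * (real (card {..<n}))\<^sup>2)"
  proof (rule fourth_moment_block_differences[where B = "\<Sum>i<N. 1 / t * k"])
    show "?f \<in> borel_measurable P"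
      by (intro borel_measurable_sum mulm_measurable Q_measurable) auto
    show "\<bar>?f x\<bar> \<le> (\<Sum>i<N. 1 / t * k)" for x
      by (intro order_trans[OF sum_abs] sum_mono opbound_entry[OF opbound_mulm[OF opbound_Q K]]) auto
    fix j and x x' :: "nat \<times> nat \<Rightarrow> real"
    assume j: "j \<in> {..<n}" and eq: "\<And>i k. i \<in> {..<N} \<Longrightarrow> k \<in> {..<n} \<Longrightarrow> k \<noteq> j \<Longrightarrow> x (i, k) = x' (i, k)"
    have "Q0 j x = Q0 j x'"
      unfolding Q0_def using eq
      by (intro minv_cong) (auto simp: gram_def erase_def S_def intro!: sum.cong)
    thus "\<bar>?f x - ?f x'\<bar> \<le> 2 * k / t" using near[of j x] near[of j x'] j by simp
  qed (use n_pos t k in auto)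
  thus ?thesis by simp
qed

text \<open>A mean-square bound phrased with the nonnegative integral, so that integrability is a
  consequence and error bounds can be added without side conditions.\<close>

definition msq :: "(((nat \<times> nat) \<Rightarrow> real) \<Rightarrow> real) \<Rightarrow> real \<Rightarrow> bool" where
  "msq e b \<longleftrightarrow> e \<in> borel_measurable P \<and> 0 \<le> b \<and> (\<integral>\<^sup>+x. ennreal ((e x)\<^sup>2) \<partial>P) \<le> ennreal b"

lemma msq_integrable:
  assumes "msq e b"
  shows "integrable P (\<lambda>x. (e x)\<^sup>2)" "(\<integral>x. (e x)\<^sup>2 \<partial>P) \<le> b"
proof -
  have [measurable]: "e \<in> borel_measurable P" using assms by (simp add: msq_def)
  have "(\<integral>\<^sup>+x. ennreal ((e x)\<^sup>2) \<partial>P) < \<infinity>"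
    using assms by (auto simp: msq_def intro: le_less_trans)
  thus i: "integrable P (\<lambda>x. (e x)\<^sup>2)" by (intro integrableI_nonneg) auto
  show "(\<integral>x. (e x)\<^sup>2 \<partial>P) \<le> b"
    using assms nn_integral_eq_integral[OF i] by (auto simp: msq_def ennreal_le_iff)
qed

text \<open>Passes from mean square O(1/m) to mean O(1/sqrt m) by |y| <= sqrt m y^2 + 1 / sqrt m.
  Unlike Cauchy-Schwarz this keeps the constant \<open>b\<close> linear, at the price of the added
  1.\<close>

lemma msq_abs:
  assumes "msq e (b / m)"
  shows "integrable P (\<lambda>x. \<bar>e x\<bar>)" "(\<integral>x. \<bar>e x\<bar> \<partial>P) \<le> (b + 1) / sqrt m"
proof -
  note i = msq_integrable[OF assms]
  have sm: "sqrt m \<ge> 1" using m by simp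
  have b: "0 \<le> b" using assms m by (simp add: msq_def zero_le_divide_iff)
  have le: "\<bar>y\<bar> \<le> sqrt m * y\<^sup>2 + 1 / sqrt m" for y :: real
  proof -
    have "X \<le> X\<^sup>2 + 1" if "0 \<le> X" for X :: real
      using zero_le_power2[of "X - 1"] that unfolding power2_diff by simp
    hence "sqrt m * \<bar>y\<bar> \<le> (sqrt m * \<bar>y\<bar>)\<^sup>2 + 1" using sm by simp
    moreover have "(sqrt m * \<bar>y\<bar>)\<^sup>2 = sqrt m * (sqrt m * y\<^sup>2)"
      unfolding power_mult_distrib power2_abs power2_eq_square[of "sqrt m"] by (rule mult.assoc)
    moreover have "sqrt m * (1 / sqrt m) = 1" using sm by simp
    ultimately have "sqrt m * \<bar>y\<bar> \<le> sqrt m * (sqrt m * y\<^sup>2 + 1 / sqrt m)"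
      unfolding distrib_left by simp
    thus ?thesis using sm by (simp only: mult_le_cancel_left_pos)
  qed
  have int2: "integrable P (\<lambda>x. sqrt m * (e x)\<^sup>2 + 1 / sqrt m)" using i by simp
  show i2: "integrable P (\<lambda>x. \<bar>e x\<bar>)"
    by (rule Bochner_Integration.integrable_bound[OF int2])
       (use assms in \<open>auto simp: msq_def intro!: order_trans[OF le]\<close>)
  have "(\<integral>x. \<bar>e x\<bar> \<partial>P) \<le> (\<integral>x. sqrt m * (e x)\<^sup>2 + 1 / sqrt m \<partial>P)"
    by (intro integral_mono i2 int2 le)
  also have "\<dots> = sqrt m * (\<integral>x. (e x)\<^sup>2 \<partial>P) + 1 / sqrt m"
    using i by (simp add: P.prob_space)
  also have "\<dots> \<le> sqrt m * (b / m) + 1 / sqrt m" using i sm by (intro add_mono mult_left_mono) auto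
  also have "sqrt m * (b / m) = b / sqrt m"
    using m by (simp add: field_simps)
  finally show "(\<integral>x. \<bar>e x\<bar> \<partial>P) \<le> (b + 1) / sqrt m" by (simp add: add_divide_distrib)
qed

lemma msq_add:
  assumes "msq e b" "msq f c"
  shows "msq (\<lambda>x. e x + f x) (2 * b + 2 * c)"
proof -
  have [measurable]: "e \<in> borel_measurable P" "f \<in> borel_measurable P" using assms by (auto simp: msq_def)
  have "(\<integral>\<^sup>+x. ennreal ((e x + f x)\<^sup>2) \<partial>P) \<le> (\<integral>\<^sup>+x. 2 * ennreal ((e x)\<^sup>2) + 2 * ennreal ((f x)\<^sup>2) \<partial>P)"
  proof (rule nn_integral_mono)
    fix x
    have "(e x + f x)\<^sup>2 \<le> 2 * (e x)\<^sup>2 + 2 * (f x)\<^sup>2"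
      using sum_squares_bound[of "e x" "f x"] by (simp add: power2_sum)
    hence "ennreal ((e x + f x)\<^sup>2) \<le> ennreal (2 * (e x)\<^sup>2 + 2 * (f x)\<^sup>2)" by (rule ennreal_leI)
    also have "\<dots> = 2 * ennreal ((e x)\<^sup>2) + 2 * ennreal ((f x)\<^sup>2)" by (simp add: ennreal_mult)
    finally show "ennreal ((e x + f x)\<^sup>2) \<le> 2 * ennreal ((e x)\<^sup>2) + 2 * ennreal ((f x)\<^sup>2)" .
  qed
  also have "\<dots> = 2 * (\<integral>\<^sup>+x. ennreal ((e x)\<^sup>2) \<partial>P) + 2 * (\<integral>\<^sup>+x. ennreal ((f x)\<^sup>2) \<partial>P)"
    by (simp add: nn_integral_add nn_integral_cmult)
  also have "\<dots> \<le> 2 * ennreal b + 2 * ennreal c"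
    using assms by (intro add_mono mult_left_mono) (auto simp: msq_def)
  also have "\<dots> = ennreal (2 * b + 2 * c)" using assms by (simp add: msq_def ennreal_mult)
  finally show ?thesis using assms by (simp add: msq_def)
qed

lemma msq_mono: "msq e b \<Longrightarrow> b \<le> c \<Longrightarrow> msq e c"
  by (auto simp: msq_def intro: order_trans ennreal_leI)

lemma msq_bounded:
  assumes "e \<in> borel_measurable P" "\<And>x. \<bar>e x\<bar> \<le> c"
  shows "msq e (c\<^sup>2)"
proof -
  have c: "0 \<le> c" using assms(2)[of undefined] by linarith
  have "(\<integral>\<^sup>+x. ennreal ((e x)\<^sup>2) \<partial>P) \<le> (\<integral>\<^sup>+x. ennreal (c\<^sup>2) \<partial>P)"
    using assms(2) c by (intro nn_integral_mono ennreal_leI) (simp add: abs_le_square_iff[symmetric])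
  thus ?thesis using assms(1) by (simp add: msq_def P.emeasure_space_1)
qed

lemma trace_msq:
  assumes K: "opbound N K k" and k: "k > 0"
  shows "msq (\<lambda>x. (\<Sum>i<N. mulm N (Q x) K i i) - (\<integral>x. (\<Sum>i<N. mulm N (Q x) K i i) \<partial>P)) (40 * k\<^sup>2 / t\<^sup>2 * real n)"
proof -
  define y where "y = (\<lambda>x. (\<Sum>i<N. mulm N (Q x) K i i) - (\<integral>x. (\<Sum>i<N. mulm N (Q x) K i i) \<partial>P))"
  have [measurable]: "y \<in> borel_measurable P"
    unfolding y_def by (intro borel_measurable_diff borel_measurable_sum mulm_measurable Q_measurable borel_measurable_const) auto
  \<comment> \<open>\<open>v\<^sup>2\<close> is the bound of \<open>trace_fourth_moment\<close>.
    This choice balances the two terms y^4 / (2v) and v / 2, each contributing v / 2.\<close>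
  define v where "v = 10 * (2 * k / t)\<^sup>2 * real n"
  have v: "v > 0" unfolding v_def using k t n_pos by simp
  have "(\<integral>\<^sup>+x. ennreal ((y x)\<^sup>2) \<partial>P) \<le> (\<integral>\<^sup>+x. ennreal (1 / (2 * v)) * ennreal (y x ^ 4) + ennreal (v / 2) \<partial>P)"
  proof (rule nn_integral_mono)
    fix x
    have "2 * v * (y x)\<^sup>2 \<le> ((y x)\<^sup>2)\<^sup>2 + v\<^sup>2"
      using sum_squares_bound[of "(y x)\<^sup>2" v] by (simp add: mult_ac)
    hence "(y x)\<^sup>2 \<le> 1 / (2 * v) * y x ^ 4 + v / 2"
      using v by (simp add: field_simps power2_eq_square power4_eq_xxxx)
    thus "ennreal ((y x)\<^sup>2) \<le> ennreal (1 / (2 * v)) * ennreal (y x ^ 4) + ennreal (v / 2)"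
      using v by (simp add: ennreal_plus[symmetric] ennreal_mult[symmetric] ennreal_leI del: ennreal_plus)
  qed
  also have "\<dots> = ennreal (1 / (2 * v)) * (\<integral>\<^sup>+x. ennreal (y x ^ 4) \<partial>P) + ennreal (v / 2)"
    by (simp add: nn_integral_add nn_integral_cmult P.emeasure_space_1)
  also have "\<dots> \<le> ennreal (1 / (2 * v)) * ennreal (100 * (2 * k / t) ^ 4 * (real n)\<^sup>2) + ennreal (v / 2)"
    unfolding y_def by (intro add_mono mult_left_mono trace_fourth_moment K k) auto
  also have "100 * (2 * k / t) ^ 4 * (real n)\<^sup>2 = v\<^sup>2"
    by (simp add: v_def power_mult_distrib power_divide power2_eq_square power4_eq_xxxx mult_ac)
  also have "ennreal (1 / (2 * v)) * ennreal (v\<^sup>2) + ennreal (v / 2) = ennreal v"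
    using v by (simp add: ennreal_plus[symmetric] ennreal_mult[symmetric] power2_eq_square del: ennreal_plus)
  also have "v = 40 * k\<^sup>2 / t\<^sup>2 * real n" by (simp add: v_def power_mult_distrib power_divide)
  finally show ?thesis using v by (simp add: msq_def y_def[symmetric])
qed

subsection \<open>Linear and quadratic forms in one column\<close>

text \<open>Fubini with the other columns frozen; the independence of column j from the rest enters
  here.\<close>

lemma column_decoupling:
  assumes j: "j < n" and F: "F \<in> borel_measurable P"
    and le: "\<And>x. (\<integral>\<^sup>+z. F (merge ({..<N} \<times> ({..<n} - {j})) ({..<N} \<times> {j}) (x, z)) \<partial>PiM ({..<N} \<times> {j}) (\<lambda>_. \<mu>)) \<le> b"
  shows "(\<integral>\<^sup>+x. F x \<partial>P) \<le> b"
proof -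
  interpret PP: product_sigma_finite "\<lambda>_. \<mu>" by (rule product_sigma_finite_const)
  let ?I = "{..<N} \<times> ({..<n} - {j})" and ?C = "{..<N} \<times> {j}"
  interpret I: prob_space "PiM ?I (\<lambda>_. \<mu>)" by (rule prob_space_const_PiM)
  have J: "J = ?I \<union> ?C" using j by auto
  have "(\<integral>\<^sup>+x. F x \<partial>P) = (\<integral>\<^sup>+x. (\<integral>\<^sup>+z. F (merge ?I ?C (x, z)) \<partial>PiM ?C (\<lambda>_. \<mu>)) \<partial>PiM ?I (\<lambda>_. \<mu>))"
    unfolding J by (rule PP.product_nn_integral_fold) (use F J in auto)
  also have "\<dots> \<le> (\<integral>\<^sup>+x. b \<partial>PiM ?I (\<lambda>_. \<mu>))" by (intro nn_integral_mono le)
  finally show ?thesis by (simp add: I.emeasure_space_1)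
qed

text \<open>Independence of column j is expressed as literal dependence on the other entries: on
  merged samples such a function is constant in column j and can be treated as a
  coefficient.\<close>

definition off_column :: "nat \<Rightarrow> (((nat \<times> nat) \<Rightarrow> real) \<Rightarrow> 'b) \<Rightarrow> bool" where
  "off_column j w \<longleftrightarrow> (\<forall>x x'. (\<forall>i<N. \<forall>k<n. k \<noteq> j \<longrightarrow> x (i, k) = x' (i, k)) \<longrightarrow> w x = w x')"

lemma sum_column: "(\<Sum>p\<in>{..<N} \<times> {j}. f p) = (\<Sum>i<N. f (i, j))"
  by (simp add: sum.cartesian_product')

lemma linear_form_msq:
  assumes j: "j < n" and off: "off_column j w" and meas: "\<And>i. i < N \<Longrightarrow> (\<lambda>x. w x i) \<in> borel_measurable P"
    and le: "\<And>x. dot N (w x) (w x) \<le> c"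
  shows "msq (\<lambda>x. dot N (Y j x) (w x)) (s * c / m)"
proof -
  have c: "0 \<le> c" using le[of undefined] dot_self_nonneg order_trans by blast
  have F: "(\<lambda>x. dot N (Y j x) (w x)) \<in> borel_measurable P"
    by (intro dot_measurable Y_measurable j meas)
  have "(\<integral>\<^sup>+x. ennreal ((dot N (Y j x) (w x))\<^sup>2) \<partial>P) \<le> ennreal (s * c / m)"
  proof (rule column_decoupling[OF j])
    show "(\<lambda>x. ennreal ((dot N (Y j x) (w x))\<^sup>2)) \<in> borel_measurable P" using F by measurable
    fix x :: "nat \<times> nat \<Rightarrow> real"
    let ?I = "{..<N} \<times> ({..<n} - {j})" and ?C = "{..<N} \<times> {j}"
    let ?mg = "\<lambda>z. merge ?I ?C (x, z)"
    \<comment> \<open>By \<open>off_column\<close> any filling of column j gives the same vector, so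
      \<open>undefined\<close> serves as the filling.\<close>
    define v where "v = w (?mg undefined)"
    have wv: "w (?mg z) = v" for z
      using off unfolding v_def off_column_def by (auto simp: merge_def)
    have Y: "Y j (?mg z) i = r i j * z (i, j)" if "i < N" for i z
      using that by (simp add: Y_def merge_def)
    have "(\<integral>\<^sup>+z. ennreal ((dot N (Y j (?mg z)) (w (?mg z)))\<^sup>2) \<partial>PiM ?C (\<lambda>_. \<mu>))
       = (\<integral>\<^sup>+z. ennreal ((\<Sum>p\<in>?C. (r (fst p) j * v (fst p)) * z p)\<^sup>2) \<partial>PiM ?C (\<lambda>_. \<mu>))"
      unfolding wv sum_column dot_def by (intro nn_integral_cong) (simp add: Y mult_ac)
    also have "\<dots> = ennreal (\<Sum>p\<in>?C. (r (fst p) j * v (fst p))\<^sup>2)"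
      by (rule nn_integral_linear_form) auto
    also have "(\<Sum>p\<in>?C. (r (fst p) j * v (fst p))\<^sup>2) = (\<Sum>i<N. (r i j)\<^sup>2 * (v i * v i))"
      unfolding sum_column by (simp add: power2_eq_square mult_ac)
    also have "\<dots> \<le> (\<Sum>i<N. s / m * (v i * v i))" by (intro sum_mono mult_right_mono r_le j) auto
    also have "\<dots> = s / m * dot N v v" by (simp add: dot_def sum_distrib_left)
    also have "\<dots> \<le> s / m * c" using le[of "?mg undefined"] s m by (intro mult_left_mono) (auto simp: v_def)
    finally show "(\<integral>\<^sup>+z. ennreal ((dot N (Y j (?mg z)) (w (?mg z)))\<^sup>2) \<partial>PiM ?C (\<lambda>_. \<mu>)) \<le> ennreal (s * c / m)"
      by (simp add: ennreal_leI)
  qed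
  thus ?thesis using F c s m by (simp add: msq_def)
qed

text \<open>Conditionally on the other columns the coefficients are r i j r k j C i k, and each
  squared factor of r is at most s/m. With a Frobenius bound of order m the result is
  O(1/m).\<close>

lemma quadratic_form_msq:
  assumes j: "j < n" and off: "off_column j C" and meas: "\<And>i k. i < N \<Longrightarrow> k < N \<Longrightarrow> (\<lambda>x. C x i k) \<in> borel_measurable P"
    and le: "\<And>x. (\<Sum>i<N. \<Sum>k<N. (C x i k)\<^sup>2) \<le> c"
  shows "msq (\<lambda>x. dot N (Y j x) (app N (C x) (Y j x)) - (\<Sum>i<N. (r i j)\<^sup>2 * C x i i)) ((4 + 2 * m4) * (s / m)\<^sup>2 * c)"
proof -
  have c: "0 \<le> c" using order_trans[OF _ le[of undefined]] by (meson sum_nonneg zero_le_power2)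
  let ?F = "\<lambda>x. dot N (Y j x) (app N (C x) (Y j x)) - (\<Sum>i<N. (r i j)\<^sup>2 * C x i i)"
  have F: "?F \<in> borel_measurable P"
    by (intro borel_measurable_diff borel_measurable_sum borel_measurable_times borel_measurable_const
        dot_measurable app_measurable Y_measurable j meas) auto
  have "(\<integral>\<^sup>+x. ennreal ((?F x)\<^sup>2) \<partial>P) \<le> ennreal ((4 + 2 * m4) * (s / m)\<^sup>2 * c)"
  proof (rule column_decoupling[OF j])
    show "(\<lambda>x. ennreal ((?F x)\<^sup>2)) \<in> borel_measurable P" using F by measurable
    fix x :: "nat \<times> nat \<Rightarrow> real"
    let ?I = "{..<N} \<times> ({..<n} - {j})" and ?C = "{..<N} \<times> {j}"
    let ?mg = "\<lambda>z. merge ?I ?C (x, z)"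
    define B where "B = C (?mg undefined)"
    have wv: "C (?mg z) = B" for z
      using off unfolding B_def off_column_def by (auto simp: merge_def)
    have Y: "Y j (?mg z) i = r i j * z (i, j)" if "i < N" for i z
      using that by (simp add: Y_def merge_def)
    let ?B = "\<lambda>p p'. r (fst p) j * r (fst p') j * B (fst p) (fst p')"
    have "(\<integral>\<^sup>+z. ennreal ((?F (?mg z))\<^sup>2) \<partial>PiM ?C (\<lambda>_. \<mu>))
       = (\<integral>\<^sup>+z. ennreal (((\<Sum>p\<in>?C. \<Sum>p'\<in>?C. ?B p p' * z p * z p') - (\<Sum>p\<in>?C. ?B p p))\<^sup>2) \<partial>PiM ?C (\<lambda>_. \<mu>))"
    proof (intro nn_integral_cong arg_cong[where f = ennreal] arg_cong[where f = "\<lambda>y. y\<^sup>2"])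
      fix z :: "nat \<times> nat \<Rightarrow> real"
      have "dot N (Y j (?mg z)) (app N B (Y j (?mg z))) = (\<Sum>p\<in>?C. \<Sum>p'\<in>?C. ?B p p' * z p * z p')"
        unfolding sum_column dot_def app_def sum_distrib_left
        by (intro sum.cong refl) (simp add: Y mult_ac)
      moreover have "(\<Sum>i<N. (r i j)\<^sup>2 * B i i) = (\<Sum>p\<in>?C. ?B p p)"
        unfolding sum_column by (simp add: power2_eq_square)
      ultimately show "?F (?mg z) = (\<Sum>p\<in>?C. \<Sum>p'\<in>?C. ?B p p' * z p * z p') - (\<Sum>p\<in>?C. ?B p p)"
        unfolding wv by simp
    qed
    also have "\<dots> \<le> ennreal ((4 + 2 * m4) * (\<Sum>p\<in>?C. \<Sum>p'\<in>?C. (?B p p')\<^sup>2))"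
      by (rule nn_integral_quadratic_form) auto
    also have "(\<Sum>p\<in>?C. \<Sum>p'\<in>?C. (?B p p')\<^sup>2) = (\<Sum>i<N. \<Sum>k<N. ((r i j)\<^sup>2 * (r k j)\<^sup>2) * (B i k)\<^sup>2)"
      unfolding sum_column by (simp add: power_mult_distrib)
    also have "\<dots> \<le> (\<Sum>i<N. \<Sum>k<N. (s / m * (s / m)) * (B i k)\<^sup>2)"
      using s m by (intro sum_mono mult_right_mono mult_mono r_le j) auto
    also have "\<dots> = (s / m)\<^sup>2 * (\<Sum>i<N. \<Sum>k<N. (B i k)\<^sup>2)"
      by (simp add: sum_distrib_left power2_eq_square)
    also have "\<dots> \<le> (s / m)\<^sup>2 * c" using le[of "?mg undefined"] by (intro mult_left_mono) (auto simp: B_def)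
    finally show "(\<integral>\<^sup>+z. ennreal ((?F (?mg z))\<^sup>2) \<partial>PiM ?C (\<lambda>_. \<mu>)) \<le> ennreal ((4 + 2 * m4) * (s / m)\<^sup>2 * c)"
      using m4_nonneg by (simp add: ennreal_leI mult_left_mono mult.assoc)
  qed
  thus ?thesis using F c m4_nonneg by (simp add: msq_def)
qed

end

section \<open>Leave-one-column-out analysis of the mean resolvent\<close>

context noise_model
begin

lemma off_column_Q0: "off_column j (Q0 j)"
  unfolding off_column_def Q0_def
  by (auto intro!: minv_cong sum.cong simp: gram_def erase_def S_def)

lemma off_column_compose: "off_column j w \<Longrightarrow> off_column j (\<lambda>x. g (w x))"
  unfolding off_column_def by metis

definition "R = minv N (wgram n A t (weight t p') (weight t p))"

lemma wgram_posdef: "posdef t N (wgram n A t (weight t p') (weight t p))"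
  using p'_nonneg p_bounds(1) by (intro posdef_weights t)

lemma opbound_R: "opbound N R (1 / t)"
  unfolding R_def by (rule opbound_minv[OF wgram_posdef])

text \<open>Collects the three errors of \<open>column_form_msq\<close>: (4 + 2 \<open>m4\<close>)
  \<open>\<kappa>\<close> from the quadratic form, 1 from erasing the column, 40
  \<open>\<kappa>\<close> from concentration. Nesting \<open>msq_add\<close> multiplies them by 2, 4
  and 4.\<close>

definition "form_const = (2 * (4 + 2 * m4) * \<kappa> + 4 + 160 * \<kappa>) * s\<^sup>2 / t\<^sup>2"

text \<open>The form is compared first with its conditional mean, a weighted trace of Q0 K, then
  with the same trace of Q K by the rank-one bound, and then with the expectation by
  concentration.\<close>

lemma column_form_msq:
  assumes j: "j < n" and K: "opbound N K k" and k: "k > 0"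
  shows "msq (\<lambda>x. dot N (Y j x) (app N (Q0 j x) (app N K (Y j x)))
     - (\<integral>x. (\<Sum>i<N. (r i j)\<^sup>2 * mulm N (Q x) K i i) \<partial>P)) (form_const * k\<^sup>2 / m)"
proof -
  \<comment> \<open>The variances of column j are absorbed into the matrix as a right diagonal
    factor, so weighted traces become traces with operator bound k s / m.\<close>
  define K' where "K' = (\<lambda>i l. K i l * (r l j)\<^sup>2)"
  have K': "opbound N K' (k * (s / m))"
    unfolding K'_def using s m by (intro opbound_diag_right K) (auto intro: r_le j)
  have mK': "mulm N B K' i i = (r i j)\<^sup>2 * mulm N B K i i" for B i
    by (simp add: mulm_def K'_def sum_distrib_left mult_ac)
  have ks: "k * (s / m) > 0" using k s m by simp
  have sm: "(s / m)\<^sup>2 \<le> s\<^sup>2 / m"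
    using m by (simp add: power_divide divide_left_mono self_le_power)
  have smx: "(s / m)\<^sup>2 * x \<le> s\<^sup>2 * \<kappa> / m" if "x \<le> \<kappa> * m" for x
  proof -
    have "(s / m)\<^sup>2 * x \<le> (s / m)\<^sup>2 * (\<kappa> * m)" by (intro mult_left_mono that) auto
    also have "\<dots> = s\<^sup>2 * \<kappa> / m" using m by (simp add: power_divide power2_eq_square)
    finally show ?thesis .
  qed
  define X1 where "X1 = (\<lambda>x. dot N (Y j x) (app N (mulm N (Q0 j x) K) (Y j x)) - (\<Sum>i<N. (r i j)\<^sup>2 * mulm N (Q0 j x) K i i))"
  define X2 where "X2 = (\<lambda>x. (\<Sum>i<N. mulm N (Q0 j x) K' i i) - (\<Sum>i<N. mulm N (Q x) K' i i))"
  define X3 where "X3 = (\<lambda>x. (\<Sum>i<N. mulm N (Q x) K' i i) - (\<integral>x. (\<Sum>i<N. mulm N (Q x) K' i i) \<partial>P))"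
  have "msq X1 ((4 + 2 * m4) * (s / m)\<^sup>2 * (real N * (1 / t * k)\<^sup>2))"
    unfolding X1_def
    by (intro quadratic_form_msq j off_column_compose[OF off_column_Q0, of j "\<lambda>B. mulm N B K"]
         mulm_measurable Q0_measurable opbound_frobenius opbound_mulm opbound_Q0 K)
  moreover have "(4 + 2 * m4) * (s / m)\<^sup>2 * (real N * (1 / t * k)\<^sup>2) \<le> (4 + 2 * m4) * \<kappa> * s\<^sup>2 / t\<^sup>2 * k\<^sup>2 / m"
  proof -
    have "(4 + 2 * m4) * (s / m)\<^sup>2 * (real N * (1 / t * k)\<^sup>2) = ((4 + 2 * m4) * (k\<^sup>2 / t\<^sup>2)) * ((s / m)\<^sup>2 * real N)"
      by (simp add: power_mult_distrib power_divide mult_ac)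
    also have "\<dots> \<le> ((4 + 2 * m4) * (k\<^sup>2 / t\<^sup>2)) * (s\<^sup>2 * \<kappa> / m)"
      using m4_nonneg by (intro mult_left_mono smx N_le) auto
    finally show ?thesis by (simp add: mult_ac)
  qed
  ultimately have 1: "msq X1 ((4 + 2 * m4) * \<kappa> * s\<^sup>2 / t\<^sup>2 * k\<^sup>2 / m)" by (rule msq_mono)
  have "msq X2 ((k * (s / m) / t)\<^sup>2)"
  proof (rule msq_bounded)
    show "X2 \<in> borel_measurable P" unfolding X2_def
      by (intro borel_measurable_diff borel_measurable_sum mulm_measurable Q_measurable Q0_measurable) auto
    show "\<bar>X2 x\<bar> \<le> k * (s / m) / t" for x
      unfolding X2_def Q_def Q0_def
      by (rule rank1_trace_diff[OF posdef_gram[OF t] posdef_gram[OF t] gram_rank1[OF j] K'])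
  qed
  moreover have "(k * (s / m) / t)\<^sup>2 \<le> s\<^sup>2 / t\<^sup>2 * k\<^sup>2 / m"
  proof -
    have "(k * (s / m) / t)\<^sup>2 = k\<^sup>2 / t\<^sup>2 * (s / m)\<^sup>2" by (simp add: power_mult_distrib power_divide)
    also have "\<dots> \<le> k\<^sup>2 / t\<^sup>2 * (s\<^sup>2 / m)" by (intro mult_left_mono sm) auto
    finally show ?thesis by (simp add: mult_ac)
  qed
  ultimately have 2: "msq X2 (s\<^sup>2 / t\<^sup>2 * k\<^sup>2 / m)" by (rule msq_mono)
  have "msq X3 (40 * (k * (s / m))\<^sup>2 / t\<^sup>2 * real n)" unfolding X3_def by (rule trace_msq[OF K' ks])
  moreover have "40 * (k * (s / m))\<^sup>2 / t\<^sup>2 * real n \<le> 40 * \<kappa> * s\<^sup>2 / t\<^sup>2 * k\<^sup>2 / m"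
  proof -
    have "40 * (k * (s / m))\<^sup>2 / t\<^sup>2 * real n = 40 * (k\<^sup>2 / t\<^sup>2) * ((s / m)\<^sup>2 * real n)"
      by (simp add: power_mult_distrib power_divide mult_ac)
    also have "\<dots> \<le> 40 * (k\<^sup>2 / t\<^sup>2) * (s\<^sup>2 * \<kappa> / m)" by (intro mult_left_mono smx n_le) auto
    finally show ?thesis by (simp add: mult_ac)
  qed
  ultimately have 3: "msq X3 (40 * \<kappa> * s\<^sup>2 / t\<^sup>2 * k\<^sup>2 / m)" by (rule msq_mono)
  have "msq (\<lambda>x. X1 x + (X2 x + X3 x)) (2 * ((4 + 2 * m4) * \<kappa> * s\<^sup>2 / t\<^sup>2 * k\<^sup>2 / m) +
      2 * (2 * (s\<^sup>2 / t\<^sup>2 * k\<^sup>2 / m) + 2 * (40 * \<kappa> * s\<^sup>2 / t\<^sup>2 * k\<^sup>2 / m)))"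
    by (rule msq_add[OF 1 msq_add[OF 2 3]])
  moreover have "(\<lambda>x. X1 x + (X2 x + X3 x)) = (\<lambda>x. dot N (Y j x) (app N (Q0 j x) (app N K (Y j x)))
     - (\<integral>x. (\<Sum>i<N. (r i j)\<^sup>2 * mulm N (Q x) K i i) \<partial>P))"
    by (simp add: X1_def X2_def X3_def mK' app_mulm)
  moreover have "2 * ((4 + 2 * m4) * \<kappa> * s\<^sup>2 / t\<^sup>2 * k\<^sup>2 / m) +
      2 * (2 * (s\<^sup>2 / t\<^sup>2 * k\<^sup>2 / m) + 2 * (40 * \<kappa> * s\<^sup>2 / t\<^sup>2 * k\<^sup>2 / m)) = form_const * k\<^sup>2 / m"
    using m t by (simp add: form_const_def field_simps)
  ultimately show ?thesis by simp
qed

text \<open>Divided by m, the first two bound the mean squares of the linear forms \<open>e1\<close>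
  and \<open>e2\<close>. \<open>bracket_const\<close> is the right-hand side of
  \<open>bracket_bound\<close> with each absolute value integrated by \<open>msq_abs\<close>, which
  is the source of the added ones.\<close>

definition "lin1_const = s * ((1 / t)\<^sup>2 * a)"
definition "lin2_const = s * ((1 / t)\<^sup>2 * ((1 / t)\<^sup>2 * a))"
definition "bracket_const = 1 / t * ((form_const * (1 / t)\<^sup>2 + 1) + (4 * lin2_const + 1) + a / t * (lin2_const + 1)
    + a / t\<^sup>2 * (lin1_const + 1) + (lin1_const + lin2_const) + a / t\<^sup>2 * ((2 * form_const + 8 * lin1_const) + 1))"

lemma lin_const_nonneg: "0 \<le> lin1_const" "0 \<le> lin2_const"
  unfolding lin1_const_def lin2_const_def using s a by auto

text \<open>In each column the deviation cancels to first order: the contribution of \<open>A\<close> through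
  \<open>\<beta>\<close> is absorbed by the defining equation of the weights, without any concentration
  of the bilinear forms \<open>\<alpha>\<close>, \<open>\<beta>\<close>.\<close>

lemma bracket_expectation:
  fixes D :: "nat \<Rightarrow> real"
  assumes j: "j < n" and D: "\<And>i. i < N \<Longrightarrow> \<bar>D i\<bar> \<le> 1"
  defines "K \<equiv> \<lambda>i l. D i * R i l"
  defines "\<pi> \<equiv> \<integral>x. (\<Sum>i<N. (r i j)\<^sup>2 * mulm N (Q x) K i i) \<partial>P"
  defines "Br \<equiv> \<lambda>x. q x j * (dot N (colv (S x) j) (app N (Q0 j x) (app N K (colv (S x) j))) - \<pi>)
      - weight t p j * dot N (colv A j) (app N (Q x) (app N K (colv A j)))"
  shows "integrable P Br" "\<bar>\<integral>x. Br x \<partial>P\<bar> \<le> bracket_const / sqrt m"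
proof -
  have K: "opbound N K (1 / t)"
    using opbound_diag[OF D _ opbound_R] by (simp add: K_def)
  let ?a = "colv A j"
  have na: "dot N ?a ?a \<le> a" by (rule A_le[OF j])
  have QH: "dot N v (app N (Q0 j x) w) = dot N (app N (Q0 j x) v) w" for v w x
    unfolding Q0_def by (rule posdef_minv_dot[OF posdef_gram[OF t]])
  define \<alpha> where "\<alpha> = (\<lambda>x. dot N ?a (app N (Q0 j x) ?a))"
  define \<beta> where "\<beta> = (\<lambda>x. dot N ?a (app N (Q0 j x) (app N K ?a)))"
  define e1 where "e1 = (\<lambda>x. dot N (Y j x) (app N (Q0 j x) ?a))"
  define e2 where "e2 = (\<lambda>x. dot N (Y j x) (app N (Q0 j x) (app N K ?a)))"
  \<comment> \<open>The second cross term, a^T Q0 K Y, written as a linear form in Y. As K = D R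
    need not be symmetric, moving it to the other side gives a vector different from that of
    \<open>e2\<close>.\<close>
  define e2' where "e2' = (\<lambda>x. dot N (Y j x) (app N R (\<lambda>i. D i * app N (Q0 j x) ?a i)))"
  define e3 where "e3 = (\<lambda>x. dot N (Y j x) (app N (Q0 j x) (app N K (Y j x))) - \<pi>)"
  define e4 where "e4 = (\<lambda>x. e2' x + e2 x)"
  define e3' where "e3' = (\<lambda>x. dot N (Y j x) (app N (Q0 j x) (app N one_matrix (Y j x)))
      - (\<integral>x. (\<Sum>i<N. (r i j)\<^sup>2 * mulm N (Q x) one_matrix i i) \<partial>P))"
  \<comment> \<open>This will be the small quantity \<kappa> - p - \<alpha> of
    \<open>bracket_identity\<close>: a centered quadratic form plus twice the cross term
    \<open>e1\<close>.\<close>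
  define \<eta> where "\<eta> = (\<lambda>x. e3' x + (e1 x + e1 x))"
  have meas_a: "(\<lambda>x. app N (Q0 j x) v i) \<in> borel_measurable P" if "i < N" for i v
    by (intro app_measurable Q0_measurable that) auto
  have m1: "msq e1 (lin1_const / m)"
    unfolding e1_def lin1_const_def
    by (intro linear_form_msq j off_column_compose[OF off_column_Q0, of j "\<lambda>B. app N B ?a"] meas_a
         opbound_app[OF opbound_Q0] na)
  have m2: "msq e2 (lin2_const / m)"
    unfolding e2_def lin2_const_def
    by (intro linear_form_msq j off_column_compose[OF off_column_Q0, of j "\<lambda>B. app N B (app N K ?a)"] meas_a
         opbound_app[OF opbound_Q0] opbound_app[OF K] na)
  have m2': "msq e2' (lin2_const / m)"
    unfolding e2'_def lin2_const_def
  proof (intro linear_form_msq j off_column_compose[OF off_column_Q0, of j "\<lambda>B. app N R (\<lambda>i. D i * app N B ?a i)"])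
    show "(\<lambda>x. app N R (\<lambda>i. D i * app N (Q0 j x) ?a i) i) \<in> borel_measurable P" if "i < N" for i
      by (intro app_measurable borel_measurable_times borel_measurable_const meas_a)
    show "dot N (app N R (\<lambda>i. D i * app N (Q0 j x) ?a i)) (app N R (\<lambda>i. D i * app N (Q0 j x) ?a i))
       \<le> (1 / t)\<^sup>2 * ((1 / t)\<^sup>2 * a)" for x
    proof (rule opbound_app[OF opbound_R])
      have appD: "app N (\<lambda>i k. D i * Q0 j x i k) ?a = (\<lambda>i. D i * app N (Q0 j x) ?a i)"
        by (auto simp: app_def sum_distrib_left mult.assoc)
      have "opbound N (\<lambda>i k. D i * Q0 j x i k) (1 * (1 / t))" by (rule opbound_diag[OF D _ opbound_Q0]) auto
      from opbound_app[OF this na]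
      show "dot N (\<lambda>i. D i * app N (Q0 j x) ?a i) (\<lambda>i. D i * app N (Q0 j x) ?a i) \<le> (1 / t)\<^sup>2 * a"
        unfolding appD mult_1 .
    qed
  qed
  have m3: "msq e3 (form_const * (1 / t)\<^sup>2 / m)"
    unfolding e3_def \<pi>_def using t by (intro column_form_msq j K) auto
  have m3': "msq e3' (form_const / m)"
    unfolding e3'_def using column_form_msq[OF j opbound_one_matrix] by simp
  have "msq e4 (2 * (lin2_const / m) + 2 * (lin2_const / m))"
    unfolding e4_def by (rule msq_add[OF m2' m2])
  hence m4: "msq e4 (4 * lin2_const / m)" by simp
  have "msq \<eta> (2 * (form_const / m) + 2 * (2 * (lin1_const / m) + 2 * (lin1_const / m)))"
    unfolding \<eta>_def by (rule msq_add[OF m3' msq_add[OF m1 m1]])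
  hence m\<eta>: "msq \<eta> ((2 * form_const + 8 * lin1_const) / m)" by (simp add: add_divide_distrib)
  have \<alpha>: "\<bar>\<alpha> x\<bar> \<le> a / t" for x
    using opbound_dot[OF opbound_Q0[of j x], of ?a] na t
    by (simp add: \<alpha>_def) (meson divide_right_mono less_imp_le order_trans)
  have \<beta>: "\<bar>\<beta> x\<bar> \<le> a / t\<^sup>2" for x
  proof -
    have "\<bar>\<beta> x\<bar> \<le> 1 / t * (1 / t) * dot N ?a ?a"
      using opbound_dot[OF opbound_mulm[OF opbound_Q0[of j x] K], of ?a] by (simp add: \<beta>_def app_mulm)
    also have "\<dots> \<le> 1 / t * (1 / t) * a" using t by (intro mult_left_mono na) auto
    finally show ?thesis by (simp add: power2_eq_square)
  qed
  have RH: "dot N v (app N R w) = dot N (app N R v) w" for v w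
    unfolding R_def by (rule posdef_minv_dot[OF wgram_posdef])
  have Kapp: "app N K v = (\<lambda>i. D i * app N R v i)" for v
    by (auto simp: K_def app_def sum_distrib_left mult.assoc)
  have aKY: "dot N ?a (app N (Q0 j x) (app N K (Y j x))) = e2' x" for x
  proof -
    have "dot N ?a (app N (Q0 j x) (app N K (Y j x))) = dot N (\<lambda>i. D i * app N (Q0 j x) ?a i) (app N R (Y j x))"
      unfolding QH Kapp by (simp add: dot_def mult_ac)
    also have "\<dots> = dot N (app N R (\<lambda>i. D i * app N (Q0 j x) ?a i)) (Y j x)" by (rule RH)
    also have "\<dots> = e2' x" unfolding e2'_def by (rule dot_commute)
    finally show ?thesis .
  qed
  have \<kappa>': "dot N (colv (S x) j) (app N (Q0 j x) (colv (S x) j)) - p j - \<alpha> x = \<eta> x" for x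
  proof -
    have "app N (Q0 j x) (app N one_matrix (Y j x)) = app N (Q0 j x) (Y j x)"
      by (rule app_cong) (simp add: app_one_matrix)
    moreover have "(\<integral>x. (\<Sum>i<N. (r i j)\<^sup>2 * mulm N (Q x) one_matrix i i) \<partial>P) = p j"
      unfolding p_def by (intro Bochner_Integration.integral_cong refl sum.cong) (simp add: mulm_one_matrix)
    moreover have "dot N ?a (app N (Q0 j x) (Y j x)) = e1 x"
      using QH[of ?a x "Y j x"] dot_commute[of N _ "Y j x"] by (simp add: e1_def)
    ultimately show ?thesis
      unfolding colv_S dot_linear \<eta>_def e3'_def by (simp add: e1_def \<alpha>_def)
  qed
  have X: "dot N (colv (S x) j) (app N (Q0 j x) (app N K (colv (S x) j))) - \<pi> = e3 x + \<beta> x + e4 x" for x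
    unfolding colv_S dot_linear aKY e3_def e4_def \<beta>_def e2_def by simp
  define \<kappa>x where "\<kappa>x = (\<lambda>x. dot N (colv (S x) j) (app N (Q0 j x) (colv (S x) j)))"
  have \<kappa>0: "0 \<le> \<kappa>x x" for x unfolding \<kappa>x_def Q0_def by (rule leave_one_nonneg[OF t j])
  have qx: "q x j = 1 / (t * (1 + \<kappa>x x))" for x
    unfolding q_def \<kappa>x_def Q0_def by (rule leave_one_q[OF t j])
  have Z: "dot N ?a (app N (Q x) (app N K ?a)) = \<beta> x - t * q x j * (\<beta> x + e2 x) * (\<alpha> x + e1 x)" for x
  proof -
    have "dot N ?a (app N (Q x) (app N K ?a)) = \<beta> x - t * q x j *
        dot N (colv (S x) j) (app N (Q0 j x) (app N K ?a)) * dot N ?a (app N (Q0 j x) (colv (S x) j))"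
      unfolding Q_def Q0_def q_def \<beta>_def by (rule leave_one_other[OF t j])
    also have "dot N (colv (S x) j) (app N (Q0 j x) (app N K ?a)) = \<beta> x + e2 x"
      unfolding colv_S dot_linear by (simp add: \<beta>_def e2_def)
    also have "dot N ?a (app N (Q0 j x) (colv (S x) j)) = \<alpha> x + e1 x"
      unfolding colv_S dot_linear using QH[of ?a x "Y j x"] dot_commute[of N _ "Y j x"]
      by (simp add: \<alpha>_def e1_def)
    finally show ?thesis .
  qed
  let ?bd = "\<lambda>x. 1 / t * (\<bar>e3 x\<bar> + \<bar>e4 x\<bar> + a / t * \<bar>e2 x\<bar> + a / t\<^sup>2 * \<bar>e1 x\<bar> + ((e1 x)\<^sup>2 + (e2 x)\<^sup>2) + a / t\<^sup>2 * \<bar>\<eta> x\<bar>)"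
  have bd: "\<bar>Br x\<bar> \<le> ?bd x" for x
  proof -
    have "\<bar>Br x\<bar> = \<bar>1 / (t * (1 + \<kappa>x x)) * (e3 x + \<beta> x + e4 x) - 1 / (t * (1 + p j)) *
        (\<beta> x - t * (1 / (t * (1 + \<kappa>x x))) * (\<beta> x + e2 x) * (\<alpha> x + e1 x))\<bar>"
      unfolding Br_def X Z qx weight_def by (rule refl)
    also have "\<dots> \<le> 1 / t * (\<bar>e3 x\<bar> + \<bar>e4 x\<bar> + a / t * \<bar>e2 x\<bar> + a / t\<^sup>2 * \<bar>e1 x\<bar> + ((e1 x)\<^sup>2 + (e2 x)\<^sup>2) + a / t\<^sup>2 * \<bar>\<kappa>x x - p j - \<alpha> x\<bar>)"
      by (rule bracket_bound[OF t \<kappa>0 p_bounds(1)[OF j] \<alpha> \<beta>])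
    finally show ?thesis unfolding \<kappa>x_def \<kappa>' .
  qed
  note abs = msq_abs[OF m1] msq_abs[OF m2] msq_abs[OF m3] msq_abs[OF m4] msq_abs[OF m\<eta>]
  note sq = msq_integrable[OF m1] msq_integrable[OF m2]
  have int_bd: "integrable P ?bd"
    using abs sq by (intro integrable_mult_right Bochner_Integration.integrable_add) auto
  have Br_meas: "Br \<in> borel_measurable P"
    unfolding Br_def
    by (intro borel_measurable_diff borel_measurable_times borel_measurable_const q_measurable j dot_measurable
        app_measurable Q0_measurable Q_measurable S_measurable)
  have "norm (Br x) \<le> norm (?bd x)" for x
    unfolding real_norm_def by (rule order_trans[OF bd abs_ge_self])
  thus int: "integrable P Br"
    by (intro Bochner_Integration.integrable_bound[OF int_bd Br_meas] AE_I2)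
  have "\<bar>\<integral>x. Br x \<partial>P\<bar> \<le> (\<integral>x. \<bar>Br x\<bar> \<partial>P)" by (rule integral_abs_bound)
  also have "\<dots> \<le> (\<integral>x. ?bd x \<partial>P)" using int by (intro integral_mono int_bd bd) auto
  also have "\<dots> = 1 / t * ((\<integral>x. \<bar>e3 x\<bar> \<partial>P) + (\<integral>x. \<bar>e4 x\<bar> \<partial>P) + a / t * (\<integral>x. \<bar>e2 x\<bar> \<partial>P) + a / t\<^sup>2 * (\<integral>x. \<bar>e1 x\<bar> \<partial>P)
      + ((\<integral>x. (e1 x)\<^sup>2 \<partial>P) + (\<integral>x. (e2 x)\<^sup>2 \<partial>P)) + a / t\<^sup>2 * (\<integral>x. \<bar>\<eta> x\<bar> \<partial>P))"
    using abs sq by simp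
  also have "\<dots> \<le> 1 / t * ((form_const * (1 / t)\<^sup>2 + 1) / sqrt m + (4 * lin2_const + 1) / sqrt m + a / t * ((lin2_const + 1) / sqrt m)
     + a / t\<^sup>2 * ((lin1_const + 1) / sqrt m) + (lin1_const / sqrt m + lin2_const / sqrt m) + a / t\<^sup>2 * (((2 * form_const + 8 * lin1_const) + 1) / sqrt m))"
  proof -
    have sm: "x / m \<le> x / sqrt m" if "0 \<le> x" for x
    proof -
      have "sqrt m \<le> m" using m by (simp add: real_le_lsqrt self_le_power)
      thus ?thesis using that m by (intro divide_left_mono) auto
    qed
    have "0 \<le> a / t" "0 \<le> a / t\<^sup>2" "0 \<le> 1 / t" using a t by auto
    thus ?thesis
      using abs(2,4,6,8,10) order_trans[OF sq(2) sm[OF lin_const_nonneg(1)]] order_trans[OF sq(4) sm[OF lin_const_nonneg(2)]]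
      by (intro mult_left_mono add_mono)
  qed
  also have "\<dots> = bracket_const / sqrt m"
    unfolding bracket_const_def by (simp add: add_divide_distrib distrib_left mult_ac)
  finally show "\<bar>\<integral>x. Br x \<partial>P\<bar> \<le> bracket_const / sqrt m" .
qed

text \<open>\<open>trace_resolvent_difference\<close> becomes a sum of n brackets, each of mean
  O(1/sqrt m), after adding and subtracting the terms \<open>\<pi> j * q x j\<close>; what is left
  over has mean zero. Hence the order sqrt m for traces of size m.\<close>

lemma mean_resolvent_estimate:
  fixes D :: "nat \<Rightarrow> real"
  assumes D: "\<And>i. i < N \<Longrightarrow> \<bar>D i\<bar> \<le> 1"
  shows "\<bar>(\<Sum>i<N. D i * R i i) - (\<integral>x. (\<Sum>i<N. D i * Q x i i) \<partial>P)\<bar> \<le> t * \<kappa> * bracket_const * sqrt m"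
proof -
  define K where "K = (\<lambda>i l. D i * R i l)"
  have K: "opbound N K (1 / t)"
    using opbound_diag[OF D _ opbound_R] by (simp add: K_def)
  define \<pi> where "\<pi> = (\<lambda>j. \<integral>x. (\<Sum>i<N. (r i j)\<^sup>2 * mulm N (Q x) K i i) \<partial>P)"
  define Br where "Br = (\<lambda>j x. q x j * (dot N (colv (S x) j) (app N (Q0 j x) (app N K (colv (S x) j))) - \<pi> j)
      - weight t p j * dot N (colv A j) (app N (Q x) (app N K (colv A j))))"
  have Br: "integrable P (Br j)" "\<bar>\<integral>x. Br j x \<partial>P\<bar> \<le> bracket_const / sqrt m" if "j < n" for j
    unfolding Br_def \<pi>_def K_def by (rule bracket_expectation[OF that D]; assumption)+
  have QK: "integrable P (\<lambda>x. mulm N (Q x) K l l)" if "l < N" for l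
    by (rule integrable_bounded[OF _ opbound_entry[OF opbound_mulm[OF opbound_Q K] that that]])
       (intro mulm_measurable Q_measurable that)
  have id: "(\<Sum>i<N. D i * (R i i - Q x i i)) = t * ((\<Sum>j<n. Br j x) + ((\<Sum>j<n. \<pi> j * q x j) - (\<Sum>l<N. p' l * mulm N (Q x) K l l)))" for x
  proof -
    have "(\<Sum>i<N. D i * (R i i - Q x i i)) =
       (\<Sum>j<n. dot N (colv (S x) j) (app N (Q x) (app N K (colv (S x) j))))
       - (\<Sum>l<N. (1 / weight t p' l - t) * mulm N (Q x) K l l)
       - t * (\<Sum>j<n. weight t p j * dot N (colv A j) (app N (Q x) (app N K (colv A j))))"
      unfolding Q_def R_def K_def by (rule trace_resolvent_difference[OF t wgram_posdef])
    also have "(\<Sum>l<N. (1 / weight t p' l - t) * mulm N (Q x) K l l) = t * (\<Sum>l<N. p' l * mulm N (Q x) K l l)"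
      by (simp add: weight_def sum_distrib_left algebra_simps)
    also have "(\<Sum>j<n. dot N (colv (S x) j) (app N (Q x) (app N K (colv (S x) j)))) =
       (\<Sum>j<n. t * q x j * dot N (colv (S x) j) (app N (Q0 j x) (app N K (colv (S x) j))))"
      unfolding Q_def Q0_def q_def by (intro sum.cong refl leave_one_self[OF t]) simp
    finally show ?thesis
      by (simp add: Br_def sum_subtractf sum.distrib algebra_simps sum_distrib_left)
  qed
  \<comment> \<open>Both sums have as expectation the double sum of (r l j)^2 E[(Q K) l l] E[q j]:
    the first through the definition of \<open>\<pi>\<close>, the second through that of
    \<open>p'\<close>. The cancellation is exact because both are means.\<close>
  have zero: "(\<integral>x. (\<Sum>j<n. \<pi> j * q x j) - (\<Sum>l<N. p' l * mulm N (Q x) K l l) \<partial>P) = 0"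
  proof -
    have "(\<integral>x. (\<Sum>j<n. \<pi> j * q x j) \<partial>P) = (\<Sum>j<n. \<pi> j * (\<integral>x. q x j \<partial>P))"
      by (simp add: q_integrable)
    also have "\<dots> = (\<Sum>j<n. \<Sum>l<N. (r l j)\<^sup>2 * (\<integral>x. mulm N (Q x) K l l \<partial>P) * (\<integral>x. q x j \<partial>P))"
      unfolding \<pi>_def by (simp add: QK sum_distrib_right)
    also have "\<dots> = (\<Sum>l<N. \<Sum>j<n. (r l j)\<^sup>2 * (\<integral>x. mulm N (Q x) K l l \<partial>P) * (\<integral>x. q x j \<partial>P))"
      by (rule sum.swap)
    also have "\<dots> = (\<Sum>l<N. p' l * (\<integral>x. mulm N (Q x) K l l \<partial>P))"
      unfolding p'_def by (simp add: q_integrable sum_distrib_left sum_distrib_right mult_ac)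
    also have "\<dots> = (\<integral>x. (\<Sum>l<N. p' l * mulm N (Q x) K l l) \<partial>P)"
      by (simp add: QK)
    finally show ?thesis
      by (subst Bochner_Integration.integral_diff) (auto simp: QK q_integrable)
  qed
  have "(\<Sum>i<N. D i * R i i) - (\<integral>x. (\<Sum>i<N. D i * Q x i i) \<partial>P) = (\<integral>x. (\<Sum>i<N. D i * (R i i - Q x i i)) \<partial>P)"
  proof -
    have i: "integrable P (\<lambda>x. \<Sum>i<N. D i * Q x i i)"
      by (intro Bochner_Integration.integrable_sum integrable_mult_right Q_integrable) auto
    have "(\<integral>x. (\<Sum>i<N. D i * R i i) - (\<Sum>i<N. D i * Q x i i) \<partial>P) =
        (\<integral>x. (\<Sum>i<N. D i * R i i) \<partial>P) - (\<integral>x. (\<Sum>i<N. D i * Q x i i) \<partial>P)"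
      by (rule Bochner_Integration.integral_diff[OF _ i]) simp
    thus ?thesis by (simp add: right_diff_distrib sum_subtractf P.prob_space)
  qed
  also have "\<dots> = t * ((\<Sum>j<n. \<integral>x. Br j x \<partial>P) + (\<integral>x. (\<Sum>j<n. \<pi> j * q x j) - (\<Sum>l<N. p' l * mulm N (Q x) K l l) \<partial>P))"
  proof -
    have "integrable P (\<lambda>x. (\<Sum>j<n. \<pi> j * q x j) - (\<Sum>l<N. p' l * mulm N (Q x) K l l))"
      by (intro Bochner_Integration.integrable_diff Bochner_Integration.integrable_sum integrable_mult_right
          QK q_integrable) auto
    moreover have "integrable P (\<lambda>x. \<Sum>j<n. Br j x)" using Br(1) by auto
    ultimately have "(\<integral>x. (\<Sum>j<n. Br j x) + ((\<Sum>j<n. \<pi> j * q x j) - (\<Sum>l<N. p' l * mulm N (Q x) K l l)) \<partial>P)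
      = (\<integral>x. (\<Sum>j<n. Br j x) \<partial>P) + (\<integral>x. (\<Sum>j<n. \<pi> j * q x j) - (\<Sum>l<N. p' l * mulm N (Q x) K l l) \<partial>P)"
      by (intro Bochner_Integration.integral_add)
    moreover have "(\<integral>x. (\<Sum>j<n. Br j x) \<partial>P) = (\<Sum>j<n. \<integral>x. Br j x \<partial>P)"
      using Br(1) by (intro Bochner_Integration.integral_sum) auto
    ultimately show ?thesis unfolding id by simp
  qed
  also have "\<dots> = t * (\<Sum>j<n. \<integral>x. Br j x \<partial>P)" unfolding zero by simp
  finally have eq: "(\<Sum>i<N. D i * R i i) - (\<integral>x. (\<Sum>i<N. D i * Q x i i) \<partial>P) = t * (\<Sum>j<n. \<integral>x. Br j x \<partial>P)" .
  have "\<bar>\<Sum>j<n. \<integral>x. Br j x \<partial>P\<bar> \<le> (\<Sum>j<n. bracket_const / sqrt m)"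
    by (intro order_trans[OF sum_abs] sum_mono Br(2)) simp
  also have "\<dots> = real n * (bracket_const / sqrt m)" by simp
  also have "\<dots> \<le> \<kappa> * m * (bracket_const / sqrt m)"
  proof (intro mult_right_mono n_le)
    show "0 \<le> bracket_const / sqrt m" using order_trans[OF abs_ge_zero Br(2)[OF n_pos]] .
  qed
  also have "\<dots> = \<kappa> * bracket_const * (m / sqrt m)" by simp
  also have "m / sqrt m = sqrt m" using m by (intro real_div_sqrt) simp
  finally show ?thesis
    unfolding eq abs_mult using t by (simp add: mult.assoc mult_left_mono)
qed

end

section \<open>Transposition and contraction\<close>

text \<open>With bounds on rows as well as columns the assumptions are invariant under
  transposition, so each estimate for the resolvent also yields one for the co-resolvent.\<close>

locale two_sided_model = noise_model +
  assumes N_pos: "N > 0"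
    and A_row_le: "\<And>i. i < N \<Longrightarrow> dot n (\<lambda>j. A i j) (\<lambda>j. A i j) \<le> a"
begin

lemma transposed_model: "noise_model \<mu> m4 n N (transp r) (transp A) t m s \<kappa> a"
  using t m s a \<kappa> N_le n_le N_pos r_le A_row_le by unfold_locales auto

lemma transposed_two_sided_model: "two_sided_model \<mu> m4 n N (transp r) (transp A) t m s \<kappa> a"
  using n_pos A_le
  by (intro two_sided_model.intro transposed_model two_sided_model_axioms.intro) auto

interpretation tr: noise_model \<mu> m4 n N "transp r" "transp A" t m s \<kappa> a
  by (rule transposed_model)

definition flip :: "(nat \<times> nat \<Rightarrow> real) \<Rightarrow> nat \<times> nat \<Rightarrow> real" where
  "flip x = (\<lambda>c\<in>{..<n} \<times> {..<N}. x (prod.swap c))"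

text \<open>All entries share one law, so exchanging the two indices preserves the product measure;
  expectations in the transposed model can be computed on \<open>P\<close>.\<close>

lemma distr_flip: "distr P (PiM ({..<n} \<times> {..<N}) (\<lambda>_. \<mu>)) flip = PiM ({..<n} \<times> {..<N}) (\<lambda>_. \<mu>)"
  unfolding flip_def
  by (rule distr_PiM_reindex[where M = "\<lambda>_. \<mu>"]) (auto simp: inj_on_def intro: prob_space_axioms)

lemma flip_measurable: "flip \<in> measurable P (PiM ({..<n} \<times> {..<N}) (\<lambda>_. \<mu>))"
  unfolding flip_def by (rule measurable_restrict) auto

lemma tr_Q_flip: "tr.Q (flip x) j j = q x j"
  unfolding tr.Q_def q_def
  by (rule fun_cong[OF fun_cong[OF minv_cong]])
     (auto simp: gram_def tr.S_def S_def flip_def intro!: sum.cong)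

lemma tr_q_flip: "tr.q (flip x) i = Q x i i"
  unfolding tr.q_def Q_def
  by (rule fun_cong[OF fun_cong[OF minv_cong]])
     (auto simp: gram_def tr.S_def S_def flip_def intro!: sum.cong)

lemma integral_flip:
  fixes f :: "(nat \<times> nat \<Rightarrow> real) \<Rightarrow> real"
  assumes "f \<in> borel_measurable (PiM ({..<n} \<times> {..<N}) (\<lambda>_. \<mu>))"
  shows "(\<integral>x. f x \<partial>PiM ({..<n} \<times> {..<N}) (\<lambda>_. \<mu>)) = (\<integral>x. f (flip x) \<partial>P)"
  by (subst distr_flip[symmetric]) (rule integral_distr[OF flip_measurable assms])

lemma tr_p: "tr.p i = p' i"
  unfolding tr.p_def p'_def
  by (subst integral_flip)
     (auto intro!: borel_measurable_sum borel_measurable_times tr.Q_measurable simp: tr_Q_flip)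

lemma tr_p': "tr.p' j = p j"
  unfolding tr.p'_def p_def
  by (subst integral_flip)
     (auto intro!: borel_measurable_sum borel_measurable_times tr.q_measurable simp: tr_q_flip)

definition "R' = minv n (wgram N (transp A) t (weight t p) (weight t p'))"

lemma tr_R: "tr.R = R'"
proof -
  have "weight t tr.p' = weight t p" "weight t tr.p = weight t p'"
    by (auto simp: weight_def tr_p tr_p')
  thus ?thesis by (simp add: tr.R_def R'_def)
qed

lemma p_approx:
  assumes j: "j < n"
  shows "\<bar>p j - (\<Sum>i<N. (r i j)\<^sup>2 * R i i)\<bar> \<le> s * t * \<kappa> * bracket_const / sqrt m"
proof -
  \<comment> \<open>The variance profile of column j rescaled to be at most 1, as
    \<open>mean_resolvent_estimate\<close> requires; undoing the scale s/m turns sqrt m into 1/sqrt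
    m.\<close>
  define D where "D = (\<lambda>i. (r i j)\<^sup>2 * (m / s))"
  have D: "\<bar>D i\<bar> \<le> 1" if "i < N" for i
  proof -
    have "(r i j)\<^sup>2 * (m / s) \<le> s / m * (m / s)" using m s that j by (intro mult_right_mono r_le) auto
    thus ?thesis using m s by (simp add: D_def)
  qed
  have rD: "(r i j)\<^sup>2 = s / m * D i" for i using m s by (simp add: D_def)
  have "p j - (\<Sum>i<N. (r i j)\<^sup>2 * R i i) = s / m * ((\<integral>x. (\<Sum>i<N. D i * Q x i i) \<partial>P) - (\<Sum>i<N. D i * R i i))"
    unfolding p_def rD mult.assoc sum_distrib_left[symmetric] by (simp add: right_diff_distrib)
  hence "\<bar>p j - (\<Sum>i<N. (r i j)\<^sup>2 * R i i)\<bar> = s / m * \<bar>(\<Sum>i<N. D i * R i i) - (\<integral>x. (\<Sum>i<N. D i * Q x i i) \<partial>P)\<bar>"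
    using s m by (simp add: abs_mult abs_minus_commute)
  also have "\<dots> \<le> s / m * (t * \<kappa> * bracket_const * sqrt m)"
    using s m by (intro mult_left_mono mean_resolvent_estimate D) auto
  also have "\<dots> = s * t * \<kappa> * bracket_const * (sqrt m / m)" by simp
  also have "sqrt m / m = 1 / sqrt m" using m by (simp add: field_simps)
  finally show ?thesis by simp
qed

lemma p'_approx:
  assumes i: "i < N"
  shows "\<bar>p' i - (\<Sum>j<n. (r i j)\<^sup>2 * R' j j)\<bar> \<le> s * t * \<kappa> * bracket_const / sqrt m"
proof -
  interpret tr2: two_sided_model \<mu> m4 n N "transp r" "transp A" t m s \<kappa> a
    by (rule transposed_two_sided_model)
  show ?thesis using tr2.p_approx[OF i] by (simp add: tr_p tr_R)
qed

text \<open>The weights of the mean resolvent solve the fundamental system up to \<open>O(1/\<surd>m)\<close>, and for large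
  \<open>t\<close> that system is a contraction.\<close>

lemma mean_equivalent:
  assumes big: "\<kappa> * s * (2 + \<kappa> * s / t) / t \<le> 1 / 2"
    and \<tau>0: "\<And>j. j < n \<Longrightarrow> 0 \<le> \<tau> j" and \<tau>'0: "\<And>i. i < N \<Longrightarrow> 0 \<le> \<tau>' i"
    and \<tau>: "\<And>j. j < n \<Longrightarrow> \<tau> j = (\<Sum>i<N. (r i j)\<^sup>2 * minv N (wgram n A t (weight t \<tau>') (weight t \<tau>)) i i)"
    and \<tau>': "\<And>i. i < N \<Longrightarrow> \<tau>' i = (\<Sum>j<n. (r i j)\<^sup>2 * minv n (wgram N (transp A) t (weight t \<tau>) (weight t \<tau>')) j j)"
  shows "\<bar>(\<integral>x. (\<Sum>i<N. Q x i i) \<partial>P) - (\<Sum>i<N. minv N (wgram n A t (weight t \<tau>') (weight t \<tau>)) i i)\<bar>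
     \<le> 2 * t * \<kappa> * bracket_const * sqrt m"
proof -
  define T where "T = minv N (wgram n A t (weight t \<tau>') (weight t \<tau>))"
  define T' where "T' = minv n (wgram N (transp A) t (weight t \<tau>) (weight t \<tau>'))"
  \<comment> \<open>A common a priori bound for mean and exact weights: diagonal entries of the
    inverses are at most 1/t, and the variances in a row or column sum to at most \<kappa>
    s.\<close>
  define c where "c = \<kappa> * s / t"
  have c: "0 \<le> c" using \<kappa> s t by (simp add: c_def)
  define \<epsilon> where "\<epsilon> = s * t * \<kappa> * bracket_const / sqrt m"
  have row_sum: "(\<Sum>i<N. (r i j)\<^sup>2 * x i) \<le> \<kappa> * s * b" if "j < n" "\<And>i. i < N \<Longrightarrow> x i \<le> b" "0 \<le> b" for j x b
  proof -
    have "(\<Sum>i<N. (r i j)\<^sup>2 * x i) \<le> (\<Sum>i<N. (r i j)\<^sup>2 * b)" using that by (intro sum_mono mult_left_mono) auto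
    also have "\<dots> \<le> (\<Sum>i<N. s / m * b)" using that by (intro sum_mono mult_right_mono r_le) auto
    also have "\<dots> = real N * (s / m * b)" by simp
    also have "\<dots> \<le> \<kappa> * m * (s / m * b)" using s m that by (intro mult_right_mono N_le) auto
    also have "\<dots> = \<kappa> * s * b" using m by simp
    finally show ?thesis .
  qed
  have col_sum: "(\<Sum>j<n. (r i j)\<^sup>2 * x j) \<le> \<kappa> * s * b" if "i < N" "\<And>j. j < n \<Longrightarrow> x j \<le> b" "0 \<le> b" for i x b
  proof -
    have "(\<Sum>j<n. (r i j)\<^sup>2 * x j) \<le> (\<Sum>j<n. (r i j)\<^sup>2 * b)" using that by (intro sum_mono mult_left_mono) auto
    also have "\<dots> \<le> (\<Sum>j<n. s / m * b)" using that by (intro sum_mono mult_right_mono r_le) auto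
    also have "\<dots> = real n * (s / m * b)" by simp
    also have "\<dots> \<le> \<kappa> * m * (s / m * b)" using s m that by (intro mult_right_mono n_le) auto
    also have "\<dots> = \<kappa> * s * b" using m by simp
    finally show ?thesis .
  qed
  have Tpd: "posdef t N (wgram n A t (weight t \<tau>') (weight t \<tau>))"
    and T'pd: "posdef t n (wgram N (transp A) t (weight t \<tau>) (weight t \<tau>'))"
    using \<tau>0 \<tau>'0 by (auto intro!: posdef_weights t)
  have \<tau>c: "\<tau> j \<le> c" if "j < n" for j
    using row_sum[OF that, of "\<lambda>i. T i i" "1 / t"] posdef_minv_diag(2)[OF Tpd] t
    unfolding \<tau>[OF that] by (simp add: T_def c_def)
  have \<tau>'c: "\<tau>' i \<le> c" if "i < N" for i
    using col_sum[OF that, of "\<lambda>j. T' j j" "1 / t"] posdef_minv_diag(2)[OF T'pd] t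
    unfolding \<tau>'[OF that] by (simp add: T'_def c_def)
  \<comment> \<open>Both families enter one maximum, since R and R' each depend on both sets of
    weights and neither error can be closed up alone.\<close>
  define E where "E = (\<lambda>j. \<bar>p j - \<tau> j\<bar>) ` {..<n} \<union> (\<lambda>i. \<bar>p' i - \<tau>' i\<bar>) ` {..<N}"
  define \<delta> where "\<delta> = Max E"
  have E: "finite E" "E \<noteq> {}" using n_pos by (auto simp: E_def)
  have d: "\<bar>p j - \<tau> j\<bar> \<le> \<delta>" if "j < n" for j
    unfolding \<delta>_def using that E by (intro Max_ge) (auto simp: E_def)
  have d': "\<bar>p' i - \<tau>' i\<bar> \<le> \<delta>" if "i < N" for i
    unfolding \<delta>_def using that E by (intro Max_ge) (auto simp: E_def)
  have \<delta>0: "0 \<le> \<delta>" using d[OF n_pos] by linarith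
  have RT: "\<bar>R i i - T i i\<bar> \<le> (2 + c) * \<delta> / t" if "i < N" for i
    unfolding R_def T_def
    by (rule wgram_stability[OF t c \<delta>0])
       (use that p'_nonneg p_bounds \<tau>'0 \<tau>0 \<tau>c d d' in \<open>auto simp: c_def\<close>)
  have RT': "\<bar>R' j j - T' j j\<bar> \<le> (2 + c) * \<delta> / t" if "j < n" for j
    unfolding R'_def T'_def
    by (rule wgram_stability[OF t c \<delta>0])
       (use that p'_nonneg p'_le p_bounds \<tau>'0 \<tau>0 \<tau>'c d d' in \<open>auto simp: c_def\<close>)
  have nn: "0 \<le> (2 + c) * \<delta> / t" using c \<delta>0 t by simp
  \<comment> \<open>The assumption \<open>big\<close> says that the Lipschitz constant \<kappa> s (2
    + c) / t of the system is at most 1/2.\<close>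
  have half: "\<kappa> * s * ((2 + c) * \<delta> / t) \<le> \<delta> / 2"
    using mult_right_mono[OF big \<delta>0] by (simp add: c_def mult_ac)
  have "e \<le> \<epsilon> + \<delta> / 2" if "e \<in> E" for e
    using that unfolding E_def
  proof
    assume "e \<in> (\<lambda>j. \<bar>p j - \<tau> j\<bar>) ` {..<n}"
    then obtain j where j: "j < n" and e: "e = \<bar>p j - \<tau> j\<bar>" by auto
    have "\<bar>(\<Sum>i<N. (r i j)\<^sup>2 * R i i) - \<tau> j\<bar> = \<bar>\<Sum>i<N. (r i j)\<^sup>2 * (R i i - T i i)\<bar>"
      unfolding \<tau>[OF j] T_def[symmetric] by (simp add: right_diff_distrib sum_subtractf)
    also have "\<dots> \<le> (\<Sum>i<N. (r i j)\<^sup>2 * \<bar>R i i - T i i\<bar>)"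
      by (intro order_trans[OF sum_abs] sum_mono) (simp add: abs_mult)
    also have "\<dots> \<le> \<kappa> * s * ((2 + c) * \<delta> / t)" by (rule row_sum[OF j RT nn])
    finally show ?thesis using p_approx[OF j] half unfolding e \<epsilon>_def by linarith
  next
    assume "e \<in> (\<lambda>i. \<bar>p' i - \<tau>' i\<bar>) ` {..<N}"
    then obtain i where i: "i < N" and e: "e = \<bar>p' i - \<tau>' i\<bar>" by auto
    have "\<bar>(\<Sum>j<n. (r i j)\<^sup>2 * R' j j) - \<tau>' i\<bar> = \<bar>\<Sum>j<n. (r i j)\<^sup>2 * (R' j j - T' j j)\<bar>"
      unfolding \<tau>'[OF i] T'_def[symmetric] by (simp add: right_diff_distrib sum_subtractf)
    also have "\<dots> \<le> (\<Sum>j<n. (r i j)\<^sup>2 * \<bar>R' j j - T' j j\<bar>)"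
      by (intro order_trans[OF sum_abs] sum_mono) (simp add: abs_mult)
    also have "\<dots> \<le> \<kappa> * s * ((2 + c) * \<delta> / t)" by (rule col_sum[OF i RT' nn])
    finally show ?thesis using p'_approx[OF i] half unfolding e \<epsilon>_def by linarith
  qed
  hence "\<delta> \<le> \<epsilon> + \<delta> / 2" unfolding \<delta>_def using Max_in[OF E] by blast
  hence \<delta>\<epsilon>: "\<delta> \<le> 2 * \<epsilon>" by simp
  have "\<bar>\<Sum>i<N. R i i - T i i\<bar> \<le> (\<Sum>i<N. (2 + c) * \<delta> / t)"
    by (intro order_trans[OF sum_abs] sum_mono RT) simp
  also have "\<dots> = real N * ((2 + c) * \<delta> / t)" by simp
  also have "\<dots> \<le> \<kappa> * m * ((2 + c) * \<delta> / t)" by (intro mult_right_mono N_le nn)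
  \<comment> \<open>Rewritten so that the contraction estimate applies a second time; afterwards
    \<delta> / 2 <= \<epsilon>.\<close>
  also have "\<dots> = m / s * (\<kappa> * s * ((2 + c) * \<delta> / t))" using s by simp
  also have "\<dots> \<le> m / s * (\<delta> / 2)" using s m by (intro mult_left_mono half) auto
  also have "\<dots> \<le> m / s * \<epsilon>" using s m \<delta>\<epsilon> by (intro mult_left_mono) auto
  also have "\<dots> = t * \<kappa> * bracket_const * (m / sqrt m)" using s by (simp add: \<epsilon>_def)
  also have "m / sqrt m = sqrt m" using m by (intro real_div_sqrt) simp
  finally have 1: "\<bar>\<Sum>i<N. R i i - T i i\<bar> \<le> t * \<kappa> * bracket_const * sqrt m" .
  have 2: "\<bar>(\<Sum>i<N. R i i) - (\<integral>x. (\<Sum>i<N. Q x i i) \<partial>P)\<bar> \<le> t * \<kappa> * bracket_const * sqrt m"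
    using mean_resolvent_estimate[of "\<lambda>_. 1"] by simp
  show ?thesis using 1 2 unfolding sum_subtractf T_def[symmetric] by linarith
qed

lemma resolvent_trace_deviation:
  "(\<integral>\<^sup>+x. ennreal (((\<Sum>i<N. Q x i i) - (\<integral>x. (\<Sum>i<N. Q x i i) \<partial>P)) ^ 4) \<partial>P) \<le> ennreal (100 * (2 / t) ^ 4 * (\<kappa> * m)\<^sup>2)"
proof -
  have e: "(\<Sum>i<N. mulm N B one_matrix i i) = (\<Sum>i<N. B i i)" for B
    by (intro sum.cong) (auto simp: mulm_one_matrix)
  have "100 * (2 * 1 / t) ^ 4 * (real n)\<^sup>2 \<le> 100 * (2 / t) ^ 4 * (\<kappa> * m)\<^sup>2"
    using t by (intro mult_mono power_mono n_le) auto
  thus ?thesis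
    using trace_fourth_moment[OF opbound_one_matrix]
    unfolding e by (auto intro: order_trans ennreal_leI)
qed

lemma co_resolvent_trace:
  shows "(\<integral>x. (\<Sum>j<n. q x j) \<partial>P) = (\<integral>x. (\<Sum>j<n. tr.Q x j j) \<partial>PiM ({..<n} \<times> {..<N}) (\<lambda>_. \<mu>))"
  by (subst integral_flip) (auto intro!: borel_measurable_sum tr.Q_measurable simp: tr_Q_flip)

lemma co_resolvent_trace_deviation:
  "(\<integral>\<^sup>+x. ennreal (((\<Sum>j<n. q x j) - (\<integral>x. (\<Sum>j<n. q x j) \<partial>P)) ^ 4) \<partial>P) \<le> ennreal (100 * (2 / t) ^ 4 * (\<kappa> * m)\<^sup>2)"
proof -
  interpret tr2: two_sided_model \<mu> m4 n N "transp r" "transp A" t m s \<kappa> a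
    by (rule transposed_two_sided_model)
  let ?P' = "PiM ({..<n} \<times> {..<N}) (\<lambda>_. \<mu>)"
  define e where "e = (\<integral>x. (\<Sum>j<n. q x j) \<partial>P)"
  have "(\<integral>\<^sup>+x. ennreal (((\<Sum>j<n. q x j) - e) ^ 4) \<partial>P) = (\<integral>\<^sup>+x. ennreal (((\<Sum>j<n. tr.Q (flip x) j j) - e) ^ 4) \<partial>P)"
    by (simp add: tr_Q_flip)
  also have "\<dots> = (\<integral>\<^sup>+x. ennreal (((\<Sum>j<n. tr.Q x j j) - e) ^ 4) \<partial>distr P ?P' flip)"
  proof (rule nn_integral_distr[OF flip_measurable, symmetric])
    have [measurable]: "(\<lambda>x. \<Sum>j<n. tr.Q x j j) \<in> borel_measurable ?P'"
      by (auto intro!: borel_measurable_sum tr.Q_measurable)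
    show "(\<lambda>x. ennreal (((\<Sum>j<n. tr.Q x j j) - e) ^ 4)) \<in> borel_measurable (distr P ?P' flip)"
      unfolding distr_flip by measurable
  qed
  also have "\<dots> \<le> ennreal (100 * (2 / t) ^ 4 * (\<kappa> * m)\<^sup>2)"
    unfolding distr_flip e_def co_resolvent_trace by (rule tr2.resolvent_trace_deviation)
  finally show ?thesis by (simp add: e_def)
qed

lemma co_mean_equivalent:
  assumes big: "\<kappa> * s * (2 + \<kappa> * s / t) / t \<le> 1 / 2"
    and \<tau>0: "\<And>j. j < n \<Longrightarrow> 0 \<le> \<tau> j" and \<tau>'0: "\<And>i. i < N \<Longrightarrow> 0 \<le> \<tau>' i"
    and \<tau>: "\<And>j. j < n \<Longrightarrow> \<tau> j = (\<Sum>i<N. (r i j)\<^sup>2 * minv N (wgram n A t (weight t \<tau>') (weight t \<tau>)) i i)"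
    and \<tau>': "\<And>i. i < N \<Longrightarrow> \<tau>' i = (\<Sum>j<n. (r i j)\<^sup>2 * minv n (wgram N (transp A) t (weight t \<tau>) (weight t \<tau>')) j j)"
  shows "\<bar>(\<integral>x. (\<Sum>j<n. q x j) \<partial>P) - (\<Sum>j<n. minv n (wgram N (transp A) t (weight t \<tau>) (weight t \<tau>')) j j)\<bar>
     \<le> 2 * t * \<kappa> * bracket_const * sqrt m"
proof -
  interpret tr2: two_sided_model \<mu> m4 n N "transp r" "transp A" t m s \<kappa> a
    by (rule transposed_two_sided_model)
  show ?thesis unfolding co_resolvent_trace
    by (rule tr2.mean_equivalent) (use assms in auto)
qed

end

section \<open>Stieltjes transforms and resolvents off the half line\<close>

text \<open>A continuous lower bound for the distance to the half line, positive off it. It is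
  preferred to the distance because one of the rotations 1, i, -i realizes it as a real
  part.\<close>

definition slit_gap :: "complex \<Rightarrow> real" where
  "slit_gap z = max \<bar>Im z\<bar> (- Re z)"

lemma slit_gap_pos: "z \<notin> \<real>\<^sub>\<ge>\<^sub>0 \<Longrightarrow> 0 < slit_gap z"
  by (auto simp: slit_gap_def complex_nonneg_Reals_iff)

text \<open>A rotation \<open>u\<close> that moves \<open>l - z\<close> into a half plane for all \<open>l \<ge> 0\<close>.\<close>

lemma slit_rotation:
  obtains u where "cmod u = 1" "0 \<le> Re u" "slit_gap z \<le> Re (- (u * z))"
proof -
  have "\<exists>u. cmod u = 1 \<and> 0 \<le> Re u \<and> slit_gap z \<le> Re (- (u * z))"
  proof (cases "\<bar>Im z\<bar> \<le> - Re z")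
    case True
    thus ?thesis by (intro exI[of _ 1]) (simp add: slit_gap_def)
  next
    case False
    show ?thesis
    proof (cases "Im z \<ge> 0")
      case True
      thus ?thesis using False by (intro exI[of _ \<i>]) (simp add: slit_gap_def)
    next
      case neg: False
      thus ?thesis using False by (intro exI[of _ "- \<i>"]) (simp add: slit_gap_def)
    qed
  qed
  thus ?thesis using that by blast
qed

lemma half_plane_diff:
  assumes "cmod u = 1" "0 \<le> Re u" "d \<le> Re (- (u * z))" "0 \<le> l"
  shows "d \<le> Re (u * (complex_of_real l - z))" "d \<le> cmod (complex_of_real l - z)"
proof -
  have "Re (u * (complex_of_real l - z)) = l * Re u + Re (- (u * z))"
    by (simp add: algebra_simps)
  thus 1: "d \<le> Re (u * (complex_of_real l - z))"
    using assms mult_nonneg_nonneg[of l "Re u"] by linarith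
  also have "\<dots> \<le> cmod (u * (complex_of_real l - z))" by (rule complex_Re_le_cmod)
  finally show "d \<le> cmod (complex_of_real l - z)" using assms by (simp add: norm_mult)
qed

lemma Re_times_real: "Re (x * complex_of_real r) = Re x * r" "Re (complex_of_real r * x) = r * Re x"
  by simp_all

locale half_line_measure = prob_space \<nu> for \<nu> :: "real measure" +
  assumes sets_nu [measurable_cong]: "sets \<nu> = sets borel"
    and measure_half_line: "measure \<nu> {0..} = 1"
begin

lemma AE_nonneg: "AE l in \<nu>. 0 \<le> l"
  using AE_prob_1[OF measure_half_line] by simp

lemma kernel_measurable: "(\<lambda>l. 1 / (complex_of_real l - z)) \<in> borel_measurable \<nu>"
  by measurable

lemma kernel_bound: "AE l in \<nu>. slit_gap z \<le> cmod (complex_of_real l - z)"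
proof -
  obtain u where u: "cmod u = 1" "0 \<le> Re u" "slit_gap z \<le> Re (- (u * z))" by (rule slit_rotation)
  show ?thesis using AE_nonneg by eventually_elim (rule half_plane_diff(2)[OF u])
qed

lemma kernel_integrable:
  assumes "z \<notin> \<real>\<^sub>\<ge>\<^sub>0"
  shows "integrable \<nu> (\<lambda>l. 1 / (complex_of_real l - z))"
proof (rule integrable_const_bound[where B = "1 / slit_gap z"])
  show "AE l in \<nu>. cmod (1 / (complex_of_real l - z)) \<le> 1 / slit_gap z"
    using kernel_bound[of z]
  proof eventually_elim
    case (elim l)
    thus ?case using slit_gap_pos[OF assms] by (simp add: norm_divide frac_le)
  qed
qed (rule kernel_measurable)

text \<open>Pointwise Re (u cnj h) = Re (u (l - z)) |h|^2 >= d |h|^2 for the kernel h. Integration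
  and Jensen give Re (u cnj f) >= d |f|^2, hence the second claim; the third is a pointwise sign.
  One rotation thus puts the diagonal and the A-part of T^{-1} into the right half plane
  simultaneously.\<close>

lemma transform_half_plane:
  assumes z: "z \<notin> \<real>\<^sub>\<ge>\<^sub>0" and u: "cmod u = 1" "0 \<le> Re u" "d \<le> Re (- (u * z))" and d: "0 < d"
  defines "f \<equiv> (\<integral>l. 1 / (complex_of_real l - z) \<partial>\<nu>)"
  shows "f \<noteq> 0" "d \<le> Re (u / f)" "0 \<le> Re (- (u * z * f))"
proof -
  let ?h = "\<lambda>l. 1 / (complex_of_real l - z)"
  note int = kernel_integrable[OF z]
  have bnd: "AE l in \<nu>. cmod (?h l) \<le> 1 / d"
    using AE_nonneg
  proof eventually_elim
    case (elim l)
    show ?case using half_plane_diff(2)[OF u elim] d by (simp add: norm_divide frac_le)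
  qed
  have int2: "integrable \<nu> (\<lambda>l. (cmod (?h l))\<^sup>2)"
  proof (rule integrable_const_bound[where B = "(1 / d)\<^sup>2"])
    show "AE l in \<nu>. norm ((cmod (?h l))\<^sup>2) \<le> (1 / d)\<^sup>2"
      using bnd by eventually_elim (simp add: power_mono del: norm_divide)
  qed measurable
  have Reint: "Re (w * cnj f) = (\<integral>l. Re (w * cnj (?h l)) \<partial>\<nu>)" for w
  proof -
    have "(\<integral>l. w * cnj (?h l) \<partial>\<nu>) = w * cnj f"
    proof -
      have "(\<integral>l. cnj (?h l) \<partial>\<nu>) = cnj f" unfolding f_def by (rule Bochner_Integration.integral_cnj)
      thus ?thesis by (subst integral_mult_right_zero) simp
    qed
    moreover have "integrable \<nu> (\<lambda>l. w * cnj (?h l))" by (intro integrable_mult_right integrable_cnj int)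
    ultimately show ?thesis using integral_Re[of \<nu> "\<lambda>l. w * cnj (?h l)"] by simp
  qed
  have "d * (\<integral>l. (cmod (?h l))\<^sup>2 \<partial>\<nu>) = (\<integral>l. d * (cmod (?h l))\<^sup>2 \<partial>\<nu>)" by simp
  also have "\<dots> \<le> (\<integral>l. Re (u * cnj (?h l)) \<partial>\<nu>)"
  proof (rule integral_mono_AE)
    show "integrable \<nu> (\<lambda>l. d * (cmod (?h l))\<^sup>2)" using int2 by (rule integrable_mult_right)
    show "integrable \<nu> (\<lambda>l. Re (u * cnj (?h l)))"
      by (intro integrable_Re integrable_mult_right integrable_cnj int)
    show "AE l in \<nu>. d * (cmod (?h l))\<^sup>2 \<le> Re (u * cnj (?h l))"
      using AE_nonneg
    proof eventually_elim
      case (elim l)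
      let ?w = "complex_of_real l - z"
      have w: "?w \<noteq> 0" using half_plane_diff(2)[OF u elim] d by auto
      have "u * cnj (?h l) = u * ?w / (complex_of_real ((cmod ?w)\<^sup>2))"
      proof -
        have "cnj (1 / W) = W / complex_of_real ((cmod W)\<^sup>2)" if "W \<noteq> 0" for W
          unfolding complex_norm_square using that by simp
        from this[OF w] show ?thesis by (simp only: times_divide_eq_right)
      qed
      hence "Re (u * cnj (?h l)) = Re (u * ?w) / (cmod ?w)\<^sup>2" by (simp only: Re_divide_of_real)
      moreover have "d / (cmod ?w)\<^sup>2 \<le> Re (u * ?w) / (cmod ?w)\<^sup>2"
        using half_plane_diff(1)[OF u elim] by (intro divide_right_mono) auto
      ultimately show ?case by (simp add: norm_divide power_divide)
    qed
  qed
  also have "\<dots> = Re (u * cnj f)" by (rule Reint[symmetric])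
  finally have key: "d * (\<integral>l. (cmod (?h l))\<^sup>2 \<partial>\<nu>) \<le> Re (u * cnj f)" .
  have jensen: "(cmod f)\<^sup>2 \<le> (\<integral>l. (cmod (?h l))\<^sup>2 \<partial>\<nu>)"
  proof -
    have "cmod f \<le> (\<integral>l. cmod (?h l) \<partial>\<nu>)" unfolding f_def by (rule integral_norm_bound)
    hence "(cmod f)\<^sup>2 \<le> (\<integral>l. cmod (?h l) \<partial>\<nu>)\<^sup>2" by (intro power_mono) auto
    also have "\<dots> \<le> (\<integral>l. (cmod (?h l))\<^sup>2 \<partial>\<nu>)"
      using variance_eq[of "\<lambda>l. cmod (?h l)"] variance_positive[of "\<lambda>l. cmod (?h l)"] int int2 by simp
    finally show ?thesis .
  qed
  have "(\<integral>l. (cmod (?h l))\<^sup>2 \<partial>\<nu>) \<noteq> 0"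
  proof
    assume "(\<integral>l. (cmod (?h l))\<^sup>2 \<partial>\<nu>) = 0"
    hence "AE l in \<nu>. (cmod (?h l))\<^sup>2 = 0"
      using integral_nonneg_eq_0_iff_AE[OF int2] by simp
    hence "AE l in \<nu>. False"
      using AE_nonneg
    proof eventually_elim
      case (elim l)
      thus ?case using half_plane_diff(2)[OF u, of l] d by auto
    qed
    thus False by simp
  qed
  moreover have "(\<integral>l. (cmod (?h l))\<^sup>2 \<partial>\<nu>) \<ge> 0" by (intro Bochner_Integration.integral_nonneg) simp
  ultimately have "(\<integral>l. (cmod (?h l))\<^sup>2 \<partial>\<nu>) > 0" by (metis order_le_less)
  hence "0 < d * (\<integral>l. (cmod (?h l))\<^sup>2 \<partial>\<nu>)" by (intro mult_pos_pos d)
  with key show f0: "f \<noteq> 0" by auto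
  have "d * (cmod f)\<^sup>2 \<le> Re (u * cnj f)"
    using key mult_left_mono[OF jensen, of d] d by linarith
  moreover have "Re (u / f) = Re (u * cnj f) / (cmod f)\<^sup>2"
    by (subst complex_div_cnj) (simp only: of_real_power[symmetric] Re_divide_of_real)
  ultimately show "d \<le> Re (u / f)" using f0 by (simp add: pos_le_divide_eq)
  have "Re (- (u * z * f)) = (\<integral>l. Re (- (u * z * ?h l)) \<partial>\<nu>)"
  proof -
    have "(\<integral>l. - (u * z * ?h l) \<partial>\<nu>) = - (u * z * f)"
      unfolding f_def by (simp only: integral_minus integral_mult_right_zero)
    moreover have "integrable \<nu> (\<lambda>l. - (u * z * ?h l))"
      using int by (intro Bochner_Integration.integrable_minus integrable_mult_right) simp
    ultimately show ?thesis using integral_Re[of \<nu> "\<lambda>l. - (u * z * ?h l)"] by simp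
  qed
  also have "\<dots> \<ge> 0"
  proof (rule integral_nonneg_AE)
    show "AE l in \<nu>. 0 \<le> Re (- (u * z * ?h l))"
      using AE_nonneg
    proof eventually_elim
      case (elim l)
      let ?w = "complex_of_real l - z"
      have "- (u * z * ?h l) = (- (u * z)) * cnj ?w / complex_of_real ((cmod ?w)\<^sup>2)"
        using complex_div_cnj[of "- (u * z)" ?w] by simp
      hence "Re (- (u * z * ?h l)) = Re ((- (u * z)) * cnj ?w) / (cmod ?w)\<^sup>2"
        by (simp only: Re_divide_of_real)
      moreover have "(- (u * z)) * cnj ?w = complex_of_real l * (- (u * z)) + u * complex_of_real ((cmod z)\<^sup>2)"
        unfolding complex_norm_square by (simp add: algebra_simps)
      hence "Re ((- (u * z)) * cnj ?w) = l * Re (- (u * z)) + Re u * (cmod z)\<^sup>2"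
        by (simp only: plus_complex.sel Re_times_real)
      ultimately show ?case using elim u d by simp
    qed
  qed
  finally show "0 \<le> Re (- (u * z * f))" .
qed

text \<open>With w = l - z, the difference quotient of the kernel minus its derivative is exactly h
  / ((w - h) w^2). For |h| < g / 2 this is at most 2 |h| / g^3 almost everywhere, so an explicit
  error bound takes the place of dominated convergence.\<close>

lemma transform_deriv:
  assumes z: "z \<notin> \<real>\<^sub>\<ge>\<^sub>0"
  shows "((\<lambda>z. \<integral>l. 1 / (complex_of_real l - z) \<partial>\<nu>) has_field_derivative
     (\<integral>l. 1 / (complex_of_real l - z)\<^sup>2 \<partial>\<nu>)) (at z)"
proof -
  let ?f = "\<lambda>z. \<integral>l. 1 / (complex_of_real l - z) \<partial>\<nu>"
  let ?D = "\<integral>l. 1 / (complex_of_real l - z)\<^sup>2 \<partial>\<nu>"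
  define g where "g = slit_gap z"
  have g: "g > 0" using slit_gap_pos[OF z] by (simp add: g_def)
  have "open (- \<real>\<^sub>\<ge>\<^sub>0 :: complex set)" by (simp add: open_Compl closed_nonneg_Reals_complex)
  then obtain e where e: "e > 0" "ball z e \<subseteq> - \<real>\<^sub>\<ge>\<^sub>0" using z by (meson ComplI open_contains_ball)
  have intD: "integrable \<nu> (\<lambda>l. 1 / (complex_of_real l - z)\<^sup>2)"
  proof (rule integrable_const_bound[where B = "1 / g\<^sup>2"])
    show "AE l in \<nu>. cmod (1 / (complex_of_real l - z)\<^sup>2) \<le> 1 / g\<^sup>2"
      using kernel_bound[of z]
    proof eventually_elim
      case (elim l)
      hence "g\<^sup>2 \<le> (cmod (complex_of_real l - z))\<^sup>2" using g by (intro power_mono) (auto simp: g_def)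
      thus ?case using g by (simp add: norm_divide norm_power frac_le)
    qed
  qed measurable
  have bound: "cmod ((?f (z + h) - ?f z) / h - ?D) \<le> cmod h * (2 / g ^ 3)"
    if h: "h \<noteq> 0" "cmod h < e" "cmod h < g / 2" for h
  proof -
    have "z + h \<in> ball z e" using h by (simp add: dist_norm)
    hence zh: "z + h \<notin> \<real>\<^sub>\<ge>\<^sub>0" using e by auto
    note i1 = kernel_integrable[OF zh] and i2 = kernel_integrable[OF z]
    let ?k = "\<lambda>l. (1 / (complex_of_real l - (z + h)) - 1 / (complex_of_real l - z)) / h - 1 / (complex_of_real l - z)\<^sup>2"
    have eq: "(?f (z + h) - ?f z) / h - ?D = (\<integral>l. ?k l \<partial>\<nu>)"
      using i1 i2 intD by simp
    have "cmod ((?f (z + h) - ?f z) / h - ?D) \<le> (\<integral>l. cmod (?k l) \<partial>\<nu>)"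
      unfolding eq by (rule integral_norm_bound)
    also have "\<dots> \<le> cmod h * (2 / g ^ 3)"
    proof (rule integral_le_const)
      show "integrable \<nu> (\<lambda>l. cmod (?k l))" using i1 i2 intD by simp
      show "AE l in \<nu>. cmod (?k l) \<le> cmod h * (2 / g ^ 3)"
        using kernel_bound[of z]
      proof eventually_elim
        case (elim l)
        let ?w = "complex_of_real l - z"
        have w: "g \<le> cmod ?w" using elim by (simp add: g_def)
        have "cmod ?w \<le> cmod (?w - h) + cmod h" using norm_triangle_ineq[of "?w - h" h] by simp
        hence wh: "g / 2 \<le> cmod (?w - h)" using w h by linarith
        have nz: "?w \<noteq> 0" "?w - h \<noteq> 0" using w wh g by auto
        have "?k l = (1 / (?w - h) - 1 / ?w) / h - 1 / ?w\<^sup>2" by (simp add: algebra_simps)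
        also have "\<dots> = h / ((?w - h) * ?w\<^sup>2)"
          using nz h by (simp add: divide_simps power2_eq_square)
        finally have "cmod (?k l) = cmod h / (cmod (?w - h) * (cmod ?w)\<^sup>2)"
          by (simp add: norm_divide norm_mult norm_power)
        also have "\<dots> \<le> cmod h / (g / 2 * g\<^sup>2)"
        proof (rule divide_left_mono)
          show "g / 2 * g\<^sup>2 \<le> cmod (?w - h) * (cmod ?w)\<^sup>2"
            using g w wh by (intro mult_mono power_mono) auto
          show "0 < cmod (?w - h) * (cmod ?w)\<^sup>2 * (g / 2 * g\<^sup>2)" using nz g by simp
        qed simp
        also have "\<dots> = cmod h * (2 / g ^ 3)" using g by (simp add: power2_eq_square power3_eq_cube)
        finally show ?case .
      qed
    qed
    finally show ?thesis .
  qed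
  have "((\<lambda>h. (?f (z + h) - ?f z) / h - ?D) \<longlongrightarrow> 0) (at 0)"
  proof (rule Lim_null_comparison)
    have "eventually (\<lambda>h. h \<noteq> 0 \<and> cmod h < e \<and> cmod h < g / 2) (at 0)"
      unfolding eventually_at using e g by (intro exI[of _ "min e (g / 2)"]) auto
    thus "eventually (\<lambda>h. cmod ((?f (z + h) - ?f z) / h - ?D) \<le> cmod h * (2 / g ^ 3)) (at 0)"
    proof eventually_elim
      case (elim h)
      thus ?case by (intro bound) auto
    qed
    show "((\<lambda>h. cmod h * (2 / g ^ 3)) \<longlongrightarrow> 0) (at 0)"
      by (rule tendsto_eq_intros refl | simp)+
  qed
  thus ?thesis unfolding DERIV_def by (simp add: LIM_zero_iff)
qed

end

lemma stieltjes_class_half_line: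
  assumes "f \<in> stieltjes_class"
  obtains \<nu> where "half_line_measure \<nu>" "\<And>z. z \<notin> \<real>\<^sub>\<ge>\<^sub>0 \<Longrightarrow> f z = (\<integral>l. 1 / (complex_of_real l - z) \<partial>\<nu>)"
  using assms unfolding stieltjes_class_def half_line_measure_def half_line_measure_axioms_def by blast

lemma stieltjes_class_half_plane:
  assumes f: "f \<in> stieltjes_class" and z: "z \<notin> \<real>\<^sub>\<ge>\<^sub>0"
    and u: "cmod u = 1" "0 \<le> Re u" "d \<le> Re (- (u * z))" "0 < d"
  shows "f z \<noteq> 0" "d \<le> Re (u / f z)" "0 \<le> Re (- (u * z * f z))"
proof -
  from stieltjes_class_half_line[OF f] obtain \<nu> where \<nu>: "half_line_measure \<nu>"
    and eq: "\<And>z. z \<notin> \<real>\<^sub>\<ge>\<^sub>0 \<Longrightarrow> f z = (\<integral>l. 1 / (complex_of_real l - z) \<partial>\<nu>)" by metis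
  show "f z \<noteq> 0" "d \<le> Re (u / f z)" "0 \<le> Re (- (u * z * f z))"
    unfolding eq[OF z] by (rule half_line_measure.transform_half_plane[OF \<nu> z u])+
qed

lemma stieltjes_class_nonzero: "f \<in> stieltjes_class \<Longrightarrow> z \<notin> \<real>\<^sub>\<ge>\<^sub>0 \<Longrightarrow> f z \<noteq> 0"
  using stieltjes_class_half_plane(1)[of f z] slit_rotation[of z] slit_gap_pos by metis

lemma stieltjes_class_holomorphic:
  assumes f: "f \<in> stieltjes_class"
  shows "f holomorphic_on - \<real>\<^sub>\<ge>\<^sub>0"
proof -
  from stieltjes_class_half_line[OF f] obtain \<nu> where \<nu>: "half_line_measure \<nu>"
    and eq: "\<And>z. z \<notin> \<real>\<^sub>\<ge>\<^sub>0 \<Longrightarrow> f z = (\<integral>l. 1 / (complex_of_real l - z) \<partial>\<nu>)" by metis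
  have "(\<lambda>z. \<integral>l. 1 / (complex_of_real l - z) \<partial>\<nu>) holomorphic_on - \<real>\<^sub>\<ge>\<^sub>0"
    unfolding holomorphic_on_open[OF open_Compl[OF closed_nonneg_Reals_complex]]
    using half_line_measure.transform_deriv[OF \<nu>] by blast
  thus ?thesis by (rule holomorphic_transform) (simp add: eq)
qed

text \<open>Supplies real positive weights of size at most 1/t, as \<open>posdef_wgram\<close>
  demands. The bounds are the half-plane estimate with trivial rotation.\<close>

lemma stieltjes_class_negative:
  assumes f: "f \<in> stieltjes_class" and t: "t > 0"
  obtains x where "0 < x" "x \<le> 1 / t" "f (- complex_of_real t) = complex_of_real x"
proof -
  from stieltjes_class_half_line[OF f] obtain \<nu> where \<nu>: "half_line_measure \<nu>"
    and eq: "\<And>z. z \<notin> \<real>\<^sub>\<ge>\<^sub>0 \<Longrightarrow> f z = (\<integral>l. 1 / (complex_of_real l - z) \<partial>\<nu>)" by metis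
  have z: "- complex_of_real t \<notin> \<real>\<^sub>\<ge>\<^sub>0" using t by (simp add: complex_nonneg_Reals_iff)
  define x where "x = (\<integral>l. 1 / (l + t) \<partial>\<nu>)"
  have "f (- complex_of_real t) = (\<integral>l. complex_of_real (1 / (l + t)) \<partial>\<nu>)"
    unfolding eq[OF z] by simp
  hence fx: "f (- complex_of_real t) = complex_of_real x" unfolding x_def integral_complex_of_real .
  have "Re (1 / complex_of_real x) \<ge> t" "x \<noteq> 0"
    using stieltjes_class_half_plane(1,2)[OF f z, of 1 t] t by (simp_all add: fx)
  hence *: "1 / x \<ge> t" by (simp add: Re_divide_of_real)
  hence "1 / x > 0" using t by linarith
  hence "x > 0" by simp
  moreover from this * t have "x \<le> 1 / t" by (simp add: field_simps)
  ultimately show ?thesis using that fx by blast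
qed

text \<open>The transform of the unit mass at 0. With all weights equal to it, \<open>T_mat\<close>
  is the resolvent, so holomorphy and bounds are proved once for both.\<close>

lemma neg_inverse_stieltjes: "(\<lambda>z. - 1 / z) \<in> stieltjes_class"
  unfolding stieltjes_class_def
proof (intro CollectI exI[of _ "return borel 0"] conjI allI impI)
  show "prob_space (return borel (0::real))" by (rule prob_space_return) simp
  show "measure (return borel (0::real)) {0..} = 1" by (simp add: measure_return)
  show "- 1 / z = (\<integral>l. 1 / (complex_of_real l - z) \<partial>return borel 0)" for z
    by (subst integral_return) auto
qed simp

section \<open>Coercivity, uniform bounds and holomorphy of T off the half line\<close>

lemma
  fixes B :: "nat \<Rightarrow> nat \<Rightarrow> complex"
  assumes d: "0 < d"
    and c: "\<And>v. d * (\<Sum>i<N. (cmod (v i))\<^sup>2) \<le> Re (u * (\<Sum>i<N. cnj (v i) * (\<Sum>k<N. B i k * v k)))"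
  shows coercive_det: "Determinant.det (sqmat N B) \<noteq> 0"
    and coercive_minv_diag: "cmod u = 1 \<Longrightarrow> i < N \<Longrightarrow> cmod (minv N B i i) \<le> 1 / d"
proof -
  show det: "Determinant.det (sqmat N B) \<noteq> 0"
  proof (rule det_sqmat_nonzero)
    fix v assume "\<And>i. i < N \<Longrightarrow> (\<Sum>k<N. B i k * v k) = 0"
    hence "d * (\<Sum>i<N. (cmod (v i))\<^sup>2) \<le> 0" using c[of v] by simp
    hence "(\<Sum>i<N. (cmod (v i))\<^sup>2) \<le> 0" using d by (simp add: mult_le_0_iff)
    hence "\<forall>i\<in>{..<N}. (cmod (v i))\<^sup>2 = 0"
      by (subst sum_nonneg_eq_0_iff[symmetric]) (auto intro!: antisym sum_nonneg)
    thus "\<forall>i<N. v i = 0" by auto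
  qed
  assume u: "cmod u = 1" and i: "i < N"
  \<comment> \<open>Column i of the inverse. Coercivity tested on it gives d |v|^2 <= |v i|, and |v
    i|^2 <= |v|^2 closes the bound.\<close>
  define v where "v = (\<lambda>k. minv N B k i)"
  have Bv: "(\<Sum>k<N. B l k * v k) = (if l = i then 1 else 0)" if "l < N" for l
    unfolding v_def by (rule minv_right[OF det that i])
  have "(\<Sum>l<N. cnj (v l) * (\<Sum>k<N. B l k * v k)) = (\<Sum>l<N. if l = i then cnj (v l) else 0)"
    by (intro sum.cong) (auto simp: Bv)
  also have "\<dots> = cnj (v i)" using i by simp
  finally have "d * (\<Sum>l<N. (cmod (v l))\<^sup>2) \<le> Re (u * cnj (v i))" using c[of v] by simp
  also have "\<dots> \<le> cmod (u * cnj (v i))" by (rule complex_Re_le_cmod)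
  also have "\<dots> = cmod (v i)" using u by (simp add: norm_mult)
  finally have 1: "d * (\<Sum>l<N. (cmod (v l))\<^sup>2) \<le> cmod (v i)" .
  have "(cmod (v i))\<^sup>2 \<le> (\<Sum>l<N. (cmod (v l))\<^sup>2)"
    using i by (intro member_le_sum) auto
  hence "d * (cmod (v i) * cmod (v i)) \<le> cmod (v i)"
    using 1 mult_left_mono[of "(cmod (v i))\<^sup>2" _ d] d by (simp add: power2_eq_square) (meson less_imp_le mult_left_mono order_trans)
  hence "d * cmod (v i) \<le> 1" by (cases "v i = 0") (auto simp: mult_le_cancel_right)
  thus "cmod (minv N B i i) \<le> 1 / d" using d by (simp add: v_def field_simps)
qed

text \<open>The complex counterpart of \<open>wgram\<close>, to which it reduces at z = -t when the
  weights are real there.\<close>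

definition cwgram :: "nat \<Rightarrow> (nat \<Rightarrow> nat \<Rightarrow> real) \<Rightarrow> (nat \<Rightarrow> complex \<Rightarrow> complex) \<Rightarrow> (nat \<Rightarrow> complex \<Rightarrow> complex) \<Rightarrow>
    complex \<Rightarrow> nat \<Rightarrow> nat \<Rightarrow> complex" where
  "cwgram n A \<psi> \<psi>' z i k = (if i = k then 1 / \<psi> i z else 0)
     - z * (\<Sum>j<n. complex_of_real (A i j) * \<psi>' j z * complex_of_real (A k j))"

text \<open>With w = A^T v the rotated form is a sum of u / \<psi> i z times |v i|^2 and of -u z
  \<psi>' j z times |w j|^2. The first has real part at least d |v|^2, the second a nonnegative one,
  by \<open>stieltjes_class_half_plane\<close>.\<close>

lemma cwgram_coercive:
  assumes \<psi>: "\<And>i. i < N \<Longrightarrow> \<psi> i \<in> stieltjes_class" and \<psi>': "\<And>j. j < n \<Longrightarrow> \<psi>' j \<in> stieltjes_class"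
    and z: "z \<notin> \<real>\<^sub>\<ge>\<^sub>0" and u: "cmod u = 1" "0 \<le> Re u" "d \<le> Re (- (u * z))" "0 < d"
  shows "d * (\<Sum>i<N. (cmod (v i))\<^sup>2) \<le> Re (u * (\<Sum>i<N. cnj (v i) * (\<Sum>k<N. cwgram n A \<psi> \<psi>' z i k * v k)))"
proof -
  define w where "w = (\<lambda>j. \<Sum>i<N. complex_of_real (A i j) * v i)"
  have app: "(\<Sum>k<N. cwgram n A \<psi> \<psi>' z i k * v k) = v i / \<psi> i z - z * (\<Sum>j<n. complex_of_real (A i j) * \<psi>' j z * w j)"
    if "i < N" for i
  proof -
    have "(\<Sum>k<N. (\<Sum>j<n. complex_of_real (A i j) * \<psi>' j z * complex_of_real (A k j)) * v k) =
        (\<Sum>k<N. \<Sum>j<n. complex_of_real (A i j) * \<psi>' j z * (complex_of_real (A k j) * v k))"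
      by (simp add: sum_distrib_right mult.assoc)
    also have "\<dots> = (\<Sum>j<n. \<Sum>k<N. complex_of_real (A i j) * \<psi>' j z * (complex_of_real (A k j) * v k))"
      by (rule sum.swap)
    also have "\<dots> = (\<Sum>j<n. complex_of_real (A i j) * \<psi>' j z * w j)"
      by (simp add: w_def sum_distrib_left)
    finally have e: "(\<Sum>k<N. (\<Sum>j<n. complex_of_real (A i j) * \<psi>' j z * complex_of_real (A k j)) * v k) =
        (\<Sum>j<n. complex_of_real (A i j) * \<psi>' j z * w j)" .
    have "(\<Sum>k<N. cwgram n A \<psi> \<psi>' z i k * v k) = (\<Sum>k<N. (if i = k then 1 / \<psi> i z else 0) * v k)
       - z * (\<Sum>k<N. (\<Sum>j<n. complex_of_real (A i j) * \<psi>' j z * complex_of_real (A k j)) * v k)"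
    proof -
      have "(\<Sum>k<N. (a k - z * X k) * v k) = (\<Sum>k<N. a k * v k) - z * (\<Sum>k<N. X k * v k)" for a X
        by (simp add: left_diff_distrib sum_subtractf sum_distrib_left mult.assoc)
      thus ?thesis unfolding cwgram_def .
    qed
    also have "(\<Sum>k<N. (if i = k then 1 / \<psi> i z else 0) * v k) = v i / \<psi> i z"
      using that by (simp add: if_distrib[of "\<lambda>x. x * _"] cong: if_cong)
    finally show ?thesis unfolding e .
  qed
  have "(\<Sum>i<N. cnj (v i) * (\<Sum>j<n. complex_of_real (A i j) * \<psi>' j z * w j)) =
      (\<Sum>i<N. \<Sum>j<n. cnj (v i) * (complex_of_real (A i j) * \<psi>' j z * w j))"
    by (simp add: sum_distrib_left)
  also have "\<dots> = (\<Sum>j<n. \<Sum>i<N. cnj (v i) * (complex_of_real (A i j) * \<psi>' j z * w j))" by (rule sum.swap)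
  also have "\<dots> = (\<Sum>j<n. cnj (w j) * \<psi>' j z * w j)"
  proof (intro sum.cong refl)
    fix j
    have "cnj (w j) = (\<Sum>i<N. cnj (v i) * complex_of_real (A i j))"
      by (simp add: w_def mult.commute)
    thus "(\<Sum>i<N. cnj (v i) * (complex_of_real (A i j) * \<psi>' j z * w j)) = cnj (w j) * \<psi>' j z * w j"
      by (simp add: sum_distrib_right mult.assoc)
  qed
  finally have quad: "(\<Sum>i<N. cnj (v i) * (\<Sum>j<n. complex_of_real (A i j) * \<psi>' j z * w j)) =
      (\<Sum>j<n. cnj (w j) * \<psi>' j z * w j)" .
  have sq: "cnj y * x * y = x * complex_of_real ((cmod y)\<^sup>2)" for x y :: complex
    unfolding complex_norm_square by (simp add: mult_ac)
  have "u * (\<Sum>i<N. cnj (v i) * (\<Sum>k<N. cwgram n A \<psi> \<psi>' z i k * v k)) =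
     u * (\<Sum>i<N. cnj (v i) * (v i / \<psi> i z)) - u * z * (\<Sum>i<N. cnj (v i) * (\<Sum>j<n. complex_of_real (A i j) * \<psi>' j z * w j))"
  proof -
    have g: "(\<Sum>i<N. c i * (X i - z * Y i)) = (\<Sum>i<N. c i * X i) - z * (\<Sum>i<N. c i * Y i)" for c X Y
      by (simp add: right_diff_distrib sum_subtractf sum_distrib_left mult.left_commute)
    have e: "(\<Sum>i<N. cnj (v i) * (\<Sum>k<N. cwgram n A \<psi> \<psi>' z i k * v k)) =
        (\<Sum>i<N. cnj (v i) * (v i / \<psi> i z - z * (\<Sum>j<n. complex_of_real (A i j) * \<psi>' j z * w j)))"
      by (intro sum.cong refl) (simp only: app lessThan_iff)
    show ?thesis unfolding e g by (simp add: right_diff_distrib mult.assoc)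
  qed
  also have "\<dots> = (\<Sum>i<N. u / \<psi> i z * complex_of_real ((cmod (v i))\<^sup>2))
      + (\<Sum>j<n. - (u * z * \<psi>' j z) * complex_of_real ((cmod (w j))\<^sup>2))"
    unfolding quad sq[symmetric] by (simp add: sum_distrib_left sum_negf mult_ac)
  finally have "Re (u * (\<Sum>i<N. cnj (v i) * (\<Sum>k<N. cwgram n A \<psi> \<psi>' z i k * v k))) =
      (\<Sum>i<N. Re (u / \<psi> i z) * (cmod (v i))\<^sup>2) + (\<Sum>j<n. Re (- (u * z * \<psi>' j z)) * (cmod (w j))\<^sup>2)"
    by (simp only: plus_complex.sel Re_sum Re_times_real)
  moreover have "d * (\<Sum>i<N. (cmod (v i))\<^sup>2) \<le> (\<Sum>i<N. Re (u / \<psi> i z) * (cmod (v i))\<^sup>2)"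
    unfolding sum_distrib_left
    by (intro sum_mono mult_right_mono stieltjes_class_half_plane(2)[OF \<psi> z u]) auto
  moreover have "0 \<le> (\<Sum>j<n. Re (- (u * z * \<psi>' j z)) * (cmod (w j))\<^sup>2)"
    by (intro sum_nonneg mult_nonneg_nonneg stieltjes_class_half_plane(3)[OF \<psi>' z u]) auto
  ultimately show ?thesis by linarith
qed

text \<open>The bound depends on z alone, not on A, the weights or the dimension. This uniformity is
  the local boundedness needed for normal families.\<close>

lemma
  assumes \<psi>: "\<And>i. i < N \<Longrightarrow> \<psi> i \<in> stieltjes_class" and \<psi>': "\<And>j. j < n \<Longrightarrow> \<psi>' j \<in> stieltjes_class"
    and z: "z \<notin> \<real>\<^sub>\<ge>\<^sub>0"
  shows cwgram_det: "Determinant.det (sqmat N (cwgram n A \<psi> \<psi>' z)) \<noteq> 0"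
    and cwgram_minv_diag: "i < N \<Longrightarrow> cmod (minv N (cwgram n A \<psi> \<psi>' z) i i) \<le> 1 / slit_gap z"
proof -
  obtain u where u: "cmod u = 1" "0 \<le> Re u" "slit_gap z \<le> Re (- (u * z))" by (rule slit_rotation)
  note g = slit_gap_pos[OF z]
  show "Determinant.det (sqmat N (cwgram n A \<psi> \<psi>' z)) \<noteq> 0"
    by (rule coercive_det[OF g cwgram_coercive[OF \<psi> \<psi>' z u g]])
  show "i < N \<Longrightarrow> cmod (minv N (cwgram n A \<psi> \<psi>' z) i i) \<le> 1 / slit_gap z"
    by (rule coercive_minv_diag[OF g cwgram_coercive[OF \<psi> \<psi>' z u g] u(1)])
qed

lemma T_mat_eq:
  assumes A: "A \<in> carrier_mat N n" and \<psi>: "\<And>i. i < N \<Longrightarrow> \<psi> i z \<noteq> 0"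
  shows "T_mat N n A \<psi> \<psi>' z = mat_inv (sqmat N (cwgram n (\<lambda>i j. A $$ (i, j)) \<psi> \<psi>' z))"
proof -
  have inv: "mat_inv (mat_diag N (\<lambda>i. \<psi> i z)) = mat_diag N (\<lambda>i. 1 / \<psi> i z)"
  proof (rule mat_inv_eqI[of _ N])
    show "mat_diag N (\<lambda>i. \<psi> i z) * mat_diag N (\<lambda>i. 1 / \<psi> i z) = 1\<^sub>m N"
      unfolding mat_diag_diag by (auto simp: mat_diag_def \<psi> intro!: eq_matI)
  qed auto
  have "(cmat A * mat_diag n (\<lambda>j. \<psi>' j z) * transpose_mat (cmat A)) $$ (i, k) =
      (\<Sum>j<n. complex_of_real (A $$ (i, j)) * \<psi>' j z * complex_of_real (A $$ (k, j)))" if "i < N" "k < N" for i k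
    using that A by (simp add: mat_diag_mult_right[of _ N] scalar_prod_def atLeast0LessThan)
  hence "mat_diag N (\<lambda>i. 1 / \<psi> i z) - z \<cdot>\<^sub>m (cmat A * mat_diag n (\<lambda>j. \<psi>' j z) * transpose_mat (cmat A))
     = sqmat N (cwgram n (\<lambda>i j. A $$ (i, j)) \<psi> \<psi>' z)"
    using A by (intro eq_matI) (auto simp: cwgram_def mat_diag_def)
  thus ?thesis by (simp add: T_mat_def inv)
qed

lemma T'_mat_eq_T_mat: "T'_mat N n A \<psi> \<psi>' = T_mat n N (transpose_mat A) \<psi>' \<psi>"
proof -
  have "cmat (transpose_mat A) = transpose_mat (cmat A)" by (intro eq_matI) auto
  thus ?thesis by (auto simp: T'_mat_def T_mat_def)
qed

lemma resolvent_eq_T_mat: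
  assumes S: "S \<in> carrier_mat N n" and z: "z \<noteq> 0"
  shows "resolvent S z = T_mat N n S (\<lambda>_ z. - 1 / z) (\<lambda>_ z. - 1 / z) z"
proof -
  have "(\<Sum>j<n. complex_of_real (S $$ (i, j)) * (- 1 / z) * complex_of_real (S $$ (k, j))) =
      - (\<Sum>j<n. complex_of_real (S $$ (i, j) * S $$ (k, j))) / z" for i k
    by (simp add: sum_negf sum_divide_distrib)
  hence "cmat (S * transpose_mat S) - z \<cdot>\<^sub>m 1\<^sub>m (dim_row S) =
      sqmat N (cwgram n (\<lambda>i j. S $$ (i, j)) (\<lambda>_ z. - 1 / z) (\<lambda>_ z. - 1 / z) z)"
    using S z by (intro eq_matI) (auto simp: cwgram_def scalar_prod_def atLeast0LessThan)
  thus ?thesis using z by (simp add: resolvent_def T_mat_eq[OF S])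
qed

lemma co_resolvent_eq_resolvent: "co_resolvent S z = resolvent (transpose_mat S) z"
  by (simp add: co_resolvent_def resolvent_def)

context
  fixes N n :: nat and A :: "real mat" and \<psi> \<psi>' :: "nat \<Rightarrow> complex \<Rightarrow> complex"
  assumes A: "A \<in> carrier_mat N n"
    and \<psi>: "\<And>i. i < N \<Longrightarrow> \<psi> i \<in> stieltjes_class" and \<psi>': "\<And>j. j < n \<Longrightarrow> \<psi>' j \<in> stieltjes_class"
begin

lemma T_mat_diag:
  assumes "z \<notin> \<real>\<^sub>\<ge>\<^sub>0" "i < N"
  shows "T_mat N n A \<psi> \<psi>' z $$ (i, i) = minv N (cwgram n (\<lambda>i j. A $$ (i, j)) \<psi> \<psi>' z) i i"
  using assms by (simp add: T_mat_eq[OF A] stieltjes_class_nonzero[OF \<psi>] minv_def)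

lemma T_mat_carrier:
  assumes "z \<notin> \<real>\<^sub>\<ge>\<^sub>0"
  shows "T_mat N n A \<psi> \<psi>' z \<in> carrier_mat N N"
  using mat_inv_works(1)[OF _ cwgram_det[OF \<psi> \<psi>' assms]] assms
  by (simp add: T_mat_eq[OF A] stieltjes_class_nonzero[OF \<psi>])

lemma T_mat_trace:
  assumes "z \<notin> \<real>\<^sub>\<ge>\<^sub>0"
  shows "mat_trace (T_mat N n A \<psi> \<psi>' z) = (\<Sum>i<N. minv N (cwgram n (\<lambda>i j. A $$ (i, j)) \<psi> \<psi>' z) i i)"
  using T_mat_carrier[OF assms] by (simp add: mat_trace_def T_mat_diag[OF assms])

lemma T_mat_trace_bound:
  assumes "z \<notin> \<real>\<^sub>\<ge>\<^sub>0"
  shows "cmod (mat_trace (T_mat N n A \<psi> \<psi>' z)) \<le> real N / slit_gap z"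
proof -
  have "cmod (mat_trace (T_mat N n A \<psi> \<psi>' z)) \<le> (\<Sum>i<N. 1 / slit_gap z)"
    unfolding T_mat_trace[OF assms]
    by (intro order_trans[OF norm_sum] sum_mono cwgram_minv_diag[OF \<psi> \<psi>' assms]) auto
  thus ?thesis by simp
qed

lemma T_mat_trace_holomorphic: "(\<lambda>z. mat_trace (T_mat N n A \<psi> \<psi>' z)) holomorphic_on - \<real>\<^sub>\<ge>\<^sub>0"
proof -
  have "(\<lambda>z. \<Sum>i<N. minv N (cwgram n (\<lambda>i j. A $$ (i, j)) \<psi> \<psi>' z) i i) holomorphic_on - \<real>\<^sub>\<ge>\<^sub>0"
  proof (intro holomorphic_on_sum minv_holomorphic)
    show "Determinant.det (sqmat N (cwgram n (\<lambda>i j. A $$ (i, j)) \<psi> \<psi>' z)) \<noteq> 0" if "z \<in> - \<real>\<^sub>\<ge>\<^sub>0" for z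
      using cwgram_det[OF \<psi> \<psi>'] that by simp
    have d: "(\<lambda>z. if i = k then 1 / \<psi> i z else 0) holomorphic_on - \<real>\<^sub>\<ge>\<^sub>0" if "i < N" for i k
      using stieltjes_class_holomorphic[OF \<psi>[OF that]] stieltjes_class_nonzero[OF \<psi>[OF that]]
      by (cases "i = k") (auto intro!: holomorphic_intros)
    show "(\<lambda>z. cwgram n (\<lambda>i j. A $$ (i, j)) \<psi> \<psi>' z i k) holomorphic_on - \<real>\<^sub>\<ge>\<^sub>0" if "i < N" "k < N" for i k
      unfolding cwgram_def
      by (intro holomorphic_on_diff d that holomorphic_on_mult holomorphic_on_sum holomorphic_on_const
          holomorphic_on_ident stieltjes_class_holomorphic \<psi>') auto
  qed auto
  thus ?thesis by (rule holomorphic_transform) (simp add: T_mat_trace)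
qed

lemma T_mat_diag_negative:
  assumes t: "t > 0" and b: "\<And>i. i < N \<Longrightarrow> \<psi> i (- complex_of_real t) = complex_of_real (b i)"
    and b': "\<And>j. j < n \<Longrightarrow> \<psi>' j (- complex_of_real t) = complex_of_real (b' j)"
    and bpos: "\<And>i. i < N \<Longrightarrow> 0 < b i \<and> b i \<le> 1 / t" and b'pos: "\<And>j. j < n \<Longrightarrow> 0 < b' j"
    and i: "i < N"
  shows "minv N (cwgram n (\<lambda>i j. A $$ (i, j)) \<psi> \<psi>' (- complex_of_real t)) i i =
    complex_of_real (minv N (wgram n (\<lambda>i j. A $$ (i, j)) t b b') i i)"
proof (rule minv_entries[where C = "\<lambda>i k. complex_of_real (minv N (wgram n (\<lambda>i j. A $$ (i, j)) t b b') i k)"])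
  let ?W = "wgram n (\<lambda>i j. A $$ (i, j)) t b b'"
  have W: "posdef t N ?W" using bpos b'pos by (intro posdef_wgram t) (auto intro: less_imp_le)
  fix i l assume il: "i < N" "l < N"
  have "(\<Sum>k<N. cwgram n (\<lambda>i j. A $$ (i, j)) \<psi> \<psi>' (- complex_of_real t) i k * complex_of_real (minv N ?W k l))
     = complex_of_real (\<Sum>k<N. ?W i k * minv N ?W k l)"
    unfolding of_real_sum of_real_mult
  proof (intro sum.cong refl arg_cong2[where f = "(*)"])
    fix k assume "k \<in> {..<N}"
    show "cwgram n (\<lambda>i j. A $$ (i, j)) \<psi> \<psi>' (- complex_of_real t) i k = complex_of_real (?W i k)"
      using il by (auto simp: cwgram_def wgram_def b b' sum_distrib_left sum_negf intro!: sum.cong)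
  qed
  thus "(\<Sum>k<N. cwgram n (\<lambda>i j. A $$ (i, j)) \<psi> \<psi>' (- complex_of_real t) i k * complex_of_real (minv N ?W k l))
     = (if i = l then 1 else 0)"
    using minv_right[OF posdef_det[OF W] il] by simp
qed (use i in auto)

end

text \<open>Were convergence to fail at z, a subsequence would stay away from 0 there, and Montel's
  theorem would extract a locally uniform limit g from it. But g vanishes at points accumulating at
  -t0 inside the connected slit plane, hence everywhere.\<close>

lemma vitali_slit_plane:
  fixes f :: "nat \<Rightarrow> complex \<Rightarrow> complex" and c t0 :: real
  assumes hol: "\<And>n. f n holomorphic_on - \<real>\<^sub>\<ge>\<^sub>0"
    and bd: "\<And>n z. z \<notin> \<real>\<^sub>\<ge>\<^sub>0 \<Longrightarrow> cmod (f n z) \<le> c / slit_gap z"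
    and t0: "t0 > 0"
    and lim: "\<And>k. (\<lambda>n. f n (- complex_of_real (t0 + 1 / real (Suc k)))) \<longlonglongrightarrow> 0"
    and z: "z \<notin> \<real>\<^sub>\<ge>\<^sub>0"
  shows "(\<lambda>n. f n z) \<longlonglongrightarrow> 0"
proof (rule ccontr)
  let ?U = "- \<real>\<^sub>\<ge>\<^sub>0 :: complex set"
  assume "\<not> (\<lambda>n. f n z) \<longlonglongrightarrow> 0"
  then obtain e where e: "e > 0" "\<And>n0. \<exists>n\<ge>n0. \<not> cmod (f n z) < e"
    unfolding LIMSEQ_iff by auto
  obtain s :: "nat \<Rightarrow> nat" where s: "strict_mono s" "\<And>n. \<not> cmod (f (s n) z) < e"
  proof -
    have "infinite {n. \<not> cmod (f n z) < e}"
      unfolding infinite_nat_iff_unbounded_le using e(2) by auto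
    from infinite_enumerate[OF this] that show ?thesis by auto
  qed
  have U: "open ?U" by (simp add: open_Compl closed_nonneg_Reals_complex)
  have conn: "connected ?U"
  proof -
    have "(\<real>\<^sub>\<ge>\<^sub>0 :: complex set) = complex_of_real ` {0..}" by (auto simp: nonneg_Reals_def)
    thus ?thesis using starlike_imp_connected[OF starlike_slotted_complex_plane_right[of 0]] by simp
  qed
  obtain g r where g: "g holomorphic_on ?U" "strict_mono (r :: nat \<Rightarrow> nat)"
    and gl: "\<And>x. x \<in> ?U \<Longrightarrow> ((\<lambda>n. f (s (r n)) x) \<longlongrightarrow> g x) sequentially"
  proof (rule Montel[OF U, of "range (\<lambda>n. f (s n))" "\<lambda>n. f (s n)"])
    show "h holomorphic_on ?U" if "h \<in> range (\<lambda>n. f (s n))" for h using that hol by auto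
    show "\<exists>B. \<forall>h\<in>range (\<lambda>n. f (s n)). \<forall>z\<in>K. cmod (h z) \<le> B" if K: "compact K" "K \<subseteq> ?U" for K
    proof (cases "K = {}")
      case False
      have "continuous_on K (\<lambda>z. c / slit_gap z)"
        unfolding slit_gap_def
        using K slit_gap_pos unfolding slit_gap_def by (intro continuous_intros) force
      from continuous_attains_sup[OF K(1) False this] obtain x where "\<forall>y\<in>K. c / slit_gap y \<le> c / slit_gap x" by auto
      hence "cmod (f n y) \<le> c / slit_gap x" if "y \<in> K" for n y using that bd[of y n] K by force
      thus ?thesis by blast
    qed auto
  qed (use that in auto)
  let ?\<xi> = "- complex_of_real t0"
  let ?w = "\<lambda>k. - complex_of_real (t0 + 1 / real (Suc k))"
  have wU: "?w k \<in> ?U" for k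
  proof -
    have "t0 + 1 / real (Suc k) > 0" using t0 by (intro add_pos_nonneg) auto
    thus ?thesis by (simp add: complex_nonneg_Reals_iff)
  qed
  have g0: "g (?w k) = 0" for k
  proof (rule LIMSEQ_unique[OF gl[OF wU]])
    have "strict_mono (s \<circ> r)" using s(1) g(2) by (rule strict_mono_o)
    from LIMSEQ_subseq_LIMSEQ[OF lim this] show "(\<lambda>n. f (s (r n)) (?w k)) \<longlonglongrightarrow> 0" by (simp add: o_def)
  qed
  have lp: "?\<xi> islimpt range ?w"
    unfolding islimpt_sequential
  proof (intro exI conjI allI)
    show "?w k \<in> range ?w - {?\<xi>}" for k by (auto simp: complex_eq_iff)
    have "(\<lambda>k. t0 + 1 / real (Suc k)) \<longlonglongrightarrow> t0 + 0"
      by (intro tendsto_intros LIMSEQ_Suc[OF lim_1_over_n])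
    hence "(\<lambda>k. complex_of_real (t0 + 1 / real (Suc k))) \<longlonglongrightarrow> complex_of_real (t0 + 0)" by (rule tendsto_of_real)
    thus "?w \<longlonglongrightarrow> ?\<xi>" using tendsto_minus by fastforce
  qed
  have "g z = 0"
  proof (rule analytic_continuation[OF g(1) U conn _ _ lp])
    show "range ?w \<subseteq> ?U" using wU by auto
    show "?\<xi> \<in> ?U" using t0 by (simp add: complex_nonneg_Reals_iff)
    show "z \<in> ?U" using z by simp
  qed (use g0 in auto)
  with gl[of z] z have "(\<lambda>n. f (s (r n)) z) \<longlonglongrightarrow> 0" by simp
  then obtain n where "cmod (f (s (r n)) z) < e" using e(1) unfolding LIMSEQ_iff by fastforce
  with s(2) show False by blast
qed

section \<open>Almost sure convergence\<close>

text \<open>The series of fourth powers has finite expectation, so it converges almost surely and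
  its terms tend to 0.\<close>

lemma AE_tendsto_zero_fourth_moments:
  fixes Z :: "nat \<Rightarrow> 'a \<Rightarrow> real"
  assumes meas: "\<And>n. Z n \<in> borel_measurable M"
    and le: "\<And>n. (\<integral>\<^sup>+\<omega>. ennreal ((Z n \<omega>) ^ 4) \<partial>M) \<le> ennreal (b n)"
    and b: "\<And>n. 0 \<le> b n" "summable b"
  shows "AE \<omega> in M. (\<lambda>n. Z n \<omega>) \<longlonglongrightarrow> 0"
proof -
  have [measurable]: "Z n \<in> borel_measurable M" for n by (rule meas)
  have "(\<integral>\<^sup>+\<omega>. (\<Sum>n. ennreal ((Z n \<omega>) ^ 4)) \<partial>M) = (\<Sum>n. \<integral>\<^sup>+\<omega>. ennreal ((Z n \<omega>) ^ 4) \<partial>M)"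
    by (rule nn_integral_suminf) measurable
  also have "\<dots> \<le> (\<Sum>n. ennreal (b n))" by (intro suminf_le le) auto
  also have "\<dots> = ennreal (\<Sum>n. b n)" using b by (intro suminf_ennreal2) auto
  finally have "(\<integral>\<^sup>+\<omega>. (\<Sum>n. ennreal ((Z n \<omega>) ^ 4)) \<partial>M) \<noteq> \<infinity>"
    using ennreal_less_top by (metis infinity_ennreal_def leD top_greatest order_le_less)
  hence "AE \<omega> in M. (\<Sum>n. ennreal ((Z n \<omega>) ^ 4)) \<noteq> \<infinity>"
    by (intro nn_integral_PInf_AE) measurable
  thus ?thesis
  proof eventually_elim
    case (elim \<omega>)
    hence "summable (\<lambda>n. (Z n \<omega>) ^ 4)" by (intro summable_suminf_not_top) auto
    hence "(\<lambda>n. (Z n \<omega>) ^ 4) \<longlonglongrightarrow> 0" by (rule summable_LIMSEQ_zero)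
    thus ?case by (simp add: power_tendsto_0_iff)
  qed
qed

text \<open>Moves the estimates from the product space to a sample space on which the entries are
  given. The centre E is the expectation on the product space; it is hidden behind a quantifier so
  that users see only matrices and the sample.\<close>

lemma (in two_sided_model) sample_estimates:
  fixes X :: "nat \<Rightarrow> nat \<Rightarrow> 'b \<Rightarrow> real"
  assumes x: "x \<in> measurable M P" and distr: "distr M P x = P"
    and X: "\<And>i j \<omega>. i < N \<Longrightarrow> j < n \<Longrightarrow> x \<omega> (i, j) = X i j \<omega>"
    and big: "\<kappa> * s * (2 + \<kappa> * s / t) / t \<le> 1 / 2"
    and \<tau>0: "\<And>j. j < n \<Longrightarrow> 0 \<le> \<tau> j" and \<tau>'0: "\<And>i. i < N \<Longrightarrow> 0 \<le> \<tau>' i"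
    and \<tau>: "\<And>j. j < n \<Longrightarrow> \<tau> j = (\<Sum>i<N. (r i j)\<^sup>2 * minv N (wgram n A t (weight t \<tau>') (weight t \<tau>)) i i)"
    and \<tau>': "\<And>i. i < N \<Longrightarrow> \<tau>' i = (\<Sum>j<n. (r i j)\<^sup>2 * minv n (wgram N (transp A) t (weight t \<tau>) (weight t \<tau>')) j j)"
  defines "trQ \<equiv> \<lambda>\<omega>. \<Sum>i<N. minv N (gram n (\<lambda>i j. r i j * X i j \<omega> + A i j) t) i i"
    and "trq \<equiv> \<lambda>\<omega>. \<Sum>j<n. minv n (gram N (\<lambda>j i. r i j * X i j \<omega> + A i j) t) j j"
  shows "trQ \<in> borel_measurable M" "trq \<in> borel_measurable M"
    and "\<exists>E. (\<integral>\<^sup>+\<omega>. ennreal ((trQ \<omega> - E) ^ 4) \<partial>M) \<le> ennreal (100 * (2 / t) ^ 4 * (\<kappa> * m)\<^sup>2) \<and>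
      \<bar>E - (\<Sum>i<N. minv N (wgram n A t (weight t \<tau>') (weight t \<tau>)) i i)\<bar> \<le> 2 * t * \<kappa> * bracket_const * sqrt m"
    and "\<exists>E. (\<integral>\<^sup>+\<omega>. ennreal ((trq \<omega> - E) ^ 4) \<partial>M) \<le> ennreal (100 * (2 / t) ^ 4 * (\<kappa> * m)\<^sup>2) \<and>
      \<bar>E - (\<Sum>j<n. minv n (wgram N (transp A) t (weight t \<tau>) (weight t \<tau>')) j j)\<bar> \<le> 2 * t * \<kappa> * bracket_const * sqrt m"
proof -
  have Q: "trQ \<omega> = (\<Sum>i<N. Q (x \<omega>) i i)" for \<omega>
    unfolding trQ_def Q_def
    by (intro sum.cong refl fun_cong[OF fun_cong[OF minv_cong]])
       (auto simp: gram_def S_def X intro!: sum.cong)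
  have q: "trq \<omega> = (\<Sum>j<n. q (x \<omega>) j)" for \<omega>
    unfolding trq_def q_def
    by (intro sum.cong refl fun_cong[OF fun_cong[OF minv_cong]])
       (auto simp: gram_def S_def X intro!: sum.cong)
  have mQ: "(\<lambda>x. \<Sum>i<N. Q x i i) \<in> borel_measurable P" and mq: "(\<lambda>x. \<Sum>j<n. q x j) \<in> borel_measurable P"
    by (auto intro!: borel_measurable_sum Q_measurable q_measurable)
  show "trQ \<in> borel_measurable M" "trq \<in> borel_measurable M"
    unfolding Q q using measurable_compose[OF x mQ] measurable_compose[OF x mq] by simp_all
  have transfer: "(\<integral>\<^sup>+\<omega>. ennreal ((f (x \<omega>) - E) ^ 4) \<partial>M) = (\<integral>\<^sup>+x. ennreal ((f x - E) ^ 4) \<partial>P)"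
    if [measurable]: "f \<in> borel_measurable P" for f E
  proof -
    have "(\<integral>\<^sup>+x. ennreal ((f x - E) ^ 4) \<partial>distr M P x) = (\<integral>\<^sup>+\<omega>. ennreal ((f (x \<omega>) - E) ^ 4) \<partial>M)"
      by (rule nn_integral_distr[OF x]) measurable
    thus ?thesis by (simp add: distr)
  qed
  show "\<exists>E. (\<integral>\<^sup>+\<omega>. ennreal ((trQ \<omega> - E) ^ 4) \<partial>M) \<le> ennreal (100 * (2 / t) ^ 4 * (\<kappa> * m)\<^sup>2) \<and>
      \<bar>E - (\<Sum>i<N. minv N (wgram n A t (weight t \<tau>') (weight t \<tau>)) i i)\<bar> \<le> 2 * t * \<kappa> * bracket_const * sqrt m"
    unfolding Q transfer[OF mQ]
    by (rule exI[of _ "\<integral>x. (\<Sum>i<N. Q x i i) \<partial>P"])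
       (intro conjI resolvent_trace_deviation mean_equivalent big \<tau>0 \<tau>'0 \<tau> \<tau>')
  show "\<exists>E. (\<integral>\<^sup>+\<omega>. ennreal ((trq \<omega> - E) ^ 4) \<partial>M) \<le> ennreal (100 * (2 / t) ^ 4 * (\<kappa> * m)\<^sup>2) \<and>
      \<bar>E - (\<Sum>j<n. minv n (wgram N (transp A) t (weight t \<tau>) (weight t \<tau>')) j j)\<bar> \<le> 2 * t * \<kappa> * bracket_const * sqrt m"
    unfolding q transfer[OF mq]
    by (rule exI[of _ "\<integral>x. (\<Sum>j<n. q x j) \<partial>P"])
       (intro conjI co_resolvent_trace_deviation co_mean_equivalent big \<tau>0 \<tau>'0 \<tau> \<tau>')
qed

section \<open>Negative points, normalized traces and their limits\<close>

lemma resolvent_trace_negative: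
  assumes S: "S \<in> carrier_mat N n" and t: "t > 0"
  shows "mat_trace (resolvent S (- complex_of_real t)) =
    complex_of_real (\<Sum>i<N. minv N (gram n (\<lambda>i j. S $$ (i, j)) t) i i)"
proof -
  let ?z = "- complex_of_real t"
  have z: "?z \<notin> \<real>\<^sub>\<ge>\<^sub>0" "?z \<noteq> 0" using t by (auto simp: complex_nonneg_Reals_iff)
  have g: "minv N (wgram n (\<lambda>i j. S $$ (i, j)) t (\<lambda>_. 1 / t) (\<lambda>_. 1 / t)) = minv N (gram n (\<lambda>i j. S $$ (i, j)) t)"
    using t by (intro minv_cong) (auto simp: wgram_def gram_def sum_distrib_left intro!: sum.cong)
  have "mat_trace (resolvent S ?z) = (\<Sum>i<N. complex_of_real (minv N (wgram n (\<lambda>i j. S $$ (i, j)) t (\<lambda>_. 1 / t) (\<lambda>_. 1 / t)) i i))"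
    unfolding resolvent_eq_T_mat[OF S z(2)] T_mat_trace[OF S neg_inverse_stieltjes neg_inverse_stieltjes z(1)]
    using t by (intro sum.cong refl T_mat_diag_negative[OF S neg_inverse_stieltjes neg_inverse_stieltjes t]) auto
  thus ?thesis by (simp add: g)
qed

lemma mat_trace_diag_mult:
  assumes "B \<in> carrier_mat n n"
  shows "mat_trace (mat_diag n f * B) = (\<Sum>i<n. f i * B $$ (i, i))"
  using assms by (simp add: mat_trace_def mat_diag_mult_left[of _ n n])

text \<open>At -t the solution has real weights, so the complex system becomes a real fixed point
  equation for \<tau> = 1/n Tr D T and \<tau>' = 1/n Tr D' T', the form in which the contraction
  argument consumes it.\<close>

lemma fundamental_solution_negative:
  assumes sol: "is_fundamental_solution N n \<sigma> A \<psi> \<psi>'" and A: "A \<in> carrier_mat N n" and n: "n \<ge> 1" and t: "t > 0"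
  defines "a \<equiv> \<lambda>i j. A $$ (i, j)" and "r \<equiv> \<lambda>i j. \<sigma> i j / sqrt (real n)"
  shows "\<exists>\<tau> \<tau>'. (\<forall>j<n. 0 \<le> \<tau> j \<and> \<tau> j = (\<Sum>i<N. (r i j)\<^sup>2 * minv N (wgram n a t (weight t \<tau>') (weight t \<tau>)) i i)) \<and>
     (\<forall>i<N. 0 \<le> \<tau>' i \<and> \<tau>' i = (\<Sum>j<n. (r i j)\<^sup>2 * minv n (wgram N (transp a) t (weight t \<tau>) (weight t \<tau>')) j j)) \<and>
     mat_trace (T_mat N n A \<psi> \<psi>' (- complex_of_real t)) =
       complex_of_real (\<Sum>i<N. minv N (wgram n a t (weight t \<tau>') (weight t \<tau>)) i i) \<and>
     mat_trace (T'_mat N n A \<psi> \<psi>' (- complex_of_real t)) =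
       complex_of_real (\<Sum>j<n. minv n (wgram N (transp a) t (weight t \<tau>) (weight t \<tau>')) j j)"
proof -
  let ?z = "- complex_of_real t"
  have z: "?z \<notin> \<real>\<^sub>\<ge>\<^sub>0" using t by (simp add: complex_nonneg_Reals_iff)
  have \<psi>: "\<psi> i \<in> stieltjes_class" if "i < N" for i using sol that by (simp add: is_fundamental_solution_def)
  have \<psi>': "\<psi>' j \<in> stieltjes_class" if "j < n" for j using sol that by (simp add: is_fundamental_solution_def)
  have At: "transpose_mat A \<in> carrier_mat n N" using A by simp
  have "\<exists>x. i < N \<longrightarrow> 0 < x \<and> x \<le> 1 / t \<and> \<psi> i ?z = complex_of_real x" for i
    using stieltjes_class_negative[OF \<psi> t, of i] by blast
  then obtain b where b: "\<And>i. i < N \<Longrightarrow> 0 < b i \<and> b i \<le> 1 / t" "\<And>i. i < N \<Longrightarrow> \<psi> i ?z = complex_of_real (b i)"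
    by metis
  have "\<exists>x. j < n \<longrightarrow> 0 < x \<and> x \<le> 1 / t \<and> \<psi>' j ?z = complex_of_real x" for j
    using stieltjes_class_negative[OF \<psi>' t, of j] by blast
  then obtain b' where b': "\<And>j. j < n \<Longrightarrow> 0 < b' j \<and> b' j \<le> 1 / t" "\<And>j. j < n \<Longrightarrow> \<psi>' j ?z = complex_of_real (b' j)"
    by metis
  define T where "T = minv N (wgram n a t b b')"
  define T' where "T' = minv n (wgram N (transp a) t b' b)"
  have T: "T_mat N n A \<psi> \<psi>' ?z $$ (i, i) = complex_of_real (T i i)" if "i < N" for i
  proof -
    have "T_mat N n A \<psi> \<psi>' ?z $$ (i, i) = minv N (cwgram n (\<lambda>i j. A $$ (i, j)) \<psi> \<psi>' ?z) i i"
      by (rule T_mat_diag[OF A \<psi> \<psi>' z that])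
    also have "\<dots> = complex_of_real (T i i)"
      unfolding T_def a_def by (rule T_mat_diag_negative[OF A \<psi> \<psi>' t]) (use b b' that in auto)
    finally show ?thesis .
  qed
  have T': "T'_mat N n A \<psi> \<psi>' ?z $$ (j, j) = complex_of_real (T' j j)" if "j < n" for j
  proof -
    have "T'_mat N n A \<psi> \<psi>' ?z $$ (j, j) = minv n (cwgram N (\<lambda>i j. transpose_mat A $$ (i, j)) \<psi>' \<psi> ?z) j j"
      unfolding T'_mat_eq_T_mat by (rule T_mat_diag[OF At \<psi>' \<psi> z that])
    also have "\<dots> = complex_of_real (minv n (wgram N (\<lambda>i j. transpose_mat A $$ (i, j)) t b' b) j j)"
      by (rule T_mat_diag_negative[OF At \<psi>' \<psi> t]) (use b b' that in auto)
    also have "minv n (wgram N (\<lambda>i j. transpose_mat A $$ (i, j)) t b' b) = T'"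
      unfolding T'_def using A by (intro minv_cong) (auto simp: wgram_def a_def intro!: sum.cong)
    finally show ?thesis .
  qed
  have Tc: "T_mat N n A \<psi> \<psi>' ?z \<in> carrier_mat N N" by (rule T_mat_carrier[OF A \<psi> \<psi>' z])
  have T'c: "T'_mat N n A \<psi> \<psi>' ?z \<in> carrier_mat n n"
    unfolding T'_mat_eq_T_mat by (rule T_mat_carrier[OF At \<psi>' \<psi> z])
  define \<tau> where "\<tau> = (\<lambda>j. \<Sum>i<N. (r i j)\<^sup>2 * T i i)"
  define \<tau>' where "\<tau>' = (\<lambda>i. \<Sum>j<n. (r i j)\<^sup>2 * T' j j)"
  have Tpd: "posdef t N (wgram n a t b b')" and T'pd: "posdef t n (wgram N (transp a) t b' b)"
    using b b' by (auto intro!: posdef_wgram t intro: less_imp_le)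
  have pos: "0 \<le> \<tau> j" "0 \<le> \<tau>' i" for i j
    unfolding \<tau>_def \<tau>'_def T_def T'_def
    by (auto intro!: sum_nonneg mult_nonneg_nonneg posdef_minv_diag(1)[OF Tpd] posdef_minv_diag(1)[OF T'pd])
  have r2: "complex_of_real ((r i j)\<^sup>2) = 1 / of_nat n * complex_of_real ((\<sigma> i j)\<^sup>2)" for i j
    by (simp add: r_def power_divide)
  have bw: "b i = weight t \<tau>' i" if i: "i < N" for i
  proof -
    have "complex_of_real (\<tau>' i) = 1 / of_nat n * mat_trace (mat_diag n (\<lambda>j. complex_of_real ((\<sigma> i j)\<^sup>2)) * T'_mat N n A \<psi> \<psi>' ?z)"
      unfolding mat_trace_diag_mult[OF T'c] \<tau>'_def of_real_sum of_real_mult r2 sum_distrib_left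
      by (intro sum.cong refl) (simp add: T' mult.assoc)
    hence "complex_of_real (b i) = - 1 / (?z * (1 + complex_of_real (\<tau>' i)))"
      using sol z i b(2)[OF i] by (simp add: is_fundamental_solution_def)
    also have "\<dots> = complex_of_real (weight t \<tau>' i)" by (simp add: weight_def)
    finally show ?thesis by (simp only: of_real_eq_iff)
  qed
  have b'w: "b' j = weight t \<tau> j" if j: "j < n" for j
  proof -
    have "complex_of_real (\<tau> j) = 1 / of_nat n * mat_trace (mat_diag N (\<lambda>i. complex_of_real ((\<sigma> i j)\<^sup>2)) * T_mat N n A \<psi> \<psi>' ?z)"
      unfolding mat_trace_diag_mult[OF Tc] \<tau>_def of_real_sum of_real_mult r2 sum_distrib_left
      by (intro sum.cong refl) (simp add: T mult.assoc)
    hence "complex_of_real (b' j) = - 1 / (?z * (1 + complex_of_real (\<tau> j)))"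
      using sol z j b'(2)[OF j] by (simp add: is_fundamental_solution_def)
    also have "\<dots> = complex_of_real (weight t \<tau> j)" by (simp add: weight_def)
    finally show ?thesis by (simp only: of_real_eq_iff)
  qed
  have Tw: "T = minv N (wgram n a t (weight t \<tau>') (weight t \<tau>))"
    unfolding T_def by (intro minv_cong) (auto simp: wgram_def bw b'w intro!: sum.cong)
  have T'w: "T' = minv n (wgram N (transp a) t (weight t \<tau>) (weight t \<tau>'))"
    unfolding T'_def by (intro minv_cong) (auto simp: wgram_def bw b'w intro!: sum.cong)
  have "mat_trace (T_mat N n A \<psi> \<psi>' ?z) = complex_of_real (\<Sum>i<N. T i i)"
    using Tc by (simp add: mat_trace_def T)
  moreover have "mat_trace (T'_mat N n A \<psi> \<psi>' ?z) = complex_of_real (\<Sum>j<n. T' j j)"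
    using T'c by (simp add: mat_trace_def T')
  moreover have "\<tau> j = (\<Sum>i<N. (r i j)\<^sup>2 * T i i)" "\<tau>' i = (\<Sum>j<n. (r i j)\<^sup>2 * T' j j)" for i j
    by (simp_all add: \<tau>_def \<tau>'_def)
  ultimately show ?thesis
    using pos unfolding Tw T'w by blast
qed

text \<open>The dimensions \<open>d\<close> and \<open>e\<close> are free so that one statement
  serves the resolvent and, after transposition, the co-resolvent.\<close>

lemma normalized_trace_convergence:
  fixes d e :: "nat \<Rightarrow> nat" and B C :: "nat \<Rightarrow> real mat" and \<phi> \<phi>' :: "nat \<Rightarrow> nat \<Rightarrow> complex \<Rightarrow> complex"
  defines "F \<equiv> \<lambda>n z. 1 / of_nat (d n) * mat_trace (resolvent (B n) z)
     - 1 / of_nat (d n) * mat_trace (T_mat (d n) (e n) (C n) (\<phi> n) (\<phi>' n) z)"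
  assumes d: "\<And>n. n \<ge> n1 \<Longrightarrow> 0 < d n"
    and B: "\<And>n. n \<ge> n1 \<Longrightarrow> B n \<in> carrier_mat (d n) (e n)" and C: "\<And>n. n \<ge> n1 \<Longrightarrow> C n \<in> carrier_mat (d n) (e n)"
    and \<phi>: "\<And>n i. n \<ge> n1 \<Longrightarrow> i < d n \<Longrightarrow> \<phi> n i \<in> stieltjes_class"
    and \<phi>': "\<And>n j. n \<ge> n1 \<Longrightarrow> j < e n \<Longrightarrow> \<phi>' n j \<in> stieltjes_class"
    and t0: "t0 > 0"
    and lim: "\<And>k. (\<lambda>n. F n (- complex_of_real (t0 + 1 / real (Suc k)))) \<longlonglongrightarrow> 0"
    and z: "z \<notin> \<real>\<^sub>\<ge>\<^sub>0"
  shows "(\<lambda>n. F n z) \<longlonglongrightarrow> 0"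
\<comment> \<open>Finitely many indices are skipped because \<open>d n\<close> is known to be
  positive only from \<open>n1\<close> on. The constant 2 counts two normalized traces, each at most
  1 / \<open>slit_gap z\<close>.\<close>
proof (rule LIMSEQ_offset[of _ n1], rule vitali_slit_plane[OF _ _ t0 _ z, where c = 2])
  fix n
  let ?n = "n + n1"
  have n: "?n \<ge> n1" by simp
  have res: "resolvent (B ?n) w = T_mat (d ?n) (e ?n) (B ?n) (\<lambda>_ z. - 1 / z) (\<lambda>_ z. - 1 / z) w"
    if "w \<in> - \<real>\<^sub>\<ge>\<^sub>0" for w
    by (rule resolvent_eq_T_mat[OF B[OF n]]) (use that in auto)
  note TB = T_mat_trace_bound[OF B[OF n] neg_inverse_stieltjes neg_inverse_stieltjes]
  have TC: "cmod (mat_trace (T_mat (d ?n) (e ?n) (C ?n) (\<phi> ?n) (\<phi>' ?n) w)) \<le> real (d ?n) / slit_gap w"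
    if "w \<notin> \<real>\<^sub>\<ge>\<^sub>0" for w
    by (rule T_mat_trace_bound[OF C[OF n] \<phi>[OF n] \<phi>'[OF n] that])
  show "F ?n holomorphic_on - \<real>\<^sub>\<ge>\<^sub>0"
  proof (rule holomorphic_transform)
    show "(\<lambda>z. 1 / of_nat (d ?n) * mat_trace (T_mat (d ?n) (e ?n) (B ?n) (\<lambda>_ z. - 1 / z) (\<lambda>_ z. - 1 / z) z)
     - 1 / of_nat (d ?n) * mat_trace (T_mat (d ?n) (e ?n) (C ?n) (\<phi> ?n) (\<phi>' ?n) z)) holomorphic_on - \<real>\<^sub>\<ge>\<^sub>0"
      by (intro holomorphic_on_diff holomorphic_on_mult holomorphic_on_const
          T_mat_trace_holomorphic[OF B[OF n] neg_inverse_stieltjes neg_inverse_stieltjes]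
          T_mat_trace_holomorphic[OF C[OF n] \<phi>[OF n] \<phi>'[OF n]])
  qed (simp add: F_def res)
  show "cmod (F ?n w) \<le> 2 / slit_gap w" if w: "w \<notin> \<real>\<^sub>\<ge>\<^sub>0" for w
  proof -
    have "cmod (F ?n w) \<le> cmod (1 / of_nat (d ?n) * mat_trace (resolvent (B ?n) w))
        + cmod (1 / of_nat (d ?n) * mat_trace (T_mat (d ?n) (e ?n) (C ?n) (\<phi> ?n) (\<phi>' ?n) w))"
      unfolding F_def by (rule norm_triangle_ineq4)
    also have "\<dots> \<le> 1 / real (d ?n) * (real (d ?n) / slit_gap w) + 1 / real (d ?n) * (real (d ?n) / slit_gap w)"
      using TB[OF w] TC[OF w] res w unfolding norm_mult norm_divide norm_of_nat norm_one
      by (intro add_mono mult_left_mono) auto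
    also have "\<dots> = 2 / slit_gap w" using d[OF n] by simp
    finally show ?thesis .
  qed
next
  show "(\<lambda>n. F (n + n1) (- complex_of_real (t0 + 1 / real (Suc k)))) \<longlonglongrightarrow> 0" for k
    using lim[of k] by (rule LIMSEQ_ignore_initial_segment)
qed

text \<open>The centre E n is within O(sqrt n) of the deterministic T n, and the deviation from E n
  has fourth moment O(n^2). After division by n the first error vanishes and the second has summable
  fourth moments.\<close>

lemma AE_normalized_limit:
  fixes tr :: "nat \<Rightarrow> 'a \<Rightarrow> real" and T :: "nat \<Rightarrow> real"
  assumes n1: "n1 \<ge> 1" and C: "0 \<le> C"
    and meas: "\<And>n. n \<ge> n1 \<Longrightarrow> tr n \<in> borel_measurable M"
    and ex: "\<And>n. n \<ge> n1 \<Longrightarrow> \<exists>E. (\<integral>\<^sup>+\<omega>. ennreal ((tr n \<omega> - E) ^ 4) \<partial>M) \<le> ennreal (C * (real n)\<^sup>2) \<and> \<bar>E - T n\<bar> \<le> D * sqrt (real n)"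
  shows "AE \<omega> in M. (\<lambda>n. (tr n \<omega> - T n) / real n) \<longlonglongrightarrow> 0"
proof -
  have "\<exists>E. n \<ge> n1 \<longrightarrow> (\<integral>\<^sup>+\<omega>. ennreal ((tr n \<omega> - E) ^ 4) \<partial>M) \<le> ennreal (C * (real n)\<^sup>2) \<and> \<bar>E - T n\<bar> \<le> D * sqrt (real n)" for n
    using ex[of n] by blast
  then obtain E where E: "\<And>n. n \<ge> n1 \<Longrightarrow> (\<integral>\<^sup>+\<omega>. ennreal ((tr n \<omega> - E n) ^ 4) \<partial>M) \<le> ennreal (C * (real n)\<^sup>2)"
      "\<And>n. n \<ge> n1 \<Longrightarrow> \<bar>E n - T n\<bar> \<le> D * sqrt (real n)"
    by metis
  \<comment> \<open>Zero before \<open>n1\<close>, where no estimate is available; in particular the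
    index 0 contributes 0 to both sides of the moment bound.\<close>
  define Z where "Z = (\<lambda>n \<omega>. if n \<ge> n1 then (tr n \<omega> - E n) / real n else 0)"
  have "AE \<omega> in M. (\<lambda>n. Z n \<omega>) \<longlonglongrightarrow> 0"
  proof (rule AE_tendsto_zero_fourth_moments[where b = "\<lambda>n. C * inverse ((real n) ^ 2)"])
    show "Z n \<in> borel_measurable M" for n
      using meas[of n] unfolding Z_def by (cases "n \<ge> n1") auto
    show "(\<integral>\<^sup>+\<omega>. ennreal ((Z n \<omega>) ^ 4) \<partial>M) \<le> ennreal (C * inverse ((real n) ^ 2))" for n
    proof (cases "n \<ge> n1")
      case True
      have n: "real n > 0" using True n1 by simp
      have [measurable]: "tr n \<in> borel_measurable M" by (rule meas[OF True])
      have "(\<integral>\<^sup>+\<omega>. ennreal ((Z n \<omega>) ^ 4) \<partial>M) = (\<integral>\<^sup>+\<omega>. ennreal (1 / real n ^ 4) * ennreal ((tr n \<omega> - E n) ^ 4) \<partial>M)"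
        using True by (intro nn_integral_cong) (simp add: Z_def power_divide ennreal_mult[symmetric])
      also have "\<dots> = ennreal (1 / real n ^ 4) * (\<integral>\<^sup>+\<omega>. ennreal ((tr n \<omega> - E n) ^ 4) \<partial>M)"
        by (rule nn_integral_cmult) measurable
      also have "\<dots> \<le> ennreal (1 / real n ^ 4) * ennreal (C * (real n)\<^sup>2)" by (intro mult_left_mono E True) simp
      also have "\<dots> = ennreal (1 / real n ^ 4 * (C * (real n)\<^sup>2))" using C by (simp add: ennreal_mult[symmetric])
      also have "1 / real n ^ 4 * (C * (real n)\<^sup>2) = C * inverse ((real n) ^ 2)"
        using n by (simp add: power2_eq_square power4_eq_xxxx field_simps)
      finally show ?thesis .
    qed (simp add: Z_def)
    show "summable (\<lambda>n. C * inverse ((real n) ^ 2))"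
      by (intro summable_mult inverse_power_summable) simp
  qed (use C in simp)
  thus ?thesis
  proof eventually_elim
    case (elim \<omega>)
    have "(\<lambda>n. (E n - T n) / real n) \<longlonglongrightarrow> 0"
    proof (rule Lim_null_comparison)
      show "eventually (\<lambda>n. norm ((E n - T n) / real n) \<le> D * inverse (sqrt (real n))) sequentially"
        using eventually_ge_at_top[of n1]
      proof eventually_elim
        case (elim n)
        have n: "real n > 0" using elim n1 by simp
        have "\<bar>E n - T n\<bar> / real n \<le> D * sqrt (real n) / real n" using E(2)[OF elim] n by (intro divide_right_mono) auto
        also have "\<dots> = D * (sqrt (real n) / real n)" by simp
        also have "sqrt (real n) / real n = inverse (sqrt (real n))" using n by (simp add: field_simps)
        finally show ?case by simp
      qed
      have "(\<lambda>n. D * inverse (sqrt (real n))) \<longlonglongrightarrow> D * 0"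
        by (intro tendsto_mult tendsto_const tendsto_inverse_0_at_top filterlim_compose[OF sqrt_at_top filterlim_real_sequentially])
      thus "(\<lambda>n. D * inverse (sqrt (real n))) \<longlonglongrightarrow> 0" by simp
    qed
    from tendsto_add[OF elim this] have "(\<lambda>n. Z n \<omega> + (E n - T n) / real n) \<longlonglongrightarrow> 0" by simp
    thus ?case
      by (rule Lim_transform_eventually)
         (use eventually_ge_at_top[of n1] in eventually_elim, simp add: Z_def diff_divide_distrib)
  qed
qed

section \<open>The law of the given array and the final assembly\<close>

lemma entry_law_distr:
  assumes "prob_space M" and X: "X \<in> borel_measurable M"
    and mean: "(\<integral>\<omega>. X \<omega> \<partial>M) = 0" and var: "(\<integral>\<omega>. (X \<omega>)\<^sup>2 \<partial>M) = 1"
    and mom: "\<epsilon> > 0" "integrable M (\<lambda>\<omega>. \<bar>X \<omega>\<bar> powr (4 + \<epsilon>))"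
  shows "entry_law (distr M borel X) (\<integral>x. x ^ 4 \<partial>distr M borel X)"
proof -
  interpret prob_space M by fact
  have le: "\<bar>y ^ 4\<bar> \<le> 1 + \<bar>y\<bar> powr (4 + \<epsilon>)" for y :: real
  proof (cases "\<bar>y\<bar> \<le> 1")
    case True
    hence "\<bar>y\<bar> ^ 4 \<le> 1" by (intro power_le_one) auto
    thus ?thesis by (simp add: power_abs[symmetric] add_increasing2)
  next
    case False
    hence "\<bar>y\<bar> ^ 4 = \<bar>y\<bar> powr 4" by simp
    also have "\<dots> \<le> \<bar>y\<bar> powr (4 + \<epsilon>)" using False mom by (intro powr_mono) auto
    finally show ?thesis by (simp add: power_abs)
  qed
  have i: "integrable M (\<lambda>\<omega>. 1 + \<bar>X \<omega>\<bar> powr (4 + \<epsilon>))" using mom by simp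
  have i4: "integrable M (\<lambda>\<omega>. X \<omega> ^ 4)"
  proof (rule Bochner_Integration.integrable_bound[OF i])
    show "(\<lambda>\<omega>. X \<omega> ^ 4) \<in> borel_measurable M" using X by measurable
    show "AE \<omega> in M. norm (X \<omega> ^ 4) \<le> norm (1 + \<bar>X \<omega>\<bar> powr (4 + \<epsilon>))"
      unfolding real_norm_def by (intro AE_I2 order_trans[OF le abs_ge_self])
  qed
  show ?thesis
  proof (intro entry_law.intro entry_law_axioms.intro)
    show "prob_space (distr M borel X)" by (rule prob_space_distr[OF X])
    show "integrable (distr M borel X) (\<lambda>x. x ^ 4)" using i4 X by (subst integrable_distr_eq) auto
    show "(\<integral>x. x \<partial>distr M borel X) = 0" using X mean by (subst integral_distr) auto
    show "(\<integral>x. x\<^sup>2 \<partial>distr M borel X) = 1" using X var by (subst integral_distr) auto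
  qed auto
qed

text \<open>Independence is given for a family indexed by triples. The slice with fixed n is the
  subfamily over the image of \<open>J\<close> under \<open>Pair n\<close>; its joint law is a
  product measure, which reindexing carries over to pairs.\<close>

lemma (in prob_space) indep_vars_distr_array:
  fixes X :: "'n \<Rightarrow> 'i \<Rightarrow> 'j \<Rightarrow> 'a \<Rightarrow> real" and n :: 'n
  assumes indep: "indep_vars (\<lambda>_. borel) (\<lambda>(n, i, j). X n i j) I"
    and J: "J \<noteq> {}" "\<And>i j. (i, j) \<in> J \<Longrightarrow> (n, i, j) \<in> I"
    and law: "\<And>i j. (i, j) \<in> J \<Longrightarrow> distr M borel (X n i j) = \<mu>" and sets: "sets \<mu> = sets borel"
  defines "x \<equiv> \<lambda>\<omega>. \<lambda>p\<in>J. X n (fst p) (snd p) \<omega>"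
  shows "x \<in> measurable M (PiM J (\<lambda>_. \<mu>))" "distr M (PiM J (\<lambda>_. \<mu>)) x = PiM J (\<lambda>_. \<mu>)"
proof -
  have rv: "X n i j \<in> borel_measurable M" if "(i, j) \<in> J" for i j
    using indep J(2)[OF that] unfolding indep_vars_def by auto
  have spm: "sets (PiM J (\<lambda>_. \<mu>)) = sets (PiM J (\<lambda>_. borel))"
    by (intro sets_PiM_cong) (auto simp: sets)
  have "x \<in> measurable M (PiM J (\<lambda>_. borel))"
    unfolding x_def by (intro measurable_restrict rv) auto
  thus "x \<in> measurable M (PiM J (\<lambda>_. \<mu>))" by (simp add: measurable_cong_sets[OF refl spm])
  let ?K = "Pair n ` J"
  define y where "y = (\<lambda>\<omega>. \<lambda>k\<in>?K. (\<lambda>(n, i, j). X n i j) k \<omega>)"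
  have spK: "sets (PiM ?K (\<lambda>_. \<mu>)) = sets (PiM ?K (\<lambda>_. borel))"
    by (intro sets_PiM_cong) (auto simp: sets)
  have "indep_vars (\<lambda>_. borel) (\<lambda>(n, i, j). X n i j) ?K"
    by (rule indep_vars_subset[OF indep]) (use J in auto)
  hence "distr M (PiM ?K (\<lambda>_. borel)) y = PiM ?K (\<lambda>k. distr M borel ((\<lambda>(n, i, j). X n i j) k))"
    unfolding y_def using J rv by (subst (asm) indep_vars_iff_distr_eq_PiM') auto
  also have "\<dots> = PiM ?K (\<lambda>_. \<mu>)" by (intro PiM_cong) (auto simp: law)
  finally have "distr M (PiM ?K (\<lambda>_. borel)) y = PiM ?K (\<lambda>_. \<mu>)" .
  moreover have "distr M (PiM ?K (\<lambda>_. \<mu>)) y = distr M (PiM ?K (\<lambda>_. borel)) y"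
    by (rule distr_cong) (auto simp: spK)
  ultimately have dy: "distr M (PiM ?K (\<lambda>_. \<mu>)) y = PiM ?K (\<lambda>_. \<mu>)" by simp
  have "y \<in> measurable M (PiM ?K (\<lambda>_. borel))"
    unfolding y_def by (intro measurable_restrict) (auto intro: rv)
  hence ym: "y \<in> measurable M (PiM ?K (\<lambda>_. \<mu>))" by (simp add: measurable_cong_sets[OF refl spK])
  let ?g = "\<lambda>z. \<lambda>p\<in>J. z (n, p)"
  obtain p0 where "p0 \<in> J" using J by auto
  hence "prob_space \<mu>" using law[of "fst p0" "snd p0"] rv[of "fst p0" "snd p0"] prob_space_distr by auto
  hence "distr (PiM ?K (\<lambda>_. \<mu>)) (PiM J (\<lambda>_. \<mu>)) ?g = PiM J (\<lambda>_. \<mu>)"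
    by (intro distr_PiM_reindex[where M = "\<lambda>_. \<mu>"]) (auto simp: inj_on_def)
  hence "distr (distr M (PiM ?K (\<lambda>_. \<mu>)) y) (PiM J (\<lambda>_. \<mu>)) ?g = PiM J (\<lambda>_. \<mu>)"
    by (simp only: dy)
  moreover have "distr (distr M (PiM ?K (\<lambda>_. \<mu>)) y) (PiM J (\<lambda>_. \<mu>)) ?g = distr M (PiM J (\<lambda>_. \<mu>)) (?g \<circ> y)"
    by (rule distr_distr[OF _ ym]) (auto intro!: measurable_restrict)
  moreover have "?g \<circ> y = x" by (auto simp: fun_eq_iff y_def x_def)
  ultimately show "distr M (PiM J (\<lambda>_. \<mu>)) x = PiM J (\<lambda>_. \<mu>)" by simp
qed

theorem theorem2p5:
  fixes M :: "'a measure"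
    and N :: "nat \<Rightarrow> nat"
    and c \<sigma>max :: real
    and X :: "nat \<Rightarrow> nat \<Rightarrow> nat \<Rightarrow> 'a \<Rightarrow> real"
    and \<sigma> :: "nat \<Rightarrow> nat \<Rightarrow> nat \<Rightarrow> real"
    and A :: "nat \<Rightarrow> real mat"
    and \<psi> \<psi>' :: "nat \<Rightarrow> nat \<Rightarrow> complex \<Rightarrow> complex"
  defines "I \<equiv> {(n, i, j). n \<ge> 1 \<and> i < N n \<and> j < n}"
  assumes "prob_space M"
    and "c > 0" and "(\<lambda>n. real (N n) / real n) \<longlonglongrightarrow> c"
    and A1_indep: "prob_space.indep_vars M (\<lambda>_. borel) (\<lambda>(n, i, j). X n i j) I"
    and A1_ident: "\<forall>(n, i, j)\<in>I. \<forall>(m, k, l)\<in>I. distr M borel (X n i j) = distr M borel (X m k l)"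
    and A1_centered: "\<forall>(n, i, j)\<in>I. integrable M (X n i j) \<and> (\<integral>\<omega>. X n i j \<omega> \<partial>M) = 0"
    and A1_variance: "\<forall>(n, i, j)\<in>I. integrable M (\<lambda>\<omega>. (X n i j \<omega>)\<^sup>2) \<and> (\<integral>\<omega>. (X n i j \<omega>)\<^sup>2 \<partial>M) = 1"
    and A1_moment: "\<exists>\<epsilon>>0. \<forall>(n, i, j)\<in>I. integrable M (\<lambda>\<omega>. \<bar>X n i j \<omega>\<bar> powr (4 + \<epsilon>))"
    and A2: "\<forall>(n, i, j)\<in>I. \<bar>\<sigma> n i j\<bar> \<le> \<sigma>max"
    and A3_dim: "\<forall>n\<ge>1. A n \<in> carrier_mat (N n) n"
    and A3_bound: "\<exists>B. \<forall>n\<ge>1. (\<forall>k<n. euclidean_norm (Matrix.col (A n) k) \<le> B) \<and>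
                            (\<forall>l<N n. euclidean_norm (Matrix.row (A n) l) \<le> B)"
    and solution: "\<forall>n\<ge>1. is_fundamental_solution (N n) n (\<sigma> n) (A n) (\<psi> n) (\<psi>' n)"
  shows "AE \<omega> in M.
    (\<forall>z. z \<notin> \<real>\<^sub>\<ge>\<^sub>0 \<longrightarrow>
      (\<lambda>n. 1 / of_nat (N n) * mat_trace (resolvent (Sigma_mat (N n) n (\<sigma> n) (A n) (\<lambda>i j. X n i j \<omega>)) z)
         - 1 / of_nat (N n) * mat_trace (T_mat (N n) n (A n) (\<psi> n) (\<psi>' n) z)) \<longlonglongrightarrow> 0) \<and>
    (\<forall>z. z \<notin> \<real>\<^sub>\<ge>\<^sub>0 \<longrightarrow>
      (\<lambda>n. 1 / of_nat n * mat_trace (co_resolvent (Sigma_mat (N n) n (\<sigma> n) (A n) (\<lambda>i j. X n i j \<omega>)) z)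
         - 1 / of_nat n * mat_trace (T'_mat (N n) n (A n) (\<psi> n) (\<psi>' n) z)) \<longlonglongrightarrow> 0)"
proof -
  interpret M: prob_space M by fact
  \<comment> \<open>Any number above c bounds N/n eventually; being at least 1 it also gives n <=
    \<kappa> n, the bound for the other dimension.\<close>
  define \<kappa> where "\<kappa> = c + 1"
  have \<kappa>: "\<kappa> \<ge> 1" using \<open>c > 0\<close> by (simp add: \<kappa>_def)
  \<comment> \<open>The added 1 makes the bound strictly positive even if all \<sigma> vanish, since
    the estimates divide by s.\<close>
  define s where "s = \<sigma>max\<^sup>2 + 1"
  have s: "s > 0" unfolding s_def by (rule add_nonneg_pos) auto
  have "eventually (\<lambda>n. 0 < real (N n) / real n \<and> real (N n) / real n < c + 1) sequentially"
    using order_tendstoD(1)[OF \<open>(\<lambda>n. real (N n) / real n) \<longlonglongrightarrow> c\<close> \<open>c > 0\<close>]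
      order_tendstoD(2)[OF \<open>(\<lambda>n. real (N n) / real n) \<longlonglongrightarrow> c\<close>, of "c + 1"]
    by (auto intro: eventually_conj)
  then obtain n0 where n0: "\<And>n. n \<ge> n0 \<Longrightarrow> 0 < real (N n) / real n \<and> real (N n) / real n < c + 1"
    by (auto simp: eventually_sequentially)
  \<comment> \<open>From here on N n is positive and at most \<kappa> n; as c > 0 this holds
    eventually.\<close>
  define n1 where "n1 = max 1 n0"
  have n1: "n1 \<ge> 1" by (simp add: n1_def)
  have Npos: "N n > 0" and npos: "n > 0" and Nle: "real (N n) \<le> \<kappa> * real n" if "n \<ge> n1" for n
    using n0[of n] that by (auto simp: n1_def \<kappa>_def zero_less_divide_iff pos_divide_less_eq intro: less_imp_le)
  have inI: "(n, i, j) \<in> I" if "n \<ge> n1" "i < N n" "j < n" for n i j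
    using that n1 by (auto simp: I_def)
  have I0: "(n1, 0, 0) \<in> I" using Npos[of n1] n1 by (intro inI) auto
  \<comment> \<open>The common law is read off at one index, which lies in \<open>I\<close> because
    N n1 and n1 are positive.\<close>
  define \<mu> where "\<mu> = distr M borel (X n1 0 0)"
  define m4 where "m4 = (\<integral>x. x ^ 4 \<partial>\<mu>)"
  obtain \<epsilon> where \<epsilon>: "\<epsilon> > 0" "\<forall>(n, i, j)\<in>I. integrable M (\<lambda>\<omega>. \<bar>X n i j \<omega>\<bar> powr (4 + \<epsilon>))"
    using A1_moment by blast
  have law: "entry_law \<mu> m4"
    unfolding \<mu>_def m4_def using I0 A1_centered A1_variance \<epsilon>
    by (intro entry_law_distr[where \<epsilon> = \<epsilon>] \<open>prob_space M\<close>) auto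
  have ident: "distr M borel (X n i j) = \<mu>" if "(n, i, j) \<in> I" for n i j
    unfolding \<mu>_def using A1_ident that I0 by fast
  obtain B where B: "\<And>n k. n \<ge> 1 \<Longrightarrow> k < n \<Longrightarrow> euclidean_norm (Matrix.col (A n) k) \<le> B"
      "\<And>n l. n \<ge> 1 \<Longrightarrow> l < N n \<Longrightarrow> euclidean_norm (Matrix.row (A n) l) \<le> B"
    using A3_bound by blast
  define r where "r = (\<lambda>n i j. \<sigma> n i j / sqrt (real n))"
  define a where "a = (\<lambda>n i j. A n $$ (i, j))"
  have Adim: "A n \<in> carrier_mat (N n) n" if "n \<ge> n1" for n using A3_dim that n1 by auto
  have norm_sq: "v \<bullet> v \<le> B\<^sup>2" if "euclidean_norm v \<le> B" "0 \<le> v \<bullet> v" for v :: "real Matrix.vec"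
    using that power_mono[of "sqrt (v \<bullet> v)" B 2] by (simp add: euclidean_norm_def)
  have col_le: "dot (N n) (colv (a n) j) (colv (a n) j) \<le> B\<^sup>2" if "n \<ge> n1" "j < n" for n j
  proof -
    have "Matrix.col (A n) j \<bullet> Matrix.col (A n) j = dot (N n) (colv (a n) j) (colv (a n) j)"
      using Adim[OF that(1)] that(2) by (simp add: scalar_prod_def dot_def a_def atLeast0LessThan)
    thus ?thesis using norm_sq[of "Matrix.col (A n) j"] B(1)[of n j] that n1 by simp
  qed
  have row_le: "dot n (\<lambda>j. a n i j) (\<lambda>j. a n i j) \<le> B\<^sup>2" if "n \<ge> n1" "i < N n" for n i
  proof -
    have "Matrix.row (A n) i \<bullet> Matrix.row (A n) i = dot n (\<lambda>j. a n i j) (\<lambda>j. a n i j)"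
      using Adim[OF that(1)] that(2) by (simp add: scalar_prod_def dot_def a_def atLeast0LessThan)
    thus ?thesis using norm_sq[of "Matrix.row (A n) i"] B(2)[of n i] that n1 by simp
  qed
  have r_le: "(r n i j)\<^sup>2 \<le> s / real n" if "n \<ge> n1" "i < N n" "j < n" for n i j
  proof -
    have "\<bar>\<sigma> n i j\<bar> \<le> \<sigma>max" using A2 inI[OF that] by auto
    hence "(\<sigma> n i j)\<^sup>2 \<le> \<sigma>max\<^sup>2" by (metis abs_ge_zero power2_abs power_mono)
    thus ?thesis by (simp add: r_def s_def power_divide divide_right_mono)
  qed
  have model: "two_sided_model \<mu> m4 (N n) n (r n) (a n) t (real n) s \<kappa> (B\<^sup>2)" if "n \<ge> n1" "t > 0" for n t
    using that n1 \<kappa> s Nle[OF that(1)] Npos[OF that(1)] npos[OF that(1)] r_le[OF that(1)] col_le[OF that(1)] row_le[OF that(1)]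
      mult_right_mono[OF \<kappa>, of "real n"]
    by (intro two_sided_model.intro noise_model.intro noise_model_axioms.intro two_sided_model_axioms.intro law) auto
  define x where "x = (\<lambda>n \<omega>. \<lambda>p\<in>{..<N n} \<times> {..<n}. X n (fst p) (snd p) \<omega>)"
  have x: "x n \<in> measurable M (PiM ({..<N n} \<times> {..<n}) (\<lambda>_. \<mu>))"
    "distr M (PiM ({..<N n} \<times> {..<n}) (\<lambda>_. \<mu>)) (x n) = PiM ({..<N n} \<times> {..<n}) (\<lambda>_. \<mu>)" if "n \<ge> n1" for n
  proof -
    have ne: "{..<N n} \<times> {..<n} \<noteq> {}" using Npos[OF that] npos[OF that] by auto
    have law': "sets \<mu> = sets borel" by (simp add: \<mu>_def)
    show "x n \<in> measurable M (PiM ({..<N n} \<times> {..<n}) (\<lambda>_. \<mu>))"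
      unfolding x_def
      by (rule M.indep_vars_distr_array(1)[OF A1_indep ne _ _ law']) (use inI that ident in auto)
    show "distr M (PiM ({..<N n} \<times> {..<n}) (\<lambda>_. \<mu>)) (x n) = PiM ({..<N n} \<times> {..<n}) (\<lambda>_. \<mu>)"
      unfolding x_def
      by (rule M.indep_vars_distr_array(2)[OF A1_indep ne _ _ law']) (use inI that ident in auto)
  qed
  \<comment> \<open>For t >= t0 one has t >= 1, hence \<kappa> s / t <= \<kappa> s, and the second
    entry of the maximum then yields the contraction condition \<open>big\<close>.\<close>
  define t0 where "t0 = max 1 (2 * \<kappa> * s * (2 + \<kappa> * s))"
  have t0: "t0 > 0" by (simp add: t0_def)
  define F where "F = (\<lambda>\<omega> n z. 1 / of_nat (N n) * mat_trace (resolvent (Sigma_mat (N n) n (\<sigma> n) (A n) (\<lambda>i j. X n i j \<omega>)) z)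
         - 1 / of_nat (N n) * mat_trace (T_mat (N n) n (A n) (\<psi> n) (\<psi>' n) z) :: complex)"
  define G where "G = (\<lambda>\<omega> n z. 1 / of_nat n * mat_trace (co_resolvent (Sigma_mat (N n) n (\<sigma> n) (A n) (\<lambda>i j. X n i j \<omega>)) z)
         - 1 / of_nat n * mat_trace (T'_mat (N n) n (A n) (\<psi> n) (\<psi>' n) z) :: complex)"
  have Sdim: "Sigma_mat (N n) n (\<sigma> n) (A n) y \<in> carrier_mat (N n) n" if "n \<ge> n1" for n y
    using Adim[OF that] by (auto simp: Sigma_mat_def)
  have Sentry: "Sigma_mat (N n) n (\<sigma> n) (A n) (\<lambda>i j. X n i j \<omega>) $$ (i, j) = r n i j * X n i j \<omega> + a n i j"
    if "n \<ge> n1" "i < N n" "j < n" for n i j \<omega>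
    using Adim[OF that(1)] that by (simp add: Sigma_mat_def r_def a_def)
  have fixed_t: "AE \<omega> in M. (\<lambda>n. F \<omega> n (- complex_of_real t)) \<longlonglongrightarrow> 0 \<and> (\<lambda>n. G \<omega> n (- complex_of_real t)) \<longlonglongrightarrow> 0"
    if t: "t \<ge> t0" for t
  proof -
    have t1: "t \<ge> 1" "t > 0" using t by (auto simp: t0_def)
    have big: "\<kappa> * s * (2 + \<kappa> * s / t) / t \<le> 1 / 2"
    proof -
      have ks: "0 \<le> \<kappa> * s" using \<kappa> s by simp
      have "\<kappa> * s / t \<le> \<kappa> * s / 1" using t1 ks by (intro divide_left_mono) auto
      hence "\<kappa> * s * (2 + \<kappa> * s / t) \<le> \<kappa> * s * (2 + \<kappa> * s)" using ks by (intro mult_left_mono) auto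
      also have "\<dots> \<le> t / 2" using t by (simp add: t0_def)
      finally show ?thesis using t1 by (simp add: field_simps)
    qed
    define \<Phi> where "\<Phi> = (\<lambda>n \<tau> \<tau>'. (\<forall>j<n. 0 \<le> \<tau> j \<and> \<tau> j = (\<Sum>i<N n. (r n i j)\<^sup>2 * minv (N n) (wgram n (a n) t (weight t \<tau>') (weight t \<tau>)) i i)) \<and>
       (\<forall>i<N n. 0 \<le> \<tau>' i \<and> \<tau>' i = (\<Sum>j<n. (r n i j)\<^sup>2 * minv n (wgram (N n) (transp (a n)) t (weight t \<tau>) (weight t \<tau>')) j j)) \<and>
       mat_trace (T_mat (N n) n (A n) (\<psi> n) (\<psi>' n) (- complex_of_real t)) =
         complex_of_real (\<Sum>i<N n. minv (N n) (wgram n (a n) t (weight t \<tau>') (weight t \<tau>)) i i) \<and>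
       mat_trace (T'_mat (N n) n (A n) (\<psi> n) (\<psi>' n) (- complex_of_real t)) =
         complex_of_real (\<Sum>j<n. minv n (wgram (N n) (transp (a n)) t (weight t \<tau>) (weight t \<tau>')) j j))"
    have "\<exists>\<tau> \<tau>'. n \<ge> n1 \<longrightarrow> \<Phi> n \<tau> \<tau>'" for n
    proof (cases "n \<ge> n1")
      case True
      hence n: "n \<ge> 1" using n1 by simp
      have "is_fundamental_solution (N n) n (\<sigma> n) (A n) (\<psi> n) (\<psi>' n)" using solution n by blast
      from fundamental_solution_negative[OF this Adim[OF True] n t1(2)]
      show ?thesis unfolding \<Phi>_def r_def a_def by blast
    qed auto
    then obtain \<tau> \<tau>' where \<Phi>: "\<And>n. n \<ge> n1 \<Longrightarrow> \<Phi> n (\<tau> n) (\<tau>' n)" by metis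
    define T where "T = (\<lambda>n. \<Sum>i<N n. minv (N n) (wgram n (a n) t (weight t (\<tau>' n)) (weight t (\<tau> n))) i i)"
    define T' where "T' = (\<lambda>n. \<Sum>j<n. minv n (wgram (N n) (transp (a n)) t (weight t (\<tau> n)) (weight t (\<tau>' n))) j j)"
    define trQ where "trQ = (\<lambda>n \<omega>. \<Sum>i<N n. minv (N n) (gram n (\<lambda>i j. r n i j * X n i j \<omega> + a n i j) t) i i)"
    define trq where "trq = (\<lambda>n \<omega>. \<Sum>j<n. minv n (gram (N n) (\<lambda>j i. r n i j * X n i j \<omega> + a n i j) t) j j)"
    define C where "C = 100 * (2 / t) ^ 4 * \<kappa>\<^sup>2"
    \<comment> \<open>The constant involves only m4, t, s, \<kappa> and B, so \<open>D\<close> is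
      the same for all n.\<close>
    define D where "D = 2 * t * \<kappa> * noise_model.bracket_const m4 t s \<kappa> (B\<^sup>2)"
    have C: "0 \<le> C" using t1 by (simp add: C_def)
    have Cn: "C * (real n)\<^sup>2 = 100 * (2 / t) ^ 4 * (\<kappa> * real n)\<^sup>2" for n
      by (simp add: C_def power_mult_distrib)
    have est: "trQ n \<in> borel_measurable M" "trq n \<in> borel_measurable M"
      "\<exists>E. (\<integral>\<^sup>+\<omega>. ennreal ((trQ n \<omega> - E) ^ 4) \<partial>M) \<le> ennreal (C * (real n)\<^sup>2) \<and> \<bar>E - T n\<bar> \<le> D * sqrt (real n)"
      "\<exists>E. (\<integral>\<^sup>+\<omega>. ennreal ((trq n \<omega> - E) ^ 4) \<partial>M) \<le> ennreal (C * (real n)\<^sup>2) \<and> \<bar>E - T' n\<bar> \<le> D * sqrt (real n)"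
      if n: "n \<ge> n1" for n
    proof -
      interpret two_sided_model \<mu> m4 "N n" n "r n" "a n" t "real n" s \<kappa> "B\<^sup>2" by (rule model[OF n t1(2)])
      have xX: "\<And>i j \<omega>. i < N n \<Longrightarrow> j < n \<Longrightarrow> x n \<omega> (i, j) = X n i j \<omega>" by (simp add: x_def)
      note P = \<Phi>[OF n, unfolded \<Phi>_def]
      have "\<And>j. j < n \<Longrightarrow> 0 \<le> \<tau> n j" "\<And>i. i < N n \<Longrightarrow> 0 \<le> \<tau>' n i"
        "\<And>j. j < n \<Longrightarrow> \<tau> n j = (\<Sum>i<N n. (r n i j)\<^sup>2 * minv (N n) (wgram n (a n) t (weight t (\<tau>' n)) (weight t (\<tau> n))) i i)"
        "\<And>i. i < N n \<Longrightarrow> \<tau>' n i = (\<Sum>j<n. (r n i j)\<^sup>2 * minv n (wgram (N n) (transp (a n)) t (weight t (\<tau> n)) (weight t (\<tau>' n))) j j)"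
        using P by blast+
      note est = sample_estimates[OF x[OF n] xX big this]
      show "trQ n \<in> borel_measurable M" unfolding trQ_def by (rule est(1))
      show "trq n \<in> borel_measurable M" unfolding trq_def by (rule est(2))
      show "\<exists>E. (\<integral>\<^sup>+\<omega>. ennreal ((trQ n \<omega> - E) ^ 4) \<partial>M) \<le> ennreal (C * (real n)\<^sup>2) \<and> \<bar>E - T n\<bar> \<le> D * sqrt (real n)"
        unfolding trQ_def Cn T_def D_def by (rule est(3))
      show "\<exists>E. (\<integral>\<^sup>+\<omega>. ennreal ((trq n \<omega> - E) ^ 4) \<partial>M) \<le> ennreal (C * (real n)\<^sup>2) \<and> \<bar>E - T' n\<bar> \<le> D * sqrt (real n)"
        unfolding trq_def Cn T'_def D_def by (rule est(4))
    qed
    have Fn: "F \<omega> n (- complex_of_real t) = complex_of_real (inverse (real (N n) / real n) * ((trQ n \<omega> - T n) / real n))"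
      if n: "n \<ge> n1" for n \<omega>
    proof -
      let ?S = "Sigma_mat (N n) n (\<sigma> n) (A n) (\<lambda>i j. X n i j \<omega>)"
      have "minv (N n) (gram n (\<lambda>i j. ?S $$ (i, j)) t) = minv (N n) (gram n (\<lambda>i j. r n i j * X n i j \<omega> + a n i j) t)"
        by (intro minv_cong) (auto simp: gram_def Sentry[OF n] intro!: sum.cong)
      hence "mat_trace (resolvent ?S (- complex_of_real t)) = complex_of_real (trQ n \<omega>)"
        by (simp add: resolvent_trace_negative[OF Sdim[OF n] t1(2)] trQ_def)
      moreover have "mat_trace (T_mat (N n) n (A n) (\<psi> n) (\<psi>' n) (- complex_of_real t)) = complex_of_real (T n)"
        using \<Phi>[OF n] unfolding \<Phi>_def T_def by blast
      ultimately have F: "F \<omega> n (- complex_of_real t) = complex_of_real ((trQ n \<omega> - T n) / real (N n))"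
        by (simp add: F_def diff_divide_distrib)
      have "inverse (real (N n) / real n) * (y / real n) = y / real (N n)" for y
        using npos[OF n] by (simp add: field_simps)
      thus ?thesis unfolding F by (simp only:)
    qed
    have Gn: "G \<omega> n (- complex_of_real t) = complex_of_real ((trq n \<omega> - T' n) / real n)"
      if n: "n \<ge> n1" for n \<omega>
    proof -
      let ?S = "Sigma_mat (N n) n (\<sigma> n) (A n) (\<lambda>i j. X n i j \<omega>)"
      have St: "transpose_mat ?S \<in> carrier_mat n (N n)" using Sdim[OF n] by simp
      have "minv n (gram (N n) (\<lambda>j i. transpose_mat ?S $$ (j, i)) t) = minv n (gram (N n) (\<lambda>j i. r n i j * X n i j \<omega> + a n i j) t)"
        using carrier_matD[OF Sdim[OF n]] by (intro minv_cong) (auto simp: gram_def Sentry[OF n] intro!: sum.cong)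
      hence "mat_trace (co_resolvent ?S (- complex_of_real t)) = complex_of_real (trq n \<omega>)"
        unfolding co_resolvent_eq_resolvent resolvent_trace_negative[OF St t1(2)] trq_def by simp
      moreover have "mat_trace (T'_mat (N n) n (A n) (\<psi> n) (\<psi>' n) (- complex_of_real t)) = complex_of_real (T' n)"
        using \<Phi>[OF n] unfolding \<Phi>_def T'_def by blast
      ultimately show ?thesis by (simp add: G_def diff_divide_distrib)
    qed
    have "AE \<omega> in M. (\<lambda>n. (trQ n \<omega> - T n) / real n) \<longlonglongrightarrow> 0"
      by (rule AE_normalized_limit[OF n1 C est(1,3)])
    moreover have "AE \<omega> in M. (\<lambda>n. (trq n \<omega> - T' n) / real n) \<longlonglongrightarrow> 0"
      by (rule AE_normalized_limit[OF n1 C est(2,4)])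
    ultimately show ?thesis
    proof eventually_elim
      case (elim \<omega>)
      \<comment> \<open>The estimate for the resolvent trace is normalized by n; the factor n / N
        tends to 1 / c.\<close>
      have "(\<lambda>n. inverse (real (N n) / real n) * ((trQ n \<omega> - T n) / real n)) \<longlonglongrightarrow> inverse c * 0"
        using \<open>c > 0\<close> by (intro tendsto_mult tendsto_inverse elim assms) auto
      hence "(\<lambda>n. complex_of_real (inverse (real (N n) / real n) * ((trQ n \<omega> - T n) / real n))) \<longlonglongrightarrow> 0"
        using tendsto_of_real by fastforce
      hence 1: "(\<lambda>n. F \<omega> n (- complex_of_real t)) \<longlonglongrightarrow> 0"
        by (rule Lim_transform_eventually)
           (use eventually_ge_at_top[of n1] in eventually_elim, simp only: Fn)
      have "(\<lambda>n. complex_of_real ((trq n \<omega> - T' n) / real n)) \<longlonglongrightarrow> complex_of_real 0"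
        by (intro tendsto_of_real elim)
      hence "(\<lambda>n. complex_of_real ((trq n \<omega> - T' n) / real n)) \<longlonglongrightarrow> 0" by simp
      hence 2: "(\<lambda>n. G \<omega> n (- complex_of_real t)) \<longlonglongrightarrow> 0"
        by (rule Lim_transform_eventually)
           (use eventually_ge_at_top[of n1] in eventually_elim, simp only: Gn)
      show ?case using 1 2 by blast
    qed
  qed
  \<comment> \<open>Only countably many points are used, so one null set serves them all. For each
    remaining sample the extension to every z is deterministic, which places the quantifier over z
    inside the almost sure statement.\<close>
  have "AE \<omega> in M. \<forall>k. (\<lambda>n. F \<omega> n (- complex_of_real (t0 + 1 / real (Suc k)))) \<longlonglongrightarrow> 0 \<and>
      (\<lambda>n. G \<omega> n (- complex_of_real (t0 + 1 / real (Suc k)))) \<longlonglongrightarrow> 0"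
    unfolding AE_all_countable by (intro allI fixed_t) simp
  thus ?thesis
  proof eventually_elim
    case (elim \<omega>)
    let ?S = "\<lambda>n. Sigma_mat (N n) n (\<sigma> n) (A n) (\<lambda>i j. X n i j \<omega>)"
    have cls: "\<psi> n i \<in> stieltjes_class" if "n \<ge> n1" "i < N n" for n i
      using solution that n1 by (auto simp: is_fundamental_solution_def)
    have cls': "\<psi>' n j \<in> stieltjes_class" if "n \<ge> n1" "j < n" for n j
      using solution that n1 by (auto simp: is_fundamental_solution_def)
    have "(\<lambda>n. F \<omega> n z) \<longlonglongrightarrow> 0" if "z \<notin> \<real>\<^sub>\<ge>\<^sub>0" for z
      unfolding F_def
      by (rule normalized_trace_convergence[where ?n1.0 = n1 and ?t0.0 = t0])
         (use Npos Sdim Adim cls cls' t0 that elim in \<open>auto simp: F_def\<close>)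
    moreover have "(\<lambda>n. G \<omega> n z) \<longlonglongrightarrow> 0" if "z \<notin> \<real>\<^sub>\<ge>\<^sub>0" for z
      unfolding G_def co_resolvent_eq_resolvent T'_mat_eq_T_mat
      by (rule normalized_trace_convergence[where ?n1.0 = n1 and ?t0.0 = t0])
         (use npos Sdim Adim cls cls' t0 that elim in \<open>auto simp: G_def co_resolvent_eq_resolvent T'_mat_eq_T_mat\<close>)
    ultimately show ?case unfolding F_def G_def by blast
  qed
qed

end
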